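(* Fix $N\in\mathbb N$ and $\epsilon>0$. Suppose that $q=q(\mathbf t,x):\mathbb R^{N+1}\times\mathbb R\to\mathbb C$ is formally (i.e. with as much smoothness and decay as needed) a nowhere vanishing solution, with nonzero boundary conditions, of the $N$-truncated NLS hierarchy $$i\partial_{t_n}q=\frac{\delta\mathcal H^{NLS}_n(q)}{\delta\overline q}\qquad\forall\,n\in\{0,\dots,N\}.$$ Let $W=(W_+,W_-)(\mathbf T,X)$ be defined from $q$ by the ansatz $$q(\mathbf t,x)=\Big(1+\frac{\epsilon^2}{2}(W_+-W_-)(\mathbf T,X)\Big)\exp\Big(i\frac{\epsilon}{\sqrt2}\int_0^X(W_++W_-)(\mathbf T,Y)\,dY\Big)e^{i\phi(\mathbf t)},$$ where $X=\sqrt2\,\epsilon x$, $T_{2n}=2(\sqrt2\epsilon)^{2n-1}t_{2n}$, $T_{2n-1}=(\sqrt2\epsilon)^{2n-1}t_{2n-1}$ and $\phi$ is real and independent of $x$. Then $\mathbf T\mapsto W(\mathbf c\,\mathbf T)$, where $\mathbf c=\mathbf c^{NLS\mapsto\epsilon\widetilde{GP}}$, solves the $N$-truncated $\epsilon\widetilde{GP}$ hierarchy and, for every $n\in\{0,\dots,N\}$, $$\frac{d}{dT_n}W(\mathbf c\,\mathbf T)=\begin{pmatrix}-(-1)^n\frac12\partial_X\big[(\mathcal E^{KdV}_{\lfloor\frac{n-1}2\rfloor})'\big(W_+(\mathbf c\,\mathbf T)\big)\big]\\[2pt]-\frac12\partial_X\big[(\mathcal E^{KdV}_{\lfloor\frac{n-1}2\rfloor})'\big(-W_-(\mathbf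 c\,\mathbf T)\big)\big]\end{pmatrix}+\epsilon^2\,\mathbf R_n\big[W(\mathbf c\,\mathbf T)\big].$$ Correspondingly, $W(\mathbf T)$ solves $$\partial_{T_{2n}}W(\mathbf T)=\sum_{m=0}^n\binom{n-\frac12}{n-m}\Big(\frac2{\epsilon^2}\Big)^{n-m}\left(\begin{pmatrix}-\frac12\partial_X(\mathcal E^{KdV}_{m-1})'(W_+(\mathbf T))\\-\frac12\partial_X(\mathcal E^{KdV}_{m-1})'(-W_-(\mathbf T))\end{pmatrix}+\epsilon^2\mathbf R_{2m}[W(\mathbf T)]\right)$$ for $0\le 2n\le N$, and $$\partial_{T_{2n-1}}W(\mathbf T)=\sum_{m=0}^n\binom{n-\frac12}{n-m}\Big(\frac2{\epsilon^2}\Big)^{n-m}\left(\begin{pmatrix}\frac12\partial_X(\mathcal E^{KdV}_{m-1})'(W_+(\mathbf T))\\-\frac12\partial_X(\mathcal E^{KdV}_{m-1})'(-W_-(\mathbf T))\end{pmatrix}+\epsilon^2\mathbf R_{2m-1}[W(\mathbf T)]\right)$$ for $1\le 2n-1\le N$.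
   Context: Notation: $\mathbf t=(t_0,\dots,t_N)$, $\mathbf T=(T_0,\dots,T_N)$. For a functional $\mathcal E(U)=\int e\,dX$ with differential-polynomial density, $\mathcal E'(U)=\delta\mathcal E/\delta U$ is its variational (Euler) derivative; $\mathcal E'(-W_-)$ means $\mathcal E'$ evaluated at $U=-W_-$. The nonzero boundary conditions are $\lim_{x\to\pm\infty}q(\mathbf t,x)e^{-i\psi(\mathbf t)}=q_\pm$ with $|q_\pm|=1$, for some real $\psi(\mathbf t)$; correspondingly $W\to0$ as $|X|\to\infty$. Equivalently, $W_\pm(\mathbf T,X)=\epsilon^{-2}\big(\tfrac12\operatorname{Im}\tfrac{q_x}{q}\pm(|q|-1)\big)(\mathbf t,x)$. NLS Hamiltonians: $\sigma^{NLS}_0=0$, $\sigma^{NLS}_1=-q\overline q$, $\sigma^{NLS}_{n+1}=\partial_x\sigma^{NLS}_n-\frac{q_x}q\sigma^{NLS}_n+\sum_{k=0}^n\sigma^{NLS}_k\sigma^{NLS}_{n-k}$ for $n\ge1$, and $\mathcal H^{NLS}_n(q)=-(-i)^n\int_{\mathbb R}\sigma^{NLS}_{n+1}\,dx$ (only the variational derivatives $\delta\mathcal H_n^{NLS}/\delta\overline q$, which are differential polynomials in $q,\overline q$, are used). Hamiltonians $\mathcal H^{\epsilon GP}_n$: Let $y$ be a formal variable and $\lambda=\sum_{n\ge-1}c_ny^{-n}$ the formal Laurent series with $\lambda^2=1-\frac{\epsilon^2}2y^2$, $c_{-1}=-\frac{i\epsilon}{\sqrt2}$. Let $r=\sum_{n\ge0}r_ny^{-n}$,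 $\sigma=\sum_{n\ge0}\sigma_ny^{-n}$ be the unique formal power series, with coefficients differential polynomials in $W_\pm$, such that $r_0=1$ and $$\partial_Xr=\tfrac{i\epsilon}{\sqrt2}\big(\epsilon^{-2}(1+\lambda)+W_+\big)r^2+\tfrac{i\epsilon}{\sqrt2}\big(\epsilon^{-2}(1-\lambda)-W_-\big),$$ $$\partial_X\sigma=y\sigma-\sigma^2+\tfrac12\big(-\epsilon^2W_-W_+-(1+\lambda)W_-+(1-\lambda)W_+-i\sqrt2\,\epsilon(\partial_XW_+)r\big).$$ Then $\mathcal H^{\epsilon GP}_n(W)=-(-i)^n(\sqrt2\epsilon)^{n+1}\int\sigma_{n+1}\,dX$ for $n\ge0$, $\mathcal H^{\epsilon GP}_{-1}(W)=-\frac\epsilon{\sqrt2}\int(W_++W_-)\,dX$. Further, for $n\ge0$, $\mathcal H^{\epsilon\widetilde{GP}}_{2n}=\mathcal H^{\epsilon GP}_{2n}$ and $\mathcal H^{\epsilon\widetilde{GP}}_{2n-1}=\sum_{m=0}^n\binom{-1/2}{n-m}4^{n-m}2^{-\mathbf 1_{\{m=0\}}}\mathcal H^{\epsilon GP}_{2m-1}$. KdV energies: $\sigma^{KdV}_0=0$, $\sigma^{KdV}_1=-U$, $\sigma^{KdV}_{n+1}=\partial_X\sigma^{KdV}_n+\sum_{k=0}^n\sigma^{KdV}_k\sigma^{KdV}_{n-k}$ for $n\ge1$; $\mathcal E^{KdV}_n(U)=(-1)^n\int\sigma^{KdV}_{2n+3}\,dX$, $n\ge-1$. The $N$-truncated $\epsilon\widetilde{GP}$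 hierarchy is, for $n\in\{0,\dots,N\}$, with $A=1+\frac{\epsilon^2}2(W_+-W_-)$ (multiplication operator) and $\frac{dt_{2n}}{dT_{2n}}=\frac1{2(\sqrt2\epsilon)^{2n-1}}$, $\frac{dt_{2n-1}}{dT_{2n-1}}=\frac1{(\sqrt2\epsilon)^{2n-1}}$, $$\partial_{T_n}W=\frac{dt_n}{dT_n}\frac1{2\epsilon^2}\begin{pmatrix}-\partial_XA^{-1}-A^{-1}\partial_X&\partial_XA^{-1}-A^{-1}\partial_X\\-\partial_XA^{-1}+A^{-1}\partial_X&\partial_XA^{-1}+A^{-1}\partial_X\end{pmatrix}\begin{pmatrix}\frac{\delta}{\delta W_+}\mathcal H^{\epsilon\widetilde{GP}}_n(W)\\\frac{\delta}{\delta W_-}\mathcal H^{\epsilon\widetilde{GP}}_n(W)\end{pmatrix}.$$ Matrix $\mathbf c=\mathbf c^{NLS\mapsto\epsilon\widetilde{GP}}\in\mathbb R^{(N+1)\times(N+1)}$ (indices $0,\dots,N$): its entry in row $j$, column $l$ is zero if $j,l$ have different parity, equals $\binom{n-\frac12}{n-m}(-\frac2{\epsilon^2})^{n-m}$ if $(l,j)=(2n,2m)$ or $(l,j)=(2n-1,2m-1)$ with $m\le n$, and is zero if $j>l$. Residuals. There are polynomials $\mathbf P_n$, $n\ge-1$, in $\epsilon$, $W_\pm$ and finitely many derivatives of $W_\pm$, such that modulo total derivatives, for $n\ge0$, $$\mathcal H^{\epsilon\widetilde{GP}}_{2n}(W)=\tfrac{(\sqrt2\epsilon)^{2n+1}}2\big(\mathcal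 E^{KdV}_{n-1}(-W_-)+\mathcal E^{KdV}_{n-1}(W_+)+\epsilon^2\!\int\mathbf P_{2n}\,dX\big),$$ $$\mathcal H^{\epsilon\widetilde{GP}}_{2n-1}(W)=\tfrac{(\sqrt2\epsilon)^{2n+1}}4\big(\mathcal E^{KdV}_{n-1}(-W_-)-\mathcal E^{KdV}_{n-1}(W_+)+\epsilon^2\!\int\mathbf P_{2n-1}\,dX\big).$$ With $D=\begin{pmatrix}-\frac12\partial_X&0\\0&\frac12\partial_X\end{pmatrix}$ and $$\mathbf E=\frac{A^{-1}-1}{2\epsilon^2}\begin{pmatrix}-\partial_X&0\\0&\partial_X\end{pmatrix}+\frac{A_XA^{-2}}{4\epsilon^2}\begin{pmatrix}1&-1\\1&-1\end{pmatrix},$$ set $$\mathbf R_{2n}[W]=\mathbf E\begin{pmatrix}\frac\delta{\delta W_+}\mathcal E^{KdV}_{n-1}(W_+)\\\frac\delta{\delta W_-}\mathcal E^{KdV}_{n-1}(-W_-)\end{pmatrix}+(D+\epsilon^2\mathbf E)\begin{pmatrix}\frac\delta{\delta W_+}\int\mathbf P_{2n}dX\\\frac\delta{\delta W_-}\int\mathbf P_{2n}dX\end{pmatrix},$$ $$\mathbf R_{2n-1}[W]=\mathbf E\begin{pmatrix}-\frac\delta{\delta W_+}\mathcal E^{KdV}_{n-1}(W_+)\\\frac\delta{\delta W_-}\mathcal E^{KdV}_{n-1}(-W_-)\end{pmatrix}+(D+\epsilon^2\mathbf E)\begin{pmatrix}\frac\delta{\delta W_+}\int\mathbf P_{2n-1}dX\\\frac\delta{\delta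 W_-}\int\mathbf P_{2n-1}dX\end{pmatrix}.$$ *)

theory Defs
  imports
    "HOL-Analysis.Analysis"
    "HOL-Library.Poly_Mapping"
    "HOL-Computational_Algebra.Formal_Laurent_Series"
begin

section \<open>Differential polynomials\<close>

text \<open>
  A differential polynomial in the fields indexed by \<open>'v\<close> is a polynomial in the jet variables
  \<open>(v, k) :: 'v \<times> nat\<close>, where \<open>(v, k)\<close> stands for the \<open>k\<close>-th space derivative of the field \<open>v\<close>.
  A functional \<open>\<integral> e dX\<close> is represented by its density \<open>e\<close>, which is only meaningful modulo total
  derivatives.
\<close>

type_synonym ('v, 'a) dpoly = "(('v \<times> nat) \<Rightarrow>\<^sub>0 nat) \<Rightarrow>\<^sub>0 'a"

definition dp_const :: "'a::zero \<Rightarrow> ('v, 'a) dpoly" where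
  "dp_const a = Poly_Mapping.single 0 a"

definition dp_var :: "'v \<Rightarrow> nat \<Rightarrow> ('v, complex) dpoly" where
  "dp_var v k = Poly_Mapping.single (Poly_Mapping.single (v, k) 1) 1"

definition dp_vars :: "('v, complex) dpoly \<Rightarrow> ('v \<times> nat) set" where
  "dp_vars p = (\<Union>m\<in>Poly_Mapping.keys p. Poly_Mapping.keys m)"

definition dp_pderiv :: "'v \<times> nat \<Rightarrow> ('v, complex) dpoly \<Rightarrow> ('v, complex) dpoly" where
  "dp_pderiv z p = (\<Sum>m\<in>Poly_Mapping.keys p.
     Poly_Mapping.single (m - Poly_Mapping.single z 1)
       (of_nat (Poly_Mapping.lookup m z) * Poly_Mapping.lookup p m))"

definition dp_D :: "('v, complex) dpoly \<Rightarrow> ('v, complex) dpoly" where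
  "dp_D p = (\<Sum>(v, k)\<in>dp_vars p. dp_pderiv (v, k) p * dp_var v (Suc k))"

definition dp_euler :: "'v \<Rightarrow> ('v, complex) dpoly \<Rightarrow> ('v, complex) dpoly" where
  "dp_euler v p = (\<Sum>k | (v, k) \<in> dp_vars p. (- 1) ^ k * (dp_D ^^ k) (dp_pderiv (v, k) p))"

definition dp_equiv :: "('v, complex) dpoly \<Rightarrow> ('v, complex) dpoly \<Rightarrow> bool" where
  "dp_equiv p p' \<longleftrightarrow> (\<exists>s. p - p' = dp_D s)"

text \<open>Substitution of differential polynomials for the fields; it commutes with \<open>dp_D\<close>.\<close>

definition dp_subst :: "('v \<Rightarrow> ('w, complex) dpoly) \<Rightarrow> ('v, complex) dpoly \<Rightarrow> ('w, complex) dpoly"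
  where
  "dp_subst s p = (\<Sum>m\<in>Poly_Mapping.keys p. dp_const (Poly_Mapping.lookup p m) *
     (\<Prod>(v, k)\<in>Poly_Mapping.keys m. (dp_D ^^ k) (s v) ^ Poly_Mapping.lookup m (v, k)))"

definition xderiv :: "(real \<Rightarrow> complex) \<Rightarrow> real \<Rightarrow> complex" where
  "xderiv f x = vector_derivative f (at x)"

definition dp_eval :: "('v, complex) dpoly \<Rightarrow> ('v \<Rightarrow> real \<Rightarrow> complex) \<Rightarrow> real \<Rightarrow> complex" where
  "dp_eval p w x = (\<Sum>m\<in>Poly_Mapping.keys p. Poly_Mapping.lookup p m *
     (\<Prod>(v, k)\<in>Poly_Mapping.keys m. ((xderiv ^^ k) (w v) x) ^ Poly_Mapping.lookup m (v, k)))"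

text \<open>Exact quotient in the integral domain of differential polynomials.\<close>

definition dp_quot :: "('v, complex) dpoly \<Rightarrow> ('v, complex) dpoly \<Rightarrow> ('v, complex) dpoly" where
  "dp_quot p d = (THE s. d * s = p)"


section \<open>The NLS Hamiltonians and the KdV energies\<close>

datatype nls_var = NLS_q | NLS_qbar

text \<open>
  Every \<open>\<sigma>\<^sub>n\<close> is divisible by \<open>q\<close>, so the term \<open>q\<^sub>x \<sigma>\<^sub>n / q\<close> of the recursion is a differential
  polynomial.
\<close>

fun nls_sigma :: "nat \<Rightarrow> (nls_var, complex) dpoly" where
  "nls_sigma 0 = 0"
| "nls_sigma (Suc 0) = - (dp_var NLS_q 0 * dp_var NLS_qbar 0)"
| "nls_sigma (Suc (Suc n)) =
     dp_D (nls_sigma (Suc n)) - dp_quot (dp_var NLS_q 1 * nls_sigma (Suc n)) (dp_var NLS_q 0)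
     + (\<Sum>k\<le>Suc n. nls_sigma k * nls_sigma (Suc n - k))"

definition nls_H :: "nat \<Rightarrow> (nls_var, complex) dpoly" where
  "nls_H n = - (dp_const ((- \<i>) ^ n) * nls_sigma (Suc n))"

datatype kdv_var = KdV_U

fun kdv_sigma :: "nat \<Rightarrow> (kdv_var, complex) dpoly" where
  "kdv_sigma 0 = 0"
| "kdv_sigma (Suc 0) = - dp_var KdV_U 0"
| "kdv_sigma (Suc (Suc n)) =
     dp_D (kdv_sigma (Suc n)) + (\<Sum>k\<le>Suc n. kdv_sigma k * kdv_sigma (Suc n - k))"

definition kdv_E :: "int \<Rightarrow> (kdv_var, complex) dpoly" where
  "kdv_E n = dp_const ((- 1) powi n) * kdv_sigma (nat (2 * n + 3))"

text \<open>The function \<open>(\<E>\<^sub>n)'(U)\<close> for a function \<open>U\<close>.\<close>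

definition kdv_E_deriv :: "int \<Rightarrow> (real \<Rightarrow> complex) \<Rightarrow> real \<Rightarrow> complex" where
  "kdv_E_deriv n U = dp_eval (dp_euler KdV_U (kdv_E n)) (\<lambda>_. U)"


section \<open>The Hamiltonians of the GP hierarchies\<close>

datatype gp_var = W_plus | W_minus

abbreviation Wp :: "(gp_var, complex) dpoly" where "Wp \<equiv> dp_var W_plus 0"
abbreviation Wm :: "(gp_var, complex) dpoly" where "Wm \<equiv> dp_var W_minus 0"

text \<open>
  Formal series in \<open>y\<^sup>-\<^sup>1\<close> are written as series in the library variable \<open>X\<close>: the coefficient of
  \<open>X\<^sup>n\<close> is that of \<open>y\<^sup>-\<^sup>n\<close>, and \<open>y\<close> itself is \<open>fls_X_inv\<close>.
\<close>

definition gp_lambda :: "real \<Rightarrow> complex fls" where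
  "gp_lambda \<epsilon> = (THE L. L ^ 2 = 1 - fls_const (complex_of_real (\<epsilon>\<^sup>2 / 2)) * fls_X_inv ^ 2 \<and>
                      fls_nth L (- 1) = - (\<i> * \<epsilon> / sqrt 2))"

definition gp_Lambda :: "real \<Rightarrow> (gp_var, complex) dpoly fls" where
  "gp_Lambda \<epsilon> = Abs_fls (\<lambda>n. dp_const (fls_nth (gp_lambda \<epsilon>) n))"

abbreviation fls_scal :: "complex \<Rightarrow> (gp_var, complex) dpoly fls" where
  "fls_scal a \<equiv> fls_const (dp_const a)"

definition fps_dp_D :: "(gp_var, complex) dpoly fps \<Rightarrow> (gp_var, complex) dpoly fps" where
  "fps_dp_D f = Abs_fps (\<lambda>n. dp_D (fps_nth f n))"

definition gp_r :: "real \<Rightarrow> (gp_var, complex) dpoly fps" where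
  "gp_r \<epsilon> = (THE r. fps_nth r 0 = 1 \<and>
     fps_to_fls (fps_dp_D r) =
       fls_scal (\<i> * \<epsilon> / sqrt 2) *
         (fls_scal (1 / \<epsilon>\<^sup>2) * (1 + gp_Lambda \<epsilon>) + fls_const Wp) * fps_to_fls r ^ 2
       + fls_scal (\<i> * \<epsilon> / sqrt 2) *
         (fls_scal (1 / \<epsilon>\<^sup>2) * (1 - gp_Lambda \<epsilon>) - fls_const Wm))"

definition gp_sigma :: "real \<Rightarrow> (gp_var, complex) dpoly fps" where
  "gp_sigma \<epsilon> = (THE s.
     fps_to_fls (fps_dp_D s) =
       fls_X_inv * fps_to_fls s - fps_to_fls s ^ 2
       + fls_scal (1 / 2) *
         (- (fls_scal (\<epsilon>\<^sup>2) * fls_const (Wm * Wp))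
          - (1 + gp_Lambda \<epsilon>) * fls_const Wm
          + (1 - gp_Lambda \<epsilon>) * fls_const Wp
          - fls_scal (\<i> * sqrt 2 * \<epsilon>) * fls_const (dp_D Wp) * fps_to_fls (gp_r \<epsilon>)))"

definition gp_H :: "real \<Rightarrow> int \<Rightarrow> (gp_var, complex) dpoly" where
  "gp_H \<epsilon> n =
     (if n = - 1 then - (dp_const (complex_of_real (\<epsilon> / sqrt 2)) * (Wp + Wm))
      else - (dp_const ((- \<i>) powi n * (sqrt 2 * \<epsilon>) powi (n + 1)) *
              fps_nth (gp_sigma \<epsilon>) (nat (n + 1))))"

definition gpt_H :: "real \<Rightarrow> int \<Rightarrow> (gp_var, complex) dpoly" where
  "gpt_H \<epsilon> k =
     (if even k then gp_H \<epsilon> k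
      else let n = nat ((k + 1) div 2) in
        (\<Sum>m\<le>n. dp_const (((- 1 / 2) gchoose (n - m)) * 4 ^ (n - m) * (if m = 0 then 1 / 2 else 1))
               * gp_H \<epsilon> (2 * int m - 1)))"


section \<open>Operators on pairs of functions\<close>

text \<open>
  A field configuration \<open>(W\<^sub>+, W\<^sub>-)\<close> at fixed time is a function \<open>w :: real \<Rightarrow> real \<times> real\<close>; since
  the densities have complex coefficients, differential polynomials are evaluated in \<open>\<complex>\<close>.
\<close>

definition cpair :: "real \<times> real \<Rightarrow> complex \<times> complex" where
  "cpair z = (complex_of_real (fst z), complex_of_real (snd z))"

definition gp_field :: "(real \<Rightarrow> real \<times> real) \<Rightarrow> gp_var \<Rightarrow> real \<Rightarrow> complex" where
  "gp_field w v X = (case v of W_plus \<Rightarrow> fst (cpair (w X)) | W_minus \<Rightarrow> snd (cpair (w X)))"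

definition gp_grad ::
  "(gp_var, complex) dpoly \<Rightarrow> (real \<Rightarrow> real \<times> real) \<Rightarrow> real \<Rightarrow> complex \<times> complex" where
  "gp_grad h w X =
     (dp_eval (dp_euler W_plus h) (gp_field w) X, dp_eval (dp_euler W_minus h) (gp_field w) X)"

definition gp_A :: "real \<Rightarrow> (real \<Rightarrow> real \<times> real) \<Rightarrow> real \<Rightarrow> complex" where
  "gp_A \<epsilon> w X = 1 + \<epsilon>\<^sup>2 / 2 * (gp_field w W_plus X - gp_field w W_minus X)"

definition gp_J :: "real \<Rightarrow> (real \<Rightarrow> real \<times> real) \<Rightarrow> (real \<Rightarrow> complex \<times> complex) \<Rightarrow>
    real \<Rightarrow> complex \<times> complex" where
  "gp_J \<epsilon> w F X =
     (let A = gp_A \<epsilon> w; f = (\<lambda>Y. fst (F Y)); g = (\<lambda>Y. snd (F Y)) in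
       (- xderiv (\<lambda>Y. f Y / A Y) X - xderiv f X / A X
          + (xderiv (\<lambda>Y. g Y / A Y) X - xderiv g X / A X),
        - xderiv (\<lambda>Y. f Y / A Y) X + xderiv f X / A X
          + (xderiv (\<lambda>Y. g Y / A Y) X + xderiv g X / A X)))"

definition gp_D :: "(real \<Rightarrow> complex \<times> complex) \<Rightarrow> real \<Rightarrow> complex \<times> complex" where
  "gp_D F X = (- (1 / 2) * xderiv (\<lambda>Y. fst (F Y)) X, (1 / 2) * xderiv (\<lambda>Y. snd (F Y)) X)"

definition gp_E :: "real \<Rightarrow> (real \<Rightarrow> real \<times> real) \<Rightarrow> (real \<Rightarrow> complex \<times> complex) \<Rightarrow>
    real \<Rightarrow> complex \<times> complex" where
  "gp_E \<epsilon> w F X =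
     (let A = gp_A \<epsilon> w; f = (\<lambda>Y. fst (F Y)); g = (\<lambda>Y. snd (F Y));
          a = (1 / A X - 1) / (2 * \<epsilon>\<^sup>2); b = xderiv A X / (A X)\<^sup>2 / (4 * \<epsilon>\<^sup>2) in
       (a * (- xderiv f X) + b * (f X - g X), a * xderiv g X + b * (f X - g X)))"


section \<open>Times, scalings and the truncated hierarchies\<close>

text \<open>\<open>\<real>\<^bsup>N+1\<^esup>\<close>, with coordinates indexed by \<open>0, \<dots>, N\<close>.\<close>

definition time_space :: "nat \<Rightarrow> (nat \<Rightarrow> real) set" where
  "time_space N = {t. \<forall>k>N. t k = 0}"

text \<open>Joint smoothness on \<open>\<real>\<^bsup>N+1\<^esup> \<times> \<real>\<close>: all iterated partial derivatives exist and are continuous.\<close>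

coinductive smooth_tx :: "nat \<Rightarrow> ((nat \<Rightarrow> real) \<Rightarrow> real \<Rightarrow> complex) \<Rightarrow> bool" for N where
  "\<lbrakk>continuous_on (time_space N \<times> UNIV) (\<lambda>(t, x). f t x);
    \<forall>t\<in>time_space N. \<forall>x. (f t has_vector_derivative h t x) (at x);
    smooth_tx N h;
    \<forall>n\<le>N. \<forall>t\<in>time_space N. \<forall>x. ((\<lambda>s. f (t(n := s)) x) has_vector_derivative g n t x) (at (t n));
    \<forall>n\<le>N. smooth_tx N (g n)\<rbrakk>
   \<Longrightarrow> smooth_tx N f"

definition nls_field :: "(real \<Rightarrow> complex) \<Rightarrow> nls_var \<Rightarrow> real \<Rightarrow> complex" where
  "nls_field u v x = (case v of NLS_q \<Rightarrow> u x | NLS_qbar \<Rightarrow> cnj (u x))"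

definition nls_hierarchy :: "nat \<Rightarrow> ((nat \<Rightarrow> real) \<Rightarrow> real \<Rightarrow> complex) \<Rightarrow> bool" where
  "nls_hierarchy N q \<longleftrightarrow> (\<forall>n\<le>N. \<forall>t\<in>time_space N. \<forall>x.
     \<i> * vector_derivative (\<lambda>s. q (t(n := s)) x) (at (t n)) =
       dp_eval (dp_euler NLS_qbar (nls_H n)) (nls_field (q t)) x)"

text \<open>\<open>T\<^sub>n = time_scale \<epsilon> n * t\<^sub>n\<close>\<close>

definition time_scale :: "real \<Rightarrow> nat \<Rightarrow> real" where
  "time_scale \<epsilon> n =
     (if even n then 2 * (sqrt 2 * \<epsilon>) powi (int n - 1) else (sqrt 2 * \<epsilon>) powi (int n))"

definition scaled_times :: "real \<Rightarrow> (nat \<Rightarrow> real) \<Rightarrow> nat \<Rightarrow> real" where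
  "scaled_times \<epsilon> t n = time_scale \<epsilon> n * t n"

definition gpt_hierarchy :: "nat \<Rightarrow> real \<Rightarrow> ((nat \<Rightarrow> real) \<Rightarrow> real \<Rightarrow> real \<times> real) \<Rightarrow> bool" where
  "gpt_hierarchy N \<epsilon> W \<longleftrightarrow> (\<forall>n\<le>N. \<forall>T\<in>time_space N. \<forall>X.
     ((\<lambda>s. cpair (W (T(n := s)) X)) has_vector_derivative
        ((1 / time_scale \<epsilon> n) * (1 / (2 * \<epsilon>\<^sup>2))) *\<^sub>R
           gp_J \<epsilon> (W T) (gp_grad (gpt_H \<epsilon> (int n)) (W T)) X) (at (T n)))"

text \<open>
  Row \<open>j\<close>, column \<open>l\<close>. For \<open>l = 2 n\<close> as well as for \<open>l = 2 n - 1\<close> one has \<open>n = (l + 1) div 2\<close>.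
\<close>

definition c_matrix :: "real \<Rightarrow> nat \<Rightarrow> nat \<Rightarrow> real" where
  "c_matrix \<epsilon> j l =
     (if even j = even l \<and> j \<le> l then
        let n = (l + 1) div 2; m = (j + 1) div 2 in
          ((real n - 1 / 2) gchoose (n - m)) * (- (2 / \<epsilon>\<^sup>2)) ^ (n - m)
      else 0)"

definition c_map :: "nat \<Rightarrow> real \<Rightarrow> (nat \<Rightarrow> real) \<Rightarrow> nat \<Rightarrow> real" where
  "c_map N \<epsilon> T j = (if j \<le> N then \<Sum>l\<le>N. c_matrix \<epsilon> j l * T l else 0)"


section \<open>Residuals\<close>

definition kdv_E_Wp :: "int \<Rightarrow> (gp_var, complex) dpoly" where
  "kdv_E_Wp n = dp_subst (\<lambda>_. Wp) (kdv_E n)"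

definition kdv_E_mWm :: "int \<Rightarrow> (gp_var, complex) dpoly" where
  "kdv_E_mWm n = dp_subst (\<lambda>_. - Wm) (kdv_E n)"

text \<open>
  The densities \<open>P\<^sub>n\<close> are polynomials in \<open>\<epsilon>\<close> as well, i.e. their coefficients lie in \<open>\<complex>[\<epsilon>]\<close>.
\<close>

definition at_eps :: "real \<Rightarrow> ('v, complex poly) dpoly \<Rightarrow> ('v, complex) dpoly" where
  "at_eps \<epsilon> p = Poly_Mapping.map (\<lambda>a. poly a (complex_of_real \<epsilon>)) p"

definition residual_densities :: "(int \<Rightarrow> (gp_var, complex poly) dpoly) \<Rightarrow> bool" where
  "residual_densities P \<longleftrightarrow> (\<forall>\<epsilon>>0. \<forall>n::nat.
     dp_equiv (gpt_H \<epsilon> (2 * int n))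
       (dp_const (complex_of_real ((sqrt 2 * \<epsilon>) ^ (2 * n + 1) / 2)) *
         (kdv_E_mWm (int n - 1) + kdv_E_Wp (int n - 1)
          + dp_const (complex_of_real (\<epsilon>\<^sup>2)) * at_eps \<epsilon> (P (2 * int n)))) \<and>
     dp_equiv (gpt_H \<epsilon> (2 * int n - 1))
       (dp_const (complex_of_real ((sqrt 2 * \<epsilon>) ^ (2 * n + 1) / 4)) *
         (kdv_E_mWm (int n - 1) - kdv_E_Wp (int n - 1)
          + dp_const (complex_of_real (\<epsilon>\<^sup>2)) * at_eps \<epsilon> (P (2 * int n - 1)))))"

text \<open>For \<open>k = 2 n\<close> as well as for \<open>k = 2 n - 1\<close> one has \<open>n - 1 = (k - 1) div 2\<close>.\<close>

definition residual :: "real \<Rightarrow> (int \<Rightarrow> (gp_var, complex poly) dpoly) \<Rightarrow> int \<Rightarrow>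
    (real \<Rightarrow> real \<times> real) \<Rightarrow> real \<Rightarrow> complex \<times> complex" where
  "residual \<epsilon> P k w X =
     (let sgn = (if even k then 1 else - 1);
          F = (\<lambda>Y. (sgn * fst (gp_grad (kdv_E_Wp ((k - 1) div 2)) w Y),
                    snd (gp_grad (kdv_E_mWm ((k - 1) div 2)) w Y)));
          G = gp_grad (at_eps \<epsilon> (P k)) w
      in gp_E \<epsilon> w F X + (gp_D G X + \<epsilon>\<^sup>2 *\<^sub>R gp_E \<epsilon> w G X))"

end

theory Submission
  imports Defs
begin

text \<open>
  The gradients of both hierarchies are read off from resolvents, formal series in the inverse
  spectral parameter. For NLS one has \<open>\<sigma> = q g\<close>, and linearizing the Riccati equation of \<open>g\<close> yields
  a triple \<open>(n, k, e)\<close> with \<open>e\<^sup>2 + 4 n k = 1\<close> that solves the linear system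
  \<open>\<partial>n = - z n - q e\<close>, \<open>\<partial>k = z k + q\<^sup>* e\<close> and whose component \<open>n\<close> generates the gradients. The algebraic
  constraint makes the solution unique, which gives the reality of the flows (\<open>k\<close> is the conjugate
  of \<open>n\<close> up to signs). For GP, \<open>\<sigma> = y / 2 - \<alpha> r\<close>, and linearizing the Riccati equation of \<open>r\<close> yields
  another such triple; a constant rotation and the gauge factor \<open>h = q / \<bar>q\<bar>\<close> turn it into a solution
  of the NLS system with \<open>z = 2 \<i> \<lambda>(y)\<close>. By uniqueness the GP gradients are the NLS gradients
  composed with \<open>\<zeta> = 1 / z\<close>, and the coefficients of the powers of \<open>\<zeta>\<close> are, up to scaling, the entries
  of the transition matrix. The residual form then follows from \<open>J / 4 = D + \<epsilon>\<^sup>2 E\<close>, because Euler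
  derivatives annihilate total derivatives.
\<close>

section \<open>The differential algebra\<close>

text \<open>The gauge factor \<open>h\<close> is nonlocal in the fields \<open>W_+\<close>,
  \<open>W_-\<close>, so the GP and NLS resolvents cannot be compared as differential polynomials.
  Both are evaluated on functions first, and the comparison is a uniqueness statement for power
  series whose coefficients are functions of \<open>y\<close>. The differential equations alone
  would leave a constant of integration in every coefficient of \<open>e\<close>; the quadratic
  constraint removes it. The half-integer binomials of the matrix come from \<open>\<zeta> = X (1 -
  2 X^2 / \<epsilon>^2)^(-1/2) / (sqrt 2 \<epsilon>)\<close>: its \<open>j\<close>-th power carries
  the exponent \<open>- j / 2\<close>, and the modified Hamiltonians of odd index contain one more
  factor \<open>(1 - 2 X^2 / \<epsilon>^2)^(-1/2)\<close>, which makes the exponent a half-integer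
  for both parities. The matrix has no column of index -1, although the odd flows have a term
  \<open>m = 0\<close>. That term is zero because the Hamiltonian of index -1 is a Casimir of the
  operator \<open>gp_J\<close>.\<close>

lemma lookup_dp_pderiv:
  "Poly_Mapping.lookup (dp_pderiv z p) m =
     of_nat (Suc (Poly_Mapping.lookup m z)) * Poly_Mapping.lookup p (m + Poly_Mapping.single z 1)"
proof -
  let ?e = "Poly_Mapping.single z (1::nat)"
  have "Poly_Mapping.lookup (dp_pderiv z p) m =
      (\<Sum>m'\<in>Poly_Mapping.keys p. if m' = m + ?e
         then of_nat (Poly_Mapping.lookup m' z) * Poly_Mapping.lookup p m' else 0)"
    unfolding dp_pderiv_def lookup_sum lookup_single
  proof (intro sum.cong refl)
    fix m'
    \<comment> \<open>Subtraction of monomials is truncated, so \<open>m' - ?e = m\<close>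
      determines \<open>m'\<close> only when \<open>z\<close> occurs in \<open>m'\<close>; otherwise
      the factor \<open>lookup m' z\<close> is zero.\<close>
    have "m' = m + ?e" if "m' - ?e = m" "Poly_Mapping.lookup m' z \<noteq> 0"
    proof (rule poly_mapping_eqI)
      fix k
      show "Poly_Mapping.lookup m' k = Poly_Mapping.lookup (m + ?e) k"
        using that by (auto simp: lookup_add lookup_minus lookup_single when_def)
    qed
    moreover have "m + ?e - ?e = m" by simp
    ultimately show "(of_nat (Poly_Mapping.lookup m' z) * Poly_Mapping.lookup p m' when m' - ?e = m) =
        (if m' = m + ?e then of_nat (Poly_Mapping.lookup m' z) * Poly_Mapping.lookup p m' else 0)"
      unfolding when_def by (metis mult_zero_left of_nat_0)
  qed
  also have "\<dots> = of_nat (Suc (Poly_Mapping.lookup m z)) * Poly_Mapping.lookup p (m + ?e)"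
    by (auto simp: sum.delta' lookup_add in_keys_iff)
  finally show ?thesis .
qed

lemma dp_pderiv_add: "dp_pderiv z (p + p') = dp_pderiv z p + dp_pderiv z p'"
  by (rule poly_mapping_eqI) (simp add: lookup_dp_pderiv lookup_add algebra_simps)

lemma dp_pderiv_0 [simp]: "dp_pderiv z 0 = 0"
  by (rule poly_mapping_eqI) (simp add: lookup_dp_pderiv)

lemma dp_pderiv_single:
  "dp_pderiv z (Poly_Mapping.single m c) =
     Poly_Mapping.single (m - Poly_Mapping.single z 1) (of_nat (Poly_Mapping.lookup m z) * c)"
  by (cases "c = 0") (auto simp: dp_pderiv_def)

lemma dp_single_induct [case_names single add]:
  assumes "\<And>m c. Q (Poly_Mapping.single m c)" "\<And>p p'. Q p \<Longrightarrow> Q p' \<Longrightarrow> Q (p + p')"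
  shows "Q (p :: 'k \<Rightarrow>\<^sub>0 'c::comm_monoid_add)"
proof -
  have "Q 0" using assms(1)[of undefined 0] by simp
  then have *: "Q (\<Sum>m\<in>S. Poly_Mapping.single m (Poly_Mapping.lookup p m))" for S
    by (induction S rule: infinite_finite_induct) (auto intro: assms)
  have "p = (\<Sum>m\<in>Poly_Mapping.keys p. Poly_Mapping.single m (Poly_Mapping.lookup p m))"
    by (rule poly_mapping_eqI)
      (auto simp: lookup_sum lookup_single when_def sum.delta' in_keys_iff)
  then show ?thesis using * by metis
qed

lemma dp_pderiv_mult: "dp_pderiv z (p * p') = dp_pderiv z p * p' + p * dp_pderiv z p'"
proof (induction p rule: dp_single_induct)
  case (single m c)
  show ?case
  proof (induction p' rule: dp_single_induct)
    case (single m' c')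
    have 1: "m + m' - Poly_Mapping.single z 1 = (m - Poly_Mapping.single z 1) + m'"
      if "Poly_Mapping.lookup m z \<noteq> 0" for m m' :: "('a \<times> nat) \<Rightarrow>\<^sub>0 nat"
      using that by (intro poly_mapping_eqI) (auto simp: lookup_add lookup_minus lookup_single when_def)
    \<comment> \<open>If \<open>z\<close> does not occur in \<open>m\<close>, the two monomials may
      differ, but both carry the coefficient zero.\<close>
    have 2: "Poly_Mapping.single (m + m' - Poly_Mapping.single z 1) (of_nat (Poly_Mapping.lookup m z) * x) =
        Poly_Mapping.single ((m - Poly_Mapping.single z 1) + m') (of_nat (Poly_Mapping.lookup m z) * x)"
      for m m' :: "('a \<times> nat) \<Rightarrow>\<^sub>0 nat" and x :: complex
      using 1[of m m'] by (cases "Poly_Mapping.lookup m z = 0") auto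
    show ?case
      using 2[of m m' "c * c'"] 2[of m' m "c * c'"]
      by (simp add: mult_single dp_pderiv_single lookup_add distrib_right distrib_left single_add add.commute mult.commute
          mult.left_commute mult.assoc)
  qed (simp add: distrib_left dp_pderiv_add)
qed (simp add: distrib_right dp_pderiv_add)

lemma dp_pderiv_const [simp]: "dp_pderiv z (dp_const c) = 0"
  by (simp add: dp_const_def dp_pderiv_single)

lemma dp_pderiv_var: "dp_pderiv z (dp_var v k) = (if z = (v, k) then 1 else 0)"
  by (auto simp: dp_var_def dp_pderiv_single lookup_single)

lemma dp_const_simps [simp]:
  "dp_const 0 = 0" "dp_const 1 = 1" "dp_const (a + b) = dp_const a + dp_const b"
  "dp_const (a * b) = dp_const a * dp_const b" 
  for a b :: "'a::comm_ring_1"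
  by (simp_all add: dp_const_def single_add mult_single)

lemma dp_const_minus [simp]: "dp_const (- a) = - dp_const a" 
  and dp_const_diff [simp]: "dp_const (a - b) = dp_const a - dp_const b"
  for a b :: "'a::comm_ring_1"
  by (simp_all add: dp_const_def single_uminus single_diff)

lemma dp_const_power [simp]: "dp_const (a ^ n) = dp_const a ^ n" for a :: "'a::comm_ring_1"
  by (induction n) auto

lemma dp_const_numeral [simp]: "dp_const (numeral n) = (numeral n :: ('v, 'a::comm_ring_1) dpoly)"
  by (simp add: dp_const_def)

text \<open>Reduces identities for homomorphisms, derivations and adjoints to the generators of the
  ring.\<close>

lemma dp_induct [case_names const var add mult]:
  fixes p :: "('v, complex) dpoly"
  assumes const: "\<And>c. Q (dp_const c)" and var: "\<And>v k. Q (dp_var v k)"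
    and add: "\<And>p p'. Q p \<Longrightarrow> Q p' \<Longrightarrow> Q (p + p')" and mult: "\<And>p p'. Q p \<Longrightarrow> Q p' \<Longrightarrow> Q (p * p')"
  shows "Q p"
proof (induction p rule: dp_single_induct)
  case (single m c)
  have pow: "Q (Poly_Mapping.single (Poly_Mapping.single z k) 1)" for z :: "'v \<times> nat" and k
  proof (induction k)
    case 0
    show ?case using const[of 1] by (simp add: dp_const_def)
  next
    case (Suc k)
    have "Poly_Mapping.single (Poly_Mapping.single z (Suc k)) (1::complex) =
        dp_var (fst z) (snd z) * Poly_Mapping.single (Poly_Mapping.single z k) 1"
      by (simp add: dp_var_def mult_single flip: single_add)
    then show ?case using mult[OF var Suc] by simp
  qed
  have "Q (Poly_Mapping.single m 1)"
  proof (induction m rule: dp_single_induct)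
    case (add p p')
    then show ?case
      using mult[OF add] by (simp add: mult_single)
  qed (rule pow)
  then show ?case
    using mult[OF const[of c], of "Poly_Mapping.single m 1"] by (simp add: dp_const_def mult_single)
qed (rule add)

lemma dp_pderiv_not_var: "z \<notin> dp_vars p \<Longrightarrow> dp_pderiv z p = 0"
  unfolding dp_pderiv_def dp_vars_def by (intro sum.neutral) (auto simp: in_keys_iff)

lemma finite_dp_vars [simp]: "finite (dp_vars p)"
  unfolding dp_vars_def by auto

text \<open>The defining sum ranges over the variables of its own argument. Over a common finite
  superset, sums for different arguments can be combined termwise.\<close>

lemma dp_D_superset:
  "finite S \<Longrightarrow> dp_vars p \<subseteq> S \<Longrightarrow> dp_D p = (\<Sum>(v, k)\<in>S. dp_pderiv (v, k) p * dp_var v (Suc k))"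
  unfolding dp_D_def by (rule sum.mono_neutral_left) (auto simp: dp_pderiv_not_var)

lemma dp_D_add [simp]: "dp_D (p + p') = dp_D p + dp_D p'"
proof -
  let ?S = "dp_vars p \<union> dp_vars p' \<union> dp_vars (p + p')"
  show ?thesis
    by (subst (1 2 3) dp_D_superset[of ?S])
      (auto simp: dp_pderiv_add distrib_right sum.distrib split_def)
qed

lemma dp_D_mult: "dp_D (p * p') = dp_D p * p' + p * dp_D p'"
proof -
  let ?S = "dp_vars p \<union> dp_vars p' \<union> dp_vars (p * p')"
  show ?thesis
    by (subst (1 2 3) dp_D_superset[of ?S])
      (auto simp: dp_pderiv_mult sum.distrib split_def sum_distrib_left sum_distrib_right algebra_simps)
qed

lemma dp_D_const [simp]: "dp_D (dp_const c) = 0"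
  by (subst dp_D_superset[of "dp_vars (dp_const c)"]) auto

lemma dp_D_0 [simp]: "dp_D 0 = 0" and dp_D_1 [simp]: "dp_D 1 = 0"
  using dp_D_const[of 0] dp_D_const[of 1] by simp_all

lemma dp_D_minus [simp]: "dp_D (- p) = - dp_D p"
  using dp_D_add[of p "- p"] by (simp del: dp_D_add add: eq_neg_iff_add_eq_0 add.commute)

lemma dp_D_diff [simp]: "dp_D (p - p') = dp_D p - dp_D p'"
  using dp_D_add[of p "- p'"] by simp

lemma dp_D_sum: "dp_D (sum f S) = (\<Sum>i\<in>S. dp_D (f i))"
  by (induction S rule: infinite_finite_induct) auto

lemma dp_D_var [simp]: "dp_D (dp_var v k) = dp_var v (Suc k)"
proof -
  let ?S = "insert (v, k) (dp_vars (dp_var v k))"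
  have "dp_D (dp_var v k) = (\<Sum>x\<in>?S. dp_pderiv x (dp_var v k) * dp_var (fst x) (Suc (snd x)))"
    by (subst dp_D_superset[of ?S]) (simp_all add: split_def subset_insertI)
  also have "\<dots> = (\<Sum>x\<in>?S. if x = (v, k) then dp_var v (Suc k) else 0)"
    by (rule sum.cong) (simp_all add: dp_pderiv_var)
  also have "\<dots> = dp_var v (Suc k)"
    by (subst sum.delta) simp_all
  finally show ?thesis .
qed

text \<open>The commutator of \<partial>/\<partial>u_k with the total derivative is
  \<partial>/\<partial>u_(k-1), and zero for \<open>k = 0\<close>. The rules for Euler derivatives
  rest on this.\<close>

lemma dp_pderiv_D:
  "dp_pderiv (v, k) (dp_D p) = dp_D (dp_pderiv (v, k) p) +
     (case k of 0 \<Rightarrow> 0 | Suc j \<Rightarrow> dp_pderiv (v, j) p)"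
proof (induction p rule: dp_induct)
  case (mult p p')
  then show ?case
    by (simp add: dp_D_mult dp_pderiv_mult dp_pderiv_add algebra_simps split: nat.split)
qed (auto simp: dp_pderiv_var dp_pderiv_add split: nat.split)

section \<open>Formal adjoints and variational derivatives\<close>

lemma dp_D_funpow_add: "(dp_D ^^ k) (p + p') = (dp_D ^^ k) p + (dp_D ^^ k) p'"
  by (induction k) auto

lemma dp_D_funpow_0 [simp]: "(dp_D ^^ k) 0 = 0"
  by (induction k) auto

lemma dp_D_funpow_var: "(dp_D ^^ k) (dp_var v j) = dp_var v (j + k)"
  by (induction k) auto

text \<open>The adjoint of the linearization of \<open>p\<close> in the direction of the field \<open>v\<close>.\<close>

definition dp_adj :: "'v \<Rightarrow> ('v, complex) dpoly \<Rightarrow> ('v, complex) dpoly \<Rightarrow> ('v, complex) dpoly"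
  where "dp_adj v p h =
    (\<Sum>k | (v, k) \<in> dp_vars p. (- 1) ^ k * (dp_D ^^ k) (h * dp_pderiv (v, k) p))"

lemma dp_euler_adj: "dp_euler v p = dp_adj v p 1"
  by (simp add: dp_euler_def dp_adj_def)

lemma dp_order_exists: "\<exists>K. \<forall>k\<ge>K. (v, k) \<notin> dp_vars p"
proof -
  have "finite (snd ` dp_vars p)" by simp
  then obtain K where K: "\<forall>k\<in>snd ` dp_vars p. k < K"
    unfolding finite_nat_set_iff_bounded by blast
  have "(v, k) \<notin> dp_vars p" if "k \<ge> K" for k
  proof
    assume "(v, k) \<in> dp_vars p"
    then have "k \<in> snd ` dp_vars p" by (rule image_eqI[rotated]) simp
    then show False using K that by auto
  qed
  then show ?thesis by blast
qed

text \<open>An order bound replaces the exact set of variables, so that adjoints of different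
  polynomials become sums over one range.\<close>

lemma dp_adj_sum:
  assumes "\<forall>k\<ge>K. dp_pderiv (v, k) p = 0"
  shows "dp_adj v p h = (\<Sum>k<K. (- 1) ^ k * (dp_D ^^ k) (h * dp_pderiv (v, k) p))"
proof -
  obtain K' where K': "\<forall>k\<ge>K'. (v, k) \<notin> dp_vars p" by (rule exE[OF dp_order_exists])
  have "dp_adj v p h = (\<Sum>k<max K K'. (- 1) ^ k * (dp_D ^^ k) (h * dp_pderiv (v, k) p))"
    unfolding dp_adj_def
  proof (rule sum.mono_neutral_left)
    show "{k. (v, k) \<in> dp_vars p} \<subseteq> {..<max K K'}"
    proof
      fix k
      assume "k \<in> {k. (v, k) \<in> dp_vars p}"
      then have "\<not> K' \<le> k" using K' by blast
      then show "k \<in> {..<max K K'}" by simp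
    qed
    show "\<forall>i\<in>{..<max K K'} - {k. (v, k) \<in> dp_vars p}. (- 1) ^ i * (dp_D ^^ i) (h * dp_pderiv (v, i) p) = 0"
      by (auto simp: dp_pderiv_not_var)
  qed simp
  also have "\<dots> = (\<Sum>k<K. (- 1) ^ k * (dp_D ^^ k) (h * dp_pderiv (v, k) p))"
    using assms by (intro sum.mono_neutral_right) auto
  finally show ?thesis .
qed

lemma dp_order_pderiv: "\<exists>K. \<forall>k\<ge>K. dp_pderiv (v, k) p = 0"
  using dp_order_exists[of v p] dp_pderiv_not_var by blast

lemma dp_order_pderiv2:
  obtains K where "\<forall>k\<ge>K. dp_pderiv (v, k) p = 0" "\<forall>k\<ge>K. dp_pderiv (v, k) p' = 0"
proof -
  obtain K K' where "\<forall>k\<ge>K. dp_pderiv (v, k) p = 0" "\<forall>k\<ge>K'. dp_pderiv (v, k) p' = 0"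
    using dp_order_pderiv[of v p] dp_order_pderiv[of v p'] by blast
  then show ?thesis by (intro that[of "max K K'"]) auto
qed

lemma dp_adj_add_left: "dp_adj v (p + p') h = dp_adj v p h + dp_adj v p' h"
proof -
  obtain K where K: "\<forall>k\<ge>K. dp_pderiv (v, k) p = 0" "\<forall>k\<ge>K. dp_pderiv (v, k) p' = 0"
    by (rule dp_order_pderiv2)
  then have "\<forall>k\<ge>K. dp_pderiv (v, k) (p + p') = 0" by (simp add: dp_pderiv_add)
  from dp_adj_sum[OF this] dp_adj_sum[OF K(1)] dp_adj_sum[OF K(2)] show ?thesis
    by (simp add: dp_pderiv_add distrib_left dp_D_funpow_add sum.distrib)
qed

lemma dp_adj_add_right: "dp_adj v p (h + h') = dp_adj v p h + dp_adj v p h'"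
  by (simp add: dp_adj_def distrib_left distrib_right dp_D_funpow_add sum.distrib)

text \<open>The linearization of a product is \<open>p'\<close> times that of \<open>p\<close> plus
  \<open>p\<close> times that of \<open>p'\<close>; transposing moves these factors onto the
  argument.\<close>

lemma dp_adj_mult: "dp_adj v (p * p') h = dp_adj v p (p' * h) + dp_adj v p' (p * h)"
proof -
  obtain K where K: "\<forall>k\<ge>K. dp_pderiv (v, k) p = 0" "\<forall>k\<ge>K. dp_pderiv (v, k) p' = 0"
    by (rule dp_order_pderiv2)
  then have "\<forall>k\<ge>K. dp_pderiv (v, k) (p * p') = 0" by (simp add: dp_pderiv_mult)
  from dp_adj_sum[OF this] dp_adj_sum[OF K(1)] dp_adj_sum[OF K(2)] show ?thesis
    by (simp add: dp_pderiv_mult distrib_left dp_D_funpow_add sum.distrib algebra_simps)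
qed

text \<open>Linearization commutes with the total derivative, whose transpose is its negative. For
  \<open>h = 1\<close> this says that Euler derivatives annihilate total derivatives.\<close>

lemma dp_adj_D: "dp_adj v (dp_D p) h = - dp_adj v p (dp_D h)"
proof -
  obtain K where K: "\<forall>k\<ge>K. dp_pderiv (v, k) p = 0"
    using dp_order_pderiv[of v p] by blast
  then have KD: "\<forall>k\<ge>Suc K. dp_pderiv (v, k) (dp_D p) = 0"
    by (auto simp: dp_pderiv_D split: nat.split)
  let ?d = "\<lambda>k. dp_pderiv (v, k) p"
  have "dp_adj v (dp_D p) h = (\<Sum>k<Suc K. (- 1) ^ k * (dp_D ^^ k) (h * dp_D (?d k))) +
      (\<Sum>k<Suc K. (- 1) ^ k * (dp_D ^^ k) (h * (case k of 0 \<Rightarrow> 0 | Suc j \<Rightarrow> ?d j)))"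
    unfolding dp_adj_sum[OF KD] sum.distrib[symmetric]
    by (simp add: dp_pderiv_D distrib_left dp_D_funpow_add del: sum.lessThan_Suc)
  \<comment> \<open>Shifting the index turns the commutator terms into total derivatives of
    \<open>h * ?d k\<close>; by the product rule they cancel the first sum and leave the terms with
    \<open>dp_D h\<close>.\<close>
  also have "(\<Sum>k<Suc K. (- 1) ^ k * (dp_D ^^ k) (h * (case k of 0 \<Rightarrow> 0 | Suc j \<Rightarrow> ?d j))) =
      (\<Sum>k<K. - ((- 1) ^ k * (dp_D ^^ k) (dp_D (h * ?d k))))"
    by (subst sum.lessThan_Suc_shift) (simp add: funpow_swap1)
  also have "(\<Sum>k<Suc K. (- 1) ^ k * (dp_D ^^ k) (h * dp_D (?d k))) =
      (\<Sum>k<K. (- 1) ^ k * (dp_D ^^ k) (h * dp_D (?d k)))"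
    using K by simp
  finally have "dp_adj v (dp_D p) h =
      - (\<Sum>k<K. (- 1) ^ k * (dp_D ^^ k) (dp_D h * ?d k))"
    by (simp add: dp_D_mult dp_D_funpow_add distrib_left sum.distrib sum_negf sum_subtractf)
  then show ?thesis by (simp add: dp_adj_sum[OF K])
qed

lemma dp_adj_var: "dp_adj v (dp_var u 0) h = (if u = v then h else 0)"
proof -
  have "\<forall>k\<ge>1. dp_pderiv (v, k) (dp_var u 0) = 0" by (auto simp: dp_pderiv_var)
  from dp_adj_sum[OF this] show ?thesis by (auto simp: dp_pderiv_var)
qed

lemma dp_adj_const [simp]: "dp_adj v (dp_const c) h = 0"
  by (simp add: dp_adj_def)

lemma dp_adj_0_left [simp]: "dp_adj v 0 h = 0"
  using dp_adj_const[of v 0] by simp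

lemma dp_adj_0_right [simp]: "dp_adj v p 0 = 0"
  by (simp add: dp_adj_def)

lemma dp_adj_minus_left: "dp_adj v (- p) h = - dp_adj v p h"
  using dp_adj_add_left[of v p "- p" h] by (simp add: eq_neg_iff_add_eq_0 add.commute)

lemma dp_adj_minus_right: "dp_adj v p (- h) = - dp_adj v p h"
  using dp_adj_add_right[of v p h "- h"] by (simp add: eq_neg_iff_add_eq_0 add.commute)

lemma dp_D_funpow_const: "(dp_D ^^ k) (dp_const c * p) = dp_const c * (dp_D ^^ k) p"
  by (induction k) (auto simp: dp_D_mult)

lemma dp_adj_const_right: "dp_adj v p (dp_const c * h) = dp_const c * dp_adj v p h"
  by (simp add: dp_adj_def sum_distrib_left dp_D_funpow_const mult.assoc mult.left_commute[of _ "dp_const c"])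

lemma dp_euler_D [simp]: "dp_euler v (dp_D p) = 0"
  by (simp add: dp_euler_adj dp_adj_D)

lemma dp_euler_add: "dp_euler v (p + p') = dp_euler v p + dp_euler v p'"
  by (simp add: dp_euler_adj dp_adj_add_left)

lemma dp_euler_minus: "dp_euler v (- p) = - dp_euler v p"
  by (simp add: dp_euler_adj dp_adj_minus_left)

lemma dp_euler_diff: "dp_euler v (p - p') = dp_euler v p - dp_euler v p'"
  using dp_euler_add[of v p "- p'"] by (simp add: dp_euler_minus)

lemma dp_euler_const_mult: "dp_euler v (dp_const c * p) = dp_const c * dp_euler v p"
  by (simp add: dp_euler_adj dp_adj_mult dp_adj_const_right[of _ _ _ 1, simplified])

lemma dp_euler_0 [simp]: "dp_euler v 0 = 0"
  by (simp add: dp_euler_adj)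

lemma dp_euler_sum: "dp_euler v (sum f S) = (\<Sum>i\<in>S. dp_euler v (f i))"
  by (induction S rule: infinite_finite_induct) (auto simp: dp_euler_add)

lemma dp_equiv_euler: "dp_equiv p p' \<Longrightarrow> dp_euler v p = dp_euler v p'"
  unfolding dp_equiv_def by (metis dp_euler_D dp_euler_diff eq_iff_diff_eq_0)

section \<open>Evaluation and substitution\<close>

text \<open>For a ring homomorphism \<open>c\<close> this is the homomorphism given by the universal
  property of the polynomial ring. \<open>dp_eval\<close> and \<open>dp_subst\<close> are both
  instances, so multiplicativity is proved once.\<close>

definition pm_ext :: "('a::comm_ring_1 \<Rightarrow> 'r::comm_ring_1) \<Rightarrow> ('z \<Rightarrow> 'r) \<Rightarrow> (('z \<Rightarrow>\<^sub>0 nat) \<Rightarrow>\<^sub>0 'a) \<Rightarrow> 'r"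
  where "pm_ext c g p = (\<Sum>m\<in>Poly_Mapping.keys p. c (Poly_Mapping.lookup p m) *
     (\<Prod>z\<in>Poly_Mapping.keys m. g z ^ Poly_Mapping.lookup m z))"

locale pm_hom =
  fixes c :: "'a::comm_ring_1 \<Rightarrow> 'r::comm_ring_1" and g :: "'z \<Rightarrow> 'r"
  assumes c0: "c 0 = 0" and c1: "c 1 = 1" and c_add: "c (a + b) = c a + c b"
    and c_mult: "c (a * b) = c a * c b"
begin

lemma monomial_superset:
  "finite S \<Longrightarrow> Poly_Mapping.keys m \<subseteq> S \<Longrightarrow>
     (\<Prod>z\<in>Poly_Mapping.keys m. g z ^ Poly_Mapping.lookup m z) = (\<Prod>z\<in>S. g z ^ Poly_Mapping.lookup m z)"
  by (rule prod.mono_neutral_left) (auto simp: in_keys_iff)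

lemma monomial_add:
  "(\<Prod>z\<in>Poly_Mapping.keys (m + m'). g z ^ Poly_Mapping.lookup (m + m') z) =
     (\<Prod>z\<in>Poly_Mapping.keys m. g z ^ Poly_Mapping.lookup m z) *
     (\<Prod>z\<in>Poly_Mapping.keys m'. g z ^ Poly_Mapping.lookup m' z)"
proof -
  let ?S = "Poly_Mapping.keys m \<union> Poly_Mapping.keys m' \<union> Poly_Mapping.keys (m + m')"
  show ?thesis
    by (subst (1 2 3) monomial_superset[of ?S])
      (auto simp: prod.distrib lookup_add power_add)
qed

lemma superset:
  "finite S \<Longrightarrow> Poly_Mapping.keys p \<subseteq> S \<Longrightarrow>
     pm_ext c g p = (\<Sum>m\<in>S. c (Poly_Mapping.lookup p m) *
       (\<Prod>z\<in>Poly_Mapping.keys m. g z ^ Poly_Mapping.lookup m z))"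
  unfolding pm_ext_def by (rule sum.mono_neutral_left) (auto simp: in_keys_iff c0)

lemma add: "pm_ext c g (p + p') = pm_ext c g p + pm_ext c g p'"
proof -
  let ?S = "Poly_Mapping.keys p \<union> Poly_Mapping.keys p' \<union> Poly_Mapping.keys (p + p')"
  show ?thesis
    by (subst (1 2 3) superset[of ?S])
      (auto simp: lookup_add c_add distrib_right sum.distrib)
qed

lemma ext_single:
  "pm_ext c g (Poly_Mapping.single m a) = c a * (\<Prod>z\<in>Poly_Mapping.keys m. g z ^ Poly_Mapping.lookup m z)"
  by (subst superset[of "{m}"]) auto

lemma mult: "pm_ext c g (p * p') = pm_ext c g p * pm_ext c g p'"
proof (induction p rule: dp_single_induct)
  case (single m a)
  show ?case
  proof (induction p' rule: dp_single_induct)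
    case (single m' a')
    show ?case
      unfolding mult_single ext_single monomial_add c_mult by (simp add: mult_ac)
  qed (simp add: distrib_left add)
qed (simp add: distrib_right add)

end

lemma pm_ext_const: "pm_ext c g (dp_const a) = c a" if "pm_hom c"
  by (simp add: dp_const_def pm_hom.ext_single[OF that])

lemma pm_ext_var: "pm_ext c g (dp_var v k) = g (v, k)" if "pm_hom c"
  using pm_hom.ext_single[OF that, of g "Poly_Mapping.single (v, k) 1" 1] pm_hom.c1[OF that]
  by (simp add: dp_var_def)

lemma dp_eval_pm_hom: "dp_eval p w x = pm_ext (\<lambda>a. a) (\<lambda>(v, k). (xderiv ^^ k) (w v) x) p"
  by (simp add: dp_eval_def pm_ext_def split_def)

lemma dp_subst_pm_hom: "dp_subst s p = pm_ext dp_const (\<lambda>(v, k). (dp_D ^^ k) (s v)) p"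
  by (simp add: dp_subst_def pm_ext_def split_def)

lemma pm_hom_id: "pm_hom (\<lambda>a. a)"
  by unfold_locales auto

lemma pm_hom_const: "pm_hom (dp_const :: complex \<Rightarrow> ('w, complex) dpoly)"
  by unfold_locales auto

lemma dp_eval_simps [simp]:
  "dp_eval (dp_const a) w x = a" "dp_eval (dp_var v k) w x = (xderiv ^^ k) (w v) x"
  "dp_eval (p + p') w x = dp_eval p w x + dp_eval p' w x"
  "dp_eval (p * p') w x = dp_eval p w x * dp_eval p' w x"
  unfolding dp_eval_pm_hom
  by (simp_all add: pm_ext_const[OF pm_hom_id] pm_ext_var[OF pm_hom_id] pm_hom.add[OF pm_hom_id]
      pm_hom.mult[OF pm_hom_id])

lemma dp_eval_0 [simp]: "dp_eval 0 w x = 0" and dp_eval_1 [simp]: "dp_eval 1 w x = 1"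
  using dp_eval_simps(1)[of 0 w x] dp_eval_simps(1)[of 1 w x] by simp_all

lemma dp_eval_minus [simp]: "dp_eval (- p) w x = - dp_eval p w x"
  using dp_eval_simps(3)[of p "- p" w x] by (simp add: eq_neg_iff_add_eq_0 add.commute del: dp_eval_simps(3))

lemma dp_eval_diff [simp]: "dp_eval (p - p') w x = dp_eval p w x - dp_eval p' w x"
  using dp_eval_simps(3)[of p "- p'" w x] by simp

lemma dp_eval_sum: "dp_eval (sum f S) w x = (\<Sum>i\<in>S. dp_eval (f i) w x)"
  by (induction S rule: infinite_finite_induct) auto

lemma dp_subst_simps [simp]:
  "dp_subst s (dp_const a) = dp_const a" "dp_subst s (dp_var v k) = (dp_D ^^ k) (s v)"
  "dp_subst s (p + p') = dp_subst s p + dp_subst s p'"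
  "dp_subst s (p * p') = dp_subst s p * dp_subst s p'"
  unfolding dp_subst_pm_hom
  by (simp_all add: pm_ext_const[OF pm_hom_const] pm_ext_var[OF pm_hom_const] pm_hom.add[OF pm_hom_const]
      pm_hom.mult[OF pm_hom_const])

lemma dp_subst_0 [simp]: "dp_subst s 0 = 0"
  using dp_subst_simps(1)[of s 0] by simp

lemma dp_subst_1 [simp]: "dp_subst s 1 = 1"
  using dp_subst_simps(1)[of s 1] by simp

lemma dp_subst_D: "dp_subst s (dp_D p) = dp_D (dp_subst s p)"
  by (induction p rule: dp_induct) (auto simp: dp_D_mult)

lemma dp_subst_D_funpow: "dp_subst s ((dp_D ^^ k) p) = (dp_D ^^ k) (dp_subst s p)"
  by (induction k) (auto simp: dp_subst_D)

lemma dp_adj_var_higher: "dp_adj v (dp_var u k) h = (if u = v then (- 1) ^ k * (dp_D ^^ k) h else 0)"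
proof (induction k arbitrary: h)
  case (Suc k)
  have "dp_adj v (dp_var u (Suc k)) h = - dp_adj v (dp_var u k) (dp_D h)"
    using dp_adj_D[of v "dp_var u k" h] by simp
  then show ?case by (simp add: Suc funpow_swap1)
qed (simp add: dp_adj_var)

text \<open>Chain rule for the adjoint. The field is replaced by a constant multiple of another one,
  and constants commute with the total derivative; \<open>c = 1\<close> and \<open>c = - 1\<close>
  serve the energies at \<open>W_+\<close> and \<open>- W_-\<close>.\<close>

lemma dp_adj_subst:
  fixes p h :: "(kdv_var, complex) dpoly" and v :: 'v
  fixes c
  defines "s \<equiv> \<lambda>_. dp_const c * dp_var v 0"
  shows "dp_adj u (dp_subst s p) (dp_subst s h) =
    (if u = v then dp_const c * dp_subst s (dp_adj KdV_U p h) else 0)"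
proof (induction p arbitrary: h rule: dp_induct)
  case (const a)
  show ?case by simp
next
  case (var z k)
  have "z = KdV_U" by (cases z)
  have *: "dp_subst s' ((- 1) ^ k) = (- 1) ^ k" for s' :: "kdv_var \<Rightarrow> ('v, complex) dpoly"
    by (metis dp_const_minus dp_const_power dp_const_simps(2) dp_subst_simps(1))
  show ?case
    using \<open>z = KdV_U\<close>
    by (simp add: s_def[symmetric] dp_adj_var_higher * dp_subst_D_funpow)
       (simp add: s_def dp_D_funpow_const dp_D_funpow_var dp_adj_mult dp_adj_var_higher * algebra_simps)
next
  case (mult p p')
  show ?case
    using mult(1)[of "p' * h"] mult(2)[of "p * h"]
    by (simp add: dp_adj_mult distrib_left)
qed (simp add: dp_adj_add_left distrib_left)

lemma dp_euler_subst:
  "dp_euler u (dp_subst (\<lambda>_. dp_const c * dp_var v 0) p) =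
    (if u = v then dp_const c * dp_subst (\<lambda>_. dp_const c * dp_var v 0) (dp_euler KdV_U p) else 0)"
  using dp_adj_subst[of u c v p 1] by (simp add: dp_euler_adj)

section \<open>Smooth functions\<close>

text \<open>Grading smoothness by the number of derivatives allows inductions in which the
  derivative is built from the function itself, as for inverses and square roots.\<close>

primrec cdiff :: "nat \<Rightarrow> (real \<Rightarrow> complex) \<Rightarrow> bool" where
  "cdiff 0 f = True"
| "cdiff (Suc n) f = (\<exists>f'. (\<forall>x. (f has_vector_derivative f' x) (at x)) \<and> cdiff n f')"

definition smooth :: "(real \<Rightarrow> complex) \<Rightarrow> bool" where "smooth f \<longleftrightarrow> (\<forall>n. cdiff n f)"

lemma xderiv_eqI: "(f has_vector_derivative d) (at x) \<Longrightarrow> xderiv f x = d"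
  by (simp add: xderiv_def vector_derivative_at)

lemma cdiff_Suc_iff:
  "cdiff (Suc n) f \<longleftrightarrow> (\<forall>x. (f has_vector_derivative xderiv f x) (at x)) \<and> cdiff n (xderiv f)"
proof
  assume "cdiff (Suc n) f"
  then obtain f' where f': "\<forall>x. (f has_vector_derivative f' x) (at x)" "cdiff n f'" by auto
  then have "xderiv f = f'" by (auto simp: xderiv_eqI)
  with f' show "(\<forall>x. (f has_vector_derivative xderiv f x) (at x)) \<and> cdiff n (xderiv f)" by simp
qed auto

lemma cdiff_SucI: "(\<And>x. (f has_vector_derivative f' x) (at x)) \<Longrightarrow> cdiff n f' \<Longrightarrow> cdiff (Suc n) f"
  by auto

lemma cdiff_Suc_D: "cdiff (Suc n) f \<Longrightarrow> cdiff n f"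
  by (induction n arbitrary: f) (simp, metis cdiff.simps(2))

lemma smooth_has_deriv: "smooth f \<Longrightarrow> (f has_vector_derivative xderiv f x) (at x)"
  using cdiff_Suc_iff[of 0 f] unfolding smooth_def by blast

lemma smooth_xderiv: "smooth f \<Longrightarrow> smooth (xderiv f)"
  unfolding smooth_def using cdiff_Suc_iff by blast

lemma smooth_funpow: "smooth f \<Longrightarrow> smooth ((xderiv ^^ k) f)"
  by (induction k) (auto intro: smooth_xderiv)

lemma cdiff_const: "cdiff n (\<lambda>_. c)"
  by (induction n arbitrary: c) (auto intro!: exI[of _ "\<lambda>_. 0"])

lemma cdiff_add: "cdiff n f \<Longrightarrow> cdiff n g \<Longrightarrow> cdiff n (\<lambda>x. f x + g x)"
proof (induction n arbitrary: f g)
  case (Suc n)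
  from Suc.prems obtain f' g' where
    "\<forall>x. (f has_vector_derivative f' x) (at x)" "cdiff n f'"
    "\<forall>x. (g has_vector_derivative g' x) (at x)" "cdiff n g'" by auto
  then show ?case
    by (intro cdiff_SucI[of _ "\<lambda>x. f' x + g' x"] Suc.IH) (auto intro!: derivative_intros)
qed simp

lemma cdiff_mult: "cdiff n f \<Longrightarrow> cdiff n g \<Longrightarrow> cdiff n (\<lambda>x. f x * g x)"
proof (induction n arbitrary: f g)
  case (Suc n)
  from Suc.prems obtain f' g' where
    *: "\<forall>x. (f has_vector_derivative f' x) (at x)" "cdiff n f'"
    "\<forall>x. (g has_vector_derivative g' x) (at x)" "cdiff n g'" by auto
  have "((\<lambda>x. f x * g x) has_vector_derivative f x * g' x + f' x * g x) (at x)" for x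
    using * by (intro has_vector_derivative_mult) auto
  then show ?case
    using * Suc.prems[THEN cdiff_Suc_D]
    by (intro cdiff_SucI[of _ "\<lambda>x. f x * g' x + f' x * g x"] Suc.IH cdiff_add)
qed simp

lemma cdiff_cnj: "cdiff n f \<Longrightarrow> cdiff n (\<lambda>x. cnj (f x))"
proof (induction n arbitrary: f)
  case (Suc n)
  from Suc.prems obtain f' where "\<forall>x. (f has_vector_derivative f' x) (at x)" "cdiff n f'" by auto
  then show ?case
    by (intro cdiff_SucI[of _ "\<lambda>x. cnj (f' x)"] Suc.IH) (auto intro!: derivative_intros)
qed simp

lemma cdiff_inverse: "(\<And>x. f x \<noteq> 0) \<Longrightarrow> cdiff n f \<Longrightarrow> cdiff n (\<lambda>x. inverse (f x))"
proof (induction n)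
  case (Suc n)
  from Suc.prems obtain f' where f': "\<And>x. (f has_vector_derivative f' x) (at x)" "cdiff n f'" by auto
  have "((\<lambda>x. inverse (f x)) has_vector_derivative (- 1) * f' x * (inverse (f x) * inverse (f x))) (at x)" for x
    using field_vector_diff_chain_at[OF f'(1)[of x] DERIV_inverse[OF Suc.prems(1)[of x]]]
    by (simp add: o_def power2_eq_square mult_ac)
  then show ?case
    using f' Suc.IH[OF Suc.prems(1)] Suc.prems(2)[THEN cdiff_Suc_D]
    by (intro cdiff_SucI[of _ "\<lambda>x. (- 1) * f' x * (inverse (f x) * inverse (f x))"] cdiff_mult cdiff_const)
qed simp

lemma cdiff_csqrt: "(\<And>x. f x \<notin> \<real>\<^sub>\<le>\<^sub>0) \<Longrightarrow> cdiff n f \<Longrightarrow> cdiff n (\<lambda>x. csqrt (f x))"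
proof (induction n)
  case (Suc n)
  from Suc.prems obtain f' where f': "\<And>x. (f has_vector_derivative f' x) (at x)" "cdiff n f'" by auto
  have nz: "csqrt (f x) \<noteq> 0" for x using Suc.prems(1)[of x] by auto
  have "((\<lambda>x. csqrt (f x)) has_vector_derivative (1 / 2) * f' x * inverse (csqrt (f x))) (at x)" for x
    using field_vector_diff_chain_at[OF f'(1)[of x] has_field_derivative_csqrt[OF Suc.prems(1)[of x]]]
    by (simp add: o_def field_simps)
  then show ?case
    using f' Suc.IH[OF Suc.prems(1)] Suc.prems(2)[THEN cdiff_Suc_D] nz
    by (intro cdiff_SucI[of _ "\<lambda>x. (1 / 2) * f' x * inverse (csqrt (f x))"] cdiff_mult cdiff_const cdiff_inverse)
qed simp

lemma cdiff_scale: "cdiff n f \<Longrightarrow> cdiff n (\<lambda>x. f (c * x))"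
proof (induction n arbitrary: f)
  case (Suc n)
  from Suc.prems obtain f' where f': "\<And>x. (f has_vector_derivative f' x) (at x)" "cdiff n f'" by auto
  have "((\<lambda>x. c * x) has_vector_derivative c) (at x)" for x
    by (auto intro!: derivative_eq_intros)
  then have "((\<lambda>x. f (c * x)) has_vector_derivative complex_of_real c * f' (c * x)) (at x)" for x
    using vector_diff_chain_at[of "\<lambda>x. c * x" c x f "f' (c * x)"] f'(1)[of "c * x"]
    by (simp add: o_def scaleR_conv_of_real)
  then show ?case
    using f' Suc.IH[of f'] by (intro cdiff_SucI[of _ "\<lambda>x. c * f' (c * x)"] cdiff_mult cdiff_const)
qed simp

lemma smooth_const: "smooth (\<lambda>_. c)"
  and smooth_add: "smooth f \<Longrightarrow> smooth g \<Longrightarrow> smooth (\<lambda>x. f x + g x)"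
  and smooth_mult: "smooth f \<Longrightarrow> smooth g \<Longrightarrow> smooth (\<lambda>x. f x * g x)"
  and smooth_cnj: "smooth f \<Longrightarrow> smooth (\<lambda>x. cnj (f x))"
  and smooth_inverse: "(\<And>x. f x \<noteq> 0) \<Longrightarrow> smooth f \<Longrightarrow> smooth (\<lambda>x. inverse (f x))"
  and smooth_csqrt: "(\<And>x. f x \<notin> \<real>\<^sub>\<le>\<^sub>0) \<Longrightarrow> smooth f \<Longrightarrow> smooth (\<lambda>x. csqrt (f x))"
  and smooth_scale: "smooth f \<Longrightarrow> smooth (\<lambda>x. f (a * x))"
  by (simp_all add: smooth_def cdiff_const cdiff_add cdiff_mult cdiff_cnj cdiff_inverse cdiff_csqrt
      cdiff_scale)

lemma smooth_diff: "smooth f \<Longrightarrow> smooth g \<Longrightarrow> smooth (\<lambda>x. f x - g x)"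
  using smooth_add[of f "\<lambda>x. (- 1) * g x"] smooth_mult[OF smooth_const, of g "- 1"] by simp

lemma dp_eval_has_deriv:
  assumes "\<And>v. smooth (w v)"
  shows "(dp_eval p w has_vector_derivative dp_eval (dp_D p) w x) (at x)"
proof (induction p rule: dp_induct)
  case (const c)
  have "dp_eval (dp_const c) w = (\<lambda>_. c)" by auto
  then show ?case by simp
next
  case (var v k)
  have "dp_eval (dp_var v k) w = (xderiv ^^ k) (w v)" by auto
  then show ?case using smooth_has_deriv[OF smooth_funpow[OF assms]] by simp
next
  case (add p p')
  have "dp_eval (p + p') w = (\<lambda>x. dp_eval p w x + dp_eval p' w x)" by auto
  then show ?case using has_vector_derivative_add[OF add] by simp
next
  case (mult p p')
  have "dp_eval (p * p') w = (\<lambda>x. dp_eval p w x * dp_eval p' w x)" by auto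
  then show ?case using has_vector_derivative_mult[OF mult] by (simp add: dp_D_mult add.commute)
qed

lemma xderiv_dp_eval: "(\<And>v. smooth (w v)) \<Longrightarrow> xderiv (dp_eval p w) = dp_eval (dp_D p) w"
  by (intro ext xderiv_eqI dp_eval_has_deriv)

lemma smooth_dp_eval:
  assumes "\<And>v. smooth (w v)" shows "smooth (dp_eval p w)"
proof -
  have "cdiff n (dp_eval p w)" for n
  proof (induction n arbitrary: p)
    case (Suc n)
    show ?case by (rule cdiff_SucI[OF dp_eval_has_deriv Suc]) (rule assms)
  qed simp
  then show ?thesis by (simp add: smooth_def)
qed

lemma dp_eval_subst:
  assumes "\<And>v. smooth (w v)"
  shows "dp_eval (dp_subst s p) w x = dp_eval p (\<lambda>v. dp_eval (s v) w) x"
proof (induction p rule: dp_induct)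
  case (var v k)
  have "(xderiv ^^ k) (dp_eval (s v) w) = dp_eval ((dp_D ^^ k) (s v)) w"
    using assms by (induction k) (auto simp: xderiv_dp_eval)
  then show ?case by simp
qed auto

section \<open>Power series of differential polynomials\<close>

text \<open>Closeness in the \<open>X\<close>-adic topology, for which power series are
  complete.\<close>

definition fps_agree :: "nat \<Rightarrow> 'a fps \<Rightarrow> 'a::zero fps \<Rightarrow> bool" where
  "fps_agree n f g \<longleftrightarrow> (\<forall>k<n. fps_nth f k = fps_nth g k)"

lemma fps_agree_refl [simp, intro]: "fps_agree n f f"
  by (simp add: fps_agree_def)

lemma fps_agree_0 [simp]: "fps_agree 0 f g"
  by (simp add: fps_agree_def)

lemma fps_agree_all: "(\<And>n. fps_agree n f g) \<Longrightarrow> f = g"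
  by (auto simp: fps_agree_def fps_eq_iff)

lemma fps_agree_add: "fps_agree n f g \<Longrightarrow> fps_agree n f' g' \<Longrightarrow> fps_agree n (f + f') (g + g')"
  for f g :: "'a::comm_ring_1 fps"
  by (simp add: fps_agree_def)

lemma fps_agree_diff: "fps_agree n f g \<Longrightarrow> fps_agree n f' g' \<Longrightarrow> fps_agree n (f - f') (g - g')"
  for f g :: "'a::comm_ring_1 fps"
  by (simp add: fps_agree_def)

lemma fps_agree_minus: "fps_agree n f g \<Longrightarrow> fps_agree n (- f) (- g)"
  for f g :: "'a::comm_ring_1 fps"
  by (simp add: fps_agree_def)

lemma fps_agree_mult: "fps_agree n f g \<Longrightarrow> fps_agree n f' g' \<Longrightarrow> fps_agree n (f * f') (g * g')"
  for f g :: "'a::comm_ring_1 fps"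
  by (auto simp: fps_agree_def fps_mult_nth intro!: sum.cong)

lemma fps_agree_X: "fps_agree n f g \<Longrightarrow> fps_agree (Suc n) (fps_X * f) (fps_X * g)"
  for f g :: "'a::comm_ring_1 fps"
  by (auto simp: fps_agree_def)

text \<open>Banach's fixed point theorem for the \<open>X\<close>-adic metric. The series given by
  implicit equations below owe their existence and uniqueness to it.\<close>

lemma fps_contraction:
  assumes "\<And>n f g. fps_agree n f g \<Longrightarrow> fps_agree (Suc n) (\<Phi> f) (\<Phi> g)"
  shows "\<exists>!f. \<Phi> f = (f :: 'a::zero fps)"
proof (rule ex_ex1I)
  have stable: "m \<ge> n \<Longrightarrow> fps_agree n ((\<Phi> ^^ n) 0) ((\<Phi> ^^ m) 0)" for n m
  proof (induction n arbitrary: m)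
    case (Suc n)
    then obtain m' where "m = Suc m'" "n \<le> m'" by (cases m) auto
    then show ?case using assms[OF Suc.IH] by simp
  qed simp
  \<comment> \<open>Coefficient \<open>n\<close> no longer changes from iterate \<open>n + 1\<close>
    on.\<close>
  define F where "F = Abs_fps (\<lambda>n. fps_nth ((\<Phi> ^^ Suc n) 0) n)"
  have F: "fps_agree n F ((\<Phi> ^^ n) 0)" for n
    using stable[of "Suc _" n] by (auto simp: fps_agree_def F_def Suc_le_eq)
  have "fps_agree n (\<Phi> F) F" for n
    using assms[OF F[of n]] F[of "Suc n"] by (simp add: fps_agree_def)
  then show "\<exists>f. \<Phi> f = f" by (blast intro: fps_agree_all)
next
  fix f g
  assume *: "\<Phi> f = f" "\<Phi> g = g"
  have "fps_agree n f g" for n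
  proof (induction n)
    case (Suc n)
    from assms[OF Suc] * show ?case by simp
  qed simp
  then show "f = g" by (rule fps_agree_all)
qed

lemma fps_X_cancel: "fps_X * f = fps_X * g \<longleftrightarrow> f = g" for f g :: "'a::comm_ring_1 fps"
proof
  assume *: "fps_X * f = fps_X * g"
  have "fps_nth f n = fps_nth g n" for n
    using arg_cong[OF *, of "\<lambda>h. fps_nth h (Suc n)"] by simp
  then show "f = g" by (simp add: fps_eq_iff)
qed simp

section \<open>Adjoint calculus for series of differential polynomials\<close>

definition fps_D :: "('v, complex) dpoly fps \<Rightarrow> ('v, complex) dpoly fps" where
  "fps_D f = Abs_fps (\<lambda>n. dp_D (fps_nth f n))"

text \<open>The adjoint extended bilinearly to series: the convolution mirrors the Cauchy product,
  so the rules for single polynomials carry over unchanged.\<close>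

definition fps_adj ::
  "'v \<Rightarrow> ('v, complex) dpoly fps \<Rightarrow> ('v, complex) dpoly fps \<Rightarrow> ('v, complex) dpoly fps" where
  "fps_adj v S H = Abs_fps (\<lambda>n. \<Sum>i=0..n. dp_adj v (fps_nth S i) (fps_nth H (n - i)))"

definition fps_dc :: "complex fps \<Rightarrow> ('v, complex) dpoly fps" where
  "fps_dc f = Abs_fps (\<lambda>n. dp_const (fps_nth f n))"

lemma dp_const_sum: "dp_const (sum f S) = (\<Sum>i\<in>S. dp_const (f i :: 'a::comm_ring_1))"
  by (induction S rule: infinite_finite_induct) auto

lemma fps_dc_simps:
  "fps_dc 0 = 0" "fps_dc 1 = 1" "fps_dc (f + g) = fps_dc f + fps_dc g"
  "fps_dc (f - g) = fps_dc f - fps_dc g" "fps_dc (- f) = - fps_dc f"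
  "fps_dc (f * g) = fps_dc f * fps_dc g" "fps_dc fps_X = fps_X"
  "fps_dc (fps_const a) = fps_const (dp_const a)"
  by (simp_all add: fps_dc_def fps_eq_iff fps_mult_nth dp_const_sum fps_X_def)

lemma fps_D_simps [simp]:
  "fps_D (f + g) = fps_D f + fps_D g" "fps_D (f - g) = fps_D f - fps_D g" "fps_D (- f) = - fps_D f"
  "fps_D (fps_dc c) = 0" "fps_D 0 = 0" "fps_D 1 = 0" "fps_D fps_X = 0"
  "fps_D (fps_const p) = fps_const (dp_D p)"
  by (simp_all add: fps_D_def fps_dc_def fps_eq_iff fps_X_def)

lemma fps_D_mult: "fps_D (f * g) = fps_D f * g + f * fps_D g"
  by (simp add: fps_eq_iff fps_D_def fps_mult_nth dp_D_sum dp_D_mult sum.distrib)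

lemma fps_D_dc_mult [simp]: "fps_D (fps_dc c * g) = fps_dc c * fps_D g"
  by (simp add: fps_D_mult)

lemma fps_D_X_mult [simp]: "fps_D (fps_X * g) = fps_X * fps_D g"
  by (simp add: fps_D_mult)

lemma fps_agree_D: "fps_agree n f g \<Longrightarrow> fps_agree n (fps_D f) (fps_D g)"
  by (simp add: fps_agree_def fps_D_def)

lemmas fps_agree_intros = fps_agree_refl fps_agree_add fps_agree_diff fps_agree_minus
  fps_agree_mult fps_agree_D fps_agree_X

lemma fps_adj_add_left: "fps_adj v (S + S') H = fps_adj v S H + fps_adj v S' H"
  and fps_adj_add_right: "fps_adj v S (H + H') = fps_adj v S H + fps_adj v S H'"
  and fps_adj_minus_left: "fps_adj v (- S) H = - fps_adj v S H"
  and fps_adj_minus_right: "fps_adj v S (- H) = - fps_adj v S H"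
  by (simp_all add: fps_eq_iff fps_adj_def dp_adj_add_left dp_adj_add_right dp_adj_minus_left
      dp_adj_minus_right sum.distrib sum_negf)

lemma fps_adj_diff_left: "fps_adj v (S - S') H = fps_adj v S H - fps_adj v S' H"
  using fps_adj_add_left[of v S "- S'"] by (simp add: fps_adj_minus_left)

lemma fps_adj_diff_right: "fps_adj v S (H - H') = fps_adj v S H - fps_adj v S H'"
  using fps_adj_add_right[of v S H "- H'"] by (simp add: fps_adj_minus_right)

lemma fps_adj_D: "fps_adj v (fps_D S) H = - fps_adj v S (fps_D H)"
  by (simp add: fps_eq_iff fps_adj_def fps_D_def dp_adj_D sum_negf)

lemma fps_adj_dc [simp]: "fps_adj v (fps_dc c) H = 0"
  by (simp add: fps_eq_iff fps_adj_def fps_dc_def)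

lemma dp_adj_sum_left: "dp_adj v (sum f S) h = (\<Sum>i\<in>S. dp_adj v (f i) h)"
  by (induction S rule: infinite_finite_induct) (auto simp: dp_adj_add_left)

lemma dp_adj_sum_right: "dp_adj v p (sum f S) = (\<Sum>i\<in>S. dp_adj v p (f i))"
  by (induction S rule: infinite_finite_induct) (auto simp: dp_adj_add_right)

lemma fps_adj_mult_aux:
  "(\<Sum>k=0..n. \<Sum>i=0..k. dp_adj v (fps_nth P i) (fps_nth Q (k - i) * fps_nth H (n - k))) =
     fps_nth (fps_adj v P (Q * H)) n"
  using fps_mult_assoc_lemma[of "\<lambda>i j k. dp_adj v (fps_nth P i) (fps_nth Q j * fps_nth H k)" n]
  by (simp add: fps_adj_def fps_mult_nth dp_adj_sum_right)

lemma fps_adj_mult: "fps_adj v (P * Q) H = fps_adj v P (Q * H) + fps_adj v Q (P * H)"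
proof (rule fps_ext)
  fix n
  have "(\<Sum>k=0..n. \<Sum>i=0..k. dp_adj v (fps_nth Q (k - i)) (fps_nth P i * fps_nth H (n - k))) =
      (\<Sum>k=0..n. \<Sum>i=0..k. dp_adj v (fps_nth Q i) (fps_nth P (k - i) * fps_nth H (n - k)))"
    by (rule sum.cong[OF refl], subst sum.atLeastAtMost_rev, rule sum.cong[OF refl]) auto
  then show "fps_nth (fps_adj v (P * Q) H) n = fps_nth (fps_adj v P (Q * H) + fps_adj v Q (P * H)) n"
    unfolding fps_add_nth fps_adj_mult_aux[symmetric]
    by (simp add: fps_adj_def fps_mult_nth dp_adj_sum_left dp_adj_mult sum.distrib)
qed

text \<open>Adjoints are linear over constants, hence over series with constant coefficients. This
  lets factors such as \<open>X\<close> pass through.\<close>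

lemma fps_adj_dc_right: "fps_adj v S (fps_dc c * H) = fps_dc c * fps_adj v S H"
proof (rule fps_ext)
  fix n
  have "fps_nth (fps_adj v S (fps_dc c * H)) n =
      (\<Sum>k=0..n. \<Sum>i=0..k. dp_adj v (fps_nth S i) (fps_nth (fps_dc c) (k - i) * fps_nth H (n - k)))"
    by (rule fps_adj_mult_aux[symmetric])
  also have "\<dots> = (\<Sum>k=0..n. \<Sum>i=0..k. dp_adj v (fps_nth S (k - i)) (fps_nth (fps_dc c) i * fps_nth H (n - k)))"
    by (rule sum.cong[OF refl], subst sum.atLeastAtMost_rev, rule sum.cong[OF refl]) auto
  also have "\<dots> = (\<Sum>k=0..n. \<Sum>i=0..n-k. dp_adj v (fps_nth S i) (fps_nth (fps_dc c) k * fps_nth H (n - k - i)))"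
    by (rule fps_mult_assoc_lemma)
  also have "\<dots> = fps_nth (fps_dc c * fps_adj v S H) n"
    by (simp add: fps_mult_nth fps_adj_def fps_dc_def dp_adj_const_right sum_distrib_left)
  finally show "fps_nth (fps_adj v S (fps_dc c * H)) n = fps_nth (fps_dc c * fps_adj v S H) n" .
qed

lemma fps_adj_X_right: "fps_adj v S (fps_X * H) = fps_X * fps_adj v S H"
  using fps_adj_dc_right[of v S fps_X H] by (simp add: fps_dc_simps)

lemma fps_adj_dc_left: "fps_adj v (fps_dc c * S) H = fps_dc c * fps_adj v S H"
  by (simp add: fps_adj_mult fps_adj_dc_right)

lemma fps_adj_X_left: "fps_adj v (fps_X * S) H = fps_X * fps_adj v S H"
  using fps_adj_dc_left[of v fps_X S H] by (simp add: fps_dc_simps)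

lemma fps_adj_var:
  "fps_adj v (fps_const (dp_var u 0)) H = (if u = v then H else 0)"
proof -
  have "(\<Sum>i=0..n. dp_adj v (fps_nth (fps_const (dp_var u 0)) i) (fps_nth H (n - i))) =
      (\<Sum>i=0..n. if i = 0 then (if u = v then fps_nth H n else 0) else 0)" for n
    by (intro sum.cong) (auto simp: dp_adj_var)
  then show ?thesis by (simp add: fps_adj_def fps_eq_iff)
qed

lemma fps_adj_1_nth: "fps_nth (fps_adj v S 1) n = dp_euler v (fps_nth S n)"
proof -
  have "(\<Sum>i=0..n. dp_adj v (fps_nth S i) (fps_nth 1 (n - i))) =
      (\<Sum>i=0..n. if i = n then dp_adj v (fps_nth S n) 1 else 0)"
    by (intro sum.cong) auto
  then show ?thesis by (simp add: fps_adj_def dp_euler_adj)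
qed

section \<open>The resolvent of the NLS hierarchy\<close>

abbreviation "nq \<equiv> fps_const (dp_var NLS_q 0)"
abbreviation "nqbar \<equiv> fps_const (dp_var NLS_qbar 0)"

text \<open>The Riccati equation of \<sigma> / q. Dividing by \<open>q\<close> cancels the term with
  q_x / q, so the recursion stays polynomial.\<close>

definition nls_g :: "(nls_var, complex) dpoly fps" where
  "nls_g = (THE g. fps_X * fps_D g + nq * (fps_X * (g * g)) - fps_X * nqbar = g)"

text \<open>Solves the adjoint of the linearized Riccati equation of \<open>nls_g\<close>; the
  source is \<open>- X q\<close> because the density to be varied is \<open>q g\<close>.\<close>

definition nls_n :: "(nls_var, complex) dpoly fps" where
  "nls_n = (THE n. - (fps_X * fps_D n) + 2 * (fps_X * (nq * nls_g * n)) - fps_X * nq = n)"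

text \<open>With \<open>nls_n\<close> these are the combinations for which the Riccati equation
  becomes a linear system; their shape makes \<open>e^2 + 4 n k = 1\<close> an algebraic
  identity.\<close>

definition "nls_e = 1 - 2 * (nls_n * nls_g)"
definition "nls_k = nls_g - nls_n * (nls_g * nls_g)"

lemma nls_g_eq: "nls_g = fps_X * fps_D nls_g + nq * (fps_X * (nls_g * nls_g)) - fps_X * nqbar"
proof -
  have "\<exists>!g. fps_X * fps_D g + nq * (fps_X * (g * g)) - fps_X * nqbar = g"
    by (rule fps_contraction) (intro fps_agree_intros)
  from theI'[OF this] show ?thesis unfolding nls_g_def by simp
qed

lemma nls_n_eq: "nls_n = - (fps_X * fps_D nls_n) + 2 * (fps_X * (nq * nls_g * nls_n)) - fps_X * nq"
proof -
  have "\<exists>!n. - (fps_X * fps_D n) + 2 * (fps_X * (nq * nls_g * n)) - fps_X * nq = n"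
    by (rule fps_contraction) (intro fps_agree_intros)
  from theI'[OF this] show ?thesis unfolding nls_n_def by simp
qed

text \<open>Makes the definite description in \<open>dp_quot\<close> well defined when the divisor
  is a variable.\<close>

lemma dp_var_mult_left_cancel: "dp_var v k * p = dp_var v k * p' \<longleftrightarrow> p = p'"
proof
  have *: "Poly_Mapping.lookup (dp_var v k * p) (Poly_Mapping.single (v, k) 1 + m) =
      Poly_Mapping.lookup p m" for p :: "('a, complex) dpoly" and m
  proof (induction p rule: dp_single_induct)
    case (single m' c)
    show ?case by (simp add: dp_var_def mult_single lookup_single when_def)
  qed (simp add: distrib_left lookup_add)
  assume "dp_var v k * p = dp_var v k * p'"
  then have "Poly_Mapping.lookup p m = Poly_Mapping.lookup p' m" for m
    using *[of p m] *[of p' m] by simp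
  then show "p = p'" by (rule poly_mapping_eqI)
qed simp

lemma dp_quot_var: "dp_quot (dp_var v k * p) (dp_var v k) = p"
  by (simp add: dp_quot_def dp_var_mult_left_cancel)

lemma nls_g_0: "fps_nth nls_g 0 = 0"
  using arg_cong[OF nls_g_eq, of "\<lambda>f. fps_nth f 0"] by simp

lemma nls_g_Suc:
  "fps_nth nls_g (Suc n) = dp_D (fps_nth nls_g n) +
     dp_var NLS_q 0 * (\<Sum>i=0..n. fps_nth nls_g i * fps_nth nls_g (n - i)) -
     (if n = 0 then dp_var NLS_qbar 0 else 0)"
  using arg_cong[OF nls_g_eq, of "\<lambda>f. fps_nth f (Suc n)"] fps_mult_nth[of nls_g nls_g n]
  by (simp add: fps_D_def)

lemma nls_sigma_eq: "nls_sigma n = dp_var NLS_q 0 * fps_nth nls_g n"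
proof (induction n rule: nls_sigma.induct)
  case 1
  show ?case by (simp add: nls_g_0)
next
  case 2
  show ?case by (simp add: nls_g_Suc nls_g_0)
next
  case (3 n)
  have "(\<Sum>k\<le>Suc n. nls_sigma k * nls_sigma (Suc n - k)) =
     (\<Sum>k\<le>Suc n. dp_var NLS_q 0 * fps_nth nls_g k * (dp_var NLS_q 0 * fps_nth nls_g (Suc n - k)))"
    using 3 by (intro sum.cong refl) simp
  moreover have "dp_var NLS_q 1 * (dp_var NLS_q 0 * fps_nth nls_g (Suc n)) =
      dp_var NLS_q 0 * (dp_var NLS_q 1 * fps_nth nls_g (Suc n))"
    by (simp add: mult_ac)
  ultimately show ?case
    using 3 by (simp add: dp_quot_var nls_g_Suc[of "Suc n"] dp_D_mult sum_distrib_left atMost_atLeast0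
        algebra_simps del: sum.atMost_Suc sum.atLeast0_atMost_Suc)
qed

text \<open>The variation of \<open>g\<close> is paired with \<open>nls_n\<close>, and the
  linearized operator is moved from one factor to the other. Since the conjugate field enters the
  Riccati equation only through the source \<open>- X * nqbar\<close>, what remains is
  \<open>X * nls_n\<close>.\<close>

lemma nls_sigma_euler: "dp_euler NLS_qbar (nls_sigma j) = fps_nth nls_n j"
proof -
  let ?L = "fps_adj NLS_qbar"
  have q: "?L nq H = 0" and qb: "?L nqbar H = H" for H
    by (simp_all add: fps_adj_var)
  have X1: "fps_X * fps_D nls_g = nls_g - nq * (fps_X * (nls_g * nls_g)) + fps_X * nqbar"
    using nls_g_eq by (simp add: algebra_simps)
  \<comment> \<open>The adjoint equation, read as an expression for \<open>X q\<close>, the factor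
    against which the variation of \<open>g\<close> is tested.\<close>
  have X2: "fps_X * nq = - (fps_X * fps_D nls_n) +
      (fps_X * (nq * nls_g * nls_n) + fps_X * (nq * nls_g * nls_n)) - nls_n"
    using nls_n_eq by (simp add: algebra_simps)
  have "fps_X * ?L (nq * nls_g) 1 = ?L nls_g (fps_X * nq)"
    by (simp add: fps_adj_mult q fps_adj_X_right)
  also have "\<dots> = fps_X * ?L (fps_D nls_g) nls_n +
      (fps_X * ?L nls_g (nq * nls_g * nls_n) + fps_X * ?L nls_g (nq * nls_g * nls_n)) - ?L nls_g nls_n"
    unfolding X2
    by (simp only: fps_adj_diff_right fps_adj_add_right fps_adj_minus_right fps_adj_X_right fps_adj_D
        mult_minus_right)
  also have "fps_X * ?L (fps_D nls_g) nls_n = ?L (fps_X * fps_D nls_g) nls_n"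
    by (simp add: fps_adj_X_left)
  also have "\<dots> = ?L nls_g nls_n - (fps_X * ?L nls_g (nq * nls_g * nls_n) + fps_X * ?L nls_g (nq * nls_g * nls_n))
      + fps_X * nls_n"
  proof -
    have "?L (nq * (fps_X * (nls_g * nls_g))) nls_n = fps_X * ?L (nls_g * nls_g) (nq * nls_n)"
      by (simp add: fps_adj_mult[of _ nq] q fps_adj_X_left)
    also have "\<dots> = fps_X * ?L nls_g (nq * nls_g * nls_n) + fps_X * ?L nls_g (nq * nls_g * nls_n)"
      by (simp add: fps_adj_mult distrib_left mult_ac)
    finally show ?thesis
      unfolding X1 by (simp add: fps_adj_diff_left fps_adj_add_left fps_adj_X_left qb)
  qed
  finally have "?L (nq * nls_g) 1 = nls_n"
    by (simp add: fps_X_cancel)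
  then show ?thesis
    using fps_adj_1_nth[of NLS_qbar "nq * nls_g" j] by (simp add: nls_sigma_eq)
qed

lemma nls_resolvent:
  "fps_X * fps_D nls_n = - nls_n - fps_X * nq * nls_e"
  "fps_X * fps_D nls_k = nls_k + fps_X * nqbar * nls_e"
  "nls_e * nls_e + 4 * nls_n * nls_k = 1"
  "fps_nth nls_n 0 = 0" "fps_nth nls_k 0 = 0" "fps_nth nls_e 0 = 1"
proof -
  show 1: "fps_X * fps_D nls_n = - nls_n - fps_X * nq * nls_e"
    using nls_n_eq by (simp add: nls_e_def algebra_simps)
  have g: "fps_X * fps_D nls_g = nls_g - nq * (fps_X * (nls_g * nls_g)) + fps_X * nqbar"
    using nls_g_eq by (simp add: algebra_simps)
  have "fps_X * fps_D nls_k = (fps_X * fps_D nls_g) * (1 - 2 * nls_n * nls_g)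
      - (fps_X * fps_D nls_n) * (nls_g * nls_g)"
    by (simp add: nls_k_def fps_D_mult algebra_simps)
  also have "\<dots> = nls_k + fps_X * nqbar * nls_e"
    unfolding g 1 nls_k_def nls_e_def by (simp add: algebra_simps)
  finally show "fps_X * fps_D nls_k = nls_k + fps_X * nqbar * nls_e" .
  show "nls_e * nls_e + 4 * nls_n * nls_k = 1"
    by (simp add: nls_e_def nls_k_def algebra_simps)
  show n0: "fps_nth nls_n 0 = 0"
    using arg_cong[OF nls_n_eq, of "\<lambda>f. fps_nth f 0"] by simp
  show "fps_nth nls_k 0 = 0" "fps_nth nls_e 0 = 1"
    by (simp_all add: nls_k_def nls_e_def n0 nls_g_0)
qed

section \<open>The resolvent of the GP hierarchy\<close>

lemma fls_X_inv_cancel: "fls_X * (fls_X_inv * f) = f" "fls_X_inv * (fls_X * f) = f"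
  for f :: "'a::comm_ring_1 fls"
  by (simp_all add: fls_X_times_conv_shift fls_X_inv_times_conv_shift)

lemma fls_X_eq_iff: "f = g \<longleftrightarrow> fls_X * f = fls_X * g" for f g :: "'a::comm_ring_1 fls"
  by (metis fls_X_inv_cancel(2))

section \<open>The binomial series behind \<lambda>\<close>

text \<open>The series \<open>(1 - 2 X^2 / \<epsilon>^2)^c\<close>. It arises because 1 -
  \<epsilon>^2 y^2 / 2 equals - \<epsilon>^2 y^2 / 2 times the case \<open>c = 1\<close> at
  \<open>X = 1 / y\<close>.\<close>

definition gp_B :: "real \<Rightarrow> complex \<Rightarrow> complex fps" where
  "gp_B \<epsilon> c = fps_binomial c oo (fps_const (- 2 / (complex_of_real \<epsilon>)\<^sup>2) * fps_X ^ 2)"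

lemma gp_B_0 [simp]: "gp_B \<epsilon> 0 = 1"
  by (simp add: gp_B_def)

lemma gp_B_add: "gp_B \<epsilon> (c + d) = gp_B \<epsilon> c * gp_B \<epsilon> d"
  by (simp add: gp_B_def fps_binomial_add_mult fps_compose_mult_distrib)

lemma gp_B_1: "gp_B \<epsilon> 1 = 1 - fps_const (2 / (complex_of_real \<epsilon>)\<^sup>2) * fps_X ^ 2"
  by (simp add: gp_B_def fps_binomial_1 fps_compose_add_distrib fps_const_neg[symmetric] del: fps_const_neg)

lemma gp_B_nth_0 [simp]: "fps_nth (gp_B \<epsilon> c) 0 = 1"
  by (simp add: gp_B_def)

lemma gp_B_power: "gp_B \<epsilon> c ^ n = gp_B \<epsilon> (of_nat n * c)"
  by (induction n) (simp_all add: gp_B_add[symmetric] algebra_simps)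

lemma gp_B_nth:
  "fps_nth (gp_B \<epsilon> c) n =
     (if even n then (c gchoose (n div 2)) * (- 2 / (complex_of_real \<epsilon>)\<^sup>2) ^ (n div 2) else 0)"
proof -
  let ?a = "- 2 / (complex_of_real \<epsilon>)\<^sup>2"
  have "fps_nth (gp_B \<epsilon> c) n = (\<Sum>i=0..n. (c gchoose i) * (if n = 2 * i then ?a ^ i else 0))"
    unfolding gp_B_def fps_compose_nth
    by (intro sum.cong) (auto simp: power_mult_distrib fps_const_power power_mult[symmetric])
  also have "\<dots> = (\<Sum>i=0..n. if i = n div 2 then
      (if even n then (c gchoose (n div 2)) * ?a ^ (n div 2) else 0) else 0)"
    by (intro sum.cong) auto
  also have "\<dots> = (if even n then (c gchoose (n div 2)) * ?a ^ (n div 2) else 0)"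
    by (subst sum.delta) auto
  finally show ?thesis .
qed

locale gp =
  fixes \<epsilon> :: real
  assumes eps: "\<epsilon> > 0"
begin

definition "kap = \<i> * complex_of_real \<epsilon> / complex_of_real (sqrt 2)"
definition "ell = fps_const (- kap) * gp_B \<epsilon> (1 / 2)"

abbreviation "eps2 \<equiv> (complex_of_real \<epsilon>)\<^sup>2"
abbreviation "sw \<equiv> sqrt 2 * \<epsilon>"
abbreviation C :: "complex \<Rightarrow> (gp_var, complex) dpoly fps" where "C a \<equiv> fps_const (dp_const a)"
abbreviation "x \<equiv> (fps_X :: (gp_var, complex) dpoly fps)"
abbreviation "L \<equiv> (fps_dc ell :: (gp_var, complex) dpoly fps)"
abbreviation "P \<equiv> fps_const Wp"
abbreviation "M \<equiv> fps_const Wm"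

lemma eps_nz [simp]: "\<epsilon> \<noteq> 0"
  using eps by simp

lemma sqrt2_sq: "complex_of_real (sqrt 2) * complex_of_real (sqrt 2) = 2"
  by (simp flip: of_real_mult)

lemma kap_sq: "kap * kap = - eps2 / 2"
proof -
  have "kap * kap = (\<i> * \<i>) * eps2 / (complex_of_real (sqrt 2) * complex_of_real (sqrt 2))"
    by (simp only: kap_def power2_eq_square times_divide_times_eq mult_ac)
  then show ?thesis unfolding sqrt2_sq by simp
qed

lemma ell_sq: "ell * ell = fps_X * fps_X - fps_const (eps2 / 2)"
proof -
  have "ell * ell = fps_const (kap * kap) * (gp_B \<epsilon> (1 / 2) * gp_B \<epsilon> (1 / 2))"
    by (simp add: ell_def mult_ac fps_const_mult[symmetric] del: fps_const_mult)
  also have "gp_B \<epsilon> (1 / 2) * gp_B \<epsilon> (1 / 2) = gp_B \<epsilon> 1"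
    by (simp flip: gp_B_add)
  finally have *: "ell * ell = fps_const (- eps2 / 2) *
      (1 - fps_const (2 / eps2) * fps_X ^ 2)"
    unfolding kap_sq gp_B_1 .
  show ?thesis
    unfolding * by (simp add: fps_eq_iff power2_eq_square algebra_simps)
qed

lemma ell_0: "fps_nth ell 0 = - kap"
  by (simp add: ell_def)

text \<open>In an integral domain square roots agree up to sign, and the prescribed coefficient of
  \<open>y\<close> selects the sign.\<close>

lemma gp_lambda_eq: "gp_lambda \<epsilon> = fls_X_inv * fps_to_fls ell"
proof -
  let ?E = "fls_const (complex_of_real (\<epsilon>\<^sup>2 / 2))"
  let ?l = "fls_X_inv * fps_to_fls ell"
  have "?l ^ 2 = fls_X_inv ^ 2 * fps_to_fls (ell * ell)"
    by (simp add: power2_eq_square fls_times_fps_to_fls mult_ac)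
  also have "\<dots> = fls_X_inv * (fls_X * (fls_X_inv * (fls_X * 1))) - ?E * fls_X_inv ^ 2"
    unfolding ell_sq by (simp add: fls_times_fps_to_fls algebra_simps power2_eq_square)
  also have "\<dots> = 1 - ?E * fls_X_inv ^ 2"
    unfolding fls_X_inv_cancel ..
  finally have sq: "?l ^ 2 = 1 - ?E * fls_X_inv ^ 2" .
  have co: "fls_nth ?l (- 1) = - kap"
    by (simp add: fls_X_inv_times_conv_shift ell_0)
  show ?thesis
    unfolding gp_lambda_def
  proof (rule the_equality)
    show "?l ^ 2 = 1 - ?E * fls_X_inv ^ 2 \<and> fls_nth ?l (- 1) = - (\<i> * \<epsilon> / sqrt 2)"
      using sq co by (simp add: kap_def)
  next
    fix l
    assume l: "l ^ 2 = 1 - ?E * fls_X_inv ^ 2 \<and> fls_nth l (- 1) = - (\<i> * \<epsilon> / sqrt 2)"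
    then have "l = ?l \<or> l = - ?l"
      using sq power2_eq_iff by metis
    moreover have "fls_nth (- ?l) (- 1) \<noteq> fls_nth l (- 1)"
      using l co by (simp add: kap_def)
    ultimately show "l = ?l" by metis
  qed
qed

lemma gp_Lambda_eq: "gp_Lambda \<epsilon> = fls_X_inv * fps_to_fls L"
proof (rule fls_eqI)
  fix n
  have "fls_nth (gp_Lambda \<epsilon>) n = dp_const (fls_nth (gp_lambda \<epsilon>) n)"
    unfolding gp_Lambda_def
    by (rule nth_Abs_fls_lower_bound[of "- 1"]) (simp add: gp_lambda_eq fls_X_inv_times_conv_shift)
  then show "fls_nth (gp_Lambda \<epsilon>) n = fls_nth (fls_X_inv * fps_to_fls L) n"
    by (simp add: gp_lambda_eq fls_X_inv_times_conv_shift fps_dc_def)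
qed

section \<open>Riccati equations of the GP hierarchy\<close>

lemma C_simps: "C a * C b = C (a * b)" "C a + C b = C (a + b)" "C 1 = 1" "C 0 = 0" "- C a = C (- a)"
  by simp_all

lemma C_dc: "C a = fps_dc (fps_const a)"
  by (simp add: fps_dc_simps)

text \<open>With \<open>X = y\<^sup>-\<^sup>1\<close>, all series are made free of poles: \<open>ell\<close> is \<open>\<lambda> / y\<close>, and \<open>gp_a\<close>, \<open>gp_b\<close> are \<open>\<alpha> / y\<close>, \<open>\<beta> / y\<close> for the
  Riccati equation \<open>\<partial>\<^sub>X r = \<alpha> r\<^sup>2 + \<beta>\<close>.\<close>

definition "gp_a = C kap * (C (1 / eps2) * (x + L) + x * P)"
definition "gp_b = C kap * (C (1 / eps2) * (x - L) - x * M)"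

lemma gp_Lambda_X: "fls_X * gp_Lambda \<epsilon> = fps_to_fls L"
  by (simp add: gp_Lambda_eq fls_X_inv_cancel)

lemma fps_dp_D_eq: "fps_dp_D = fps_D"
  by (simp add: fps_dp_D_def fps_D_def fun_eq_iff)

lemma gp_r_iff:
  "fps_to_fls (fps_dp_D r) =
       fls_scal (\<i> * \<epsilon> / sqrt 2) *
         (fls_scal (1 / \<epsilon>\<^sup>2) * (1 + gp_Lambda \<epsilon>) + fls_const Wp) * fps_to_fls r ^ 2
       + fls_scal (\<i> * \<epsilon> / sqrt 2) *
         (fls_scal (1 / \<epsilon>\<^sup>2) * (1 - gp_Lambda \<epsilon>) - fls_const Wm)
   \<longleftrightarrow> x * fps_D r = gp_a * (r * r) + gp_b"
    (is "?l = ?r \<longleftrightarrow> _")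
proof -
  have k: "\<i> * complex_of_real \<epsilon> / complex_of_real (sqrt 2) = kap" by (simp add: kap_def)
  have "fls_X * ?r = fls_scal kap *
         (fls_scal (1 / \<epsilon>\<^sup>2) * (fls_X + fls_X * gp_Lambda \<epsilon>) + fls_X * fls_const Wp) * (fps_to_fls r * fps_to_fls r)
       + fls_scal kap * (fls_scal (1 / \<epsilon>\<^sup>2) * (fls_X - fls_X * gp_Lambda \<epsilon>) - fls_X * fls_const Wm)"
    unfolding k power2_eq_square[of "fps_to_fls r"]
    by (simp only: distrib_left distrib_right right_diff_distrib left_diff_distrib mult_ac mult_1_right mult_1)
  also have "\<dots> = fps_to_fls (gp_a * (r * r) + gp_b)"
    unfolding gp_Lambda_X by (simp add: gp_a_def gp_b_def fls_times_fps_to_fls)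
  finally have "fls_X * ?r = fps_to_fls (gp_a * (r * r) + gp_b)" .
  moreover have "fls_X * ?l = fps_to_fls (x * fps_D r)"
    by (simp add: fls_times_fps_to_fls fps_dp_D_eq)
  ultimately show ?thesis
    unfolding fls_X_eq_iff[of ?l] by (simp only: fps_to_fls_eq_iff)
qed

text \<open>The field-free part of \<open>gp_a\<close> that carries its constant term
  \<open>1 / 2\<close>. It is invertible and occurs in \<open>gp_b\<close> with the opposite
  sign.\<close>

definition "gp_a0 = fps_const (kap / eps2) * ell"

lemma gp_a0_nth: "fps_nth gp_a0 0 = 1 / 2"
  using kap_sq by (simp add: gp_a0_def ell_0 field_simps)

lemma gp_a_split: "gp_a = fps_dc gp_a0 + x * (C (kap / eps2) + C kap * P)"
  and gp_b_split: "gp_b = - fps_dc gp_a0 + x * (C (kap / eps2) - C kap * M)"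
proof -
  have *: "C (kap / eps2) = C kap * C (1 / eps2)"
    unfolding C_simps by simp
  have **: "fps_dc gp_a0 = C kap * C (1 / eps2) * L"
    unfolding gp_a0_def fps_dc_simps * by (rule refl)
  show "gp_a = fps_dc gp_a0 + x * (C (kap / eps2) + C kap * P)"
    "gp_b = - fps_dc gp_a0 + x * (C (kap / eps2) - C kap * M)"
    unfolding * ** gp_a_def gp_b_def
    by (simp_all only: distrib_left distrib_right right_diff_distrib left_diff_distrib mult_ac add_ac
        diff_conv_add_uminus mult_minus_right mult_minus_left minus_add_distrib)
qed

lemma half: "C (1 / 2) + C (1 / 2) = 1"
  unfolding C_simps by simp

text \<open>At \<open>X = 0\<close> the equation reads \<open>(r^2 - 1) / 2 = 0\<close>, which is
  compatible with the prescribed value 1. Around it the linear part \<open>2 * gp_a0\<close> is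
  invertible and determines all further coefficients.\<close>

lemma gp_r_ex1: "\<exists>!r. fps_nth r 0 = 1 \<and> x * fps_D r = gp_a * (r * r) + gp_b"
proof -
  define a0 where "a0 = (fps_dc gp_a0 :: (gp_var, complex) dpoly fps)"
  define u where "u = (fps_dc (inverse gp_a0) :: (gp_var, complex) dpoly fps)"
  define a1 where "a1 = C (kap / eps2) + C kap * P"
  define b1 where "b1 = C (kap / eps2) - C kap * M"
  define h where "h = C (1 / 2)"
  have "inverse gp_a0 * gp_a0 = 1"
    by (rule inverse_mult_eq_1) (simp add: gp_a0_nth)
  then have ua: "u * a0 = 1"
    unfolding u_def a0_def fps_dc_simps(6)[symmetric] by (simp add: fps_dc_simps)
  have h2: "h + h = 1" unfolding h_def by (rule half)
  \<comment> \<open>The equation for \<open>r = 1 + x * w\<close>, divided by \<open>x\<close> and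
    solved for the linear term \<open>2 * a0 * w\<close>.\<close>
  define \<Phi> where "\<Phi> w = h * u * (x * fps_D w - a1 * ((1 + x * w) * (1 + x * w)) - b1) - h * (x * (w * w))" for w
  have ex: "\<exists>!w. \<Phi> w = w"
  proof (rule fps_contraction)
    fix n and f g :: "(gp_var, complex) dpoly fps"
    assume "fps_agree n f g"
    then show "fps_agree (Suc n) (\<Phi> f) (\<Phi> g)"
      unfolding \<Phi>_def by (intro fps_agree_intros)
  qed
  have key: "x * fps_D (1 + x * w) = gp_a * ((1 + x * w) * (1 + x * w)) + gp_b \<longleftrightarrow> \<Phi> w = w" for w
  proof -
    let ?R = "(1 + x * w) * (1 + x * w)"
    have "gp_a * ?R + gp_b = x * (a0 * (w + w + x * (w * w)) + a1 * ?R + b1)"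
      unfolding gp_a_split gp_b_split a0_def[symmetric] a1_def[symmetric] b1_def[symmetric]
      by (simp add: algebra_simps)
    then have "x * fps_D (1 + x * w) = gp_a * ?R + gp_b \<longleftrightarrow>
        x * fps_D w = a0 * (w + w + x * (w * w)) + a1 * ?R + b1"
      by (simp add: fps_X_cancel)
    also have "\<dots> \<longleftrightarrow> \<Phi> w = w"
    proof
      assume "x * fps_D w = a0 * (w + w + x * (w * w)) + a1 * ?R + b1"
      then have "\<Phi> w = h * ((u * a0) * (w + w + x * (w * w))) - h * (x * (w * w))"
        unfolding \<Phi>_def by (simp add: algebra_simps)
      also have "\<dots> = (h + h) * w"
        unfolding ua by (simp add: algebra_simps)
      finally show "\<Phi> w = w" unfolding h2 by simp
    next
      assume w: "\<Phi> w = w"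
      have "a0 * (w + w + x * (w * w)) = a0 * (\<Phi> w + \<Phi> w + x * (w * w))" unfolding w ..
      also have "\<dots> = (h + h) * ((u * a0) * (x * fps_D w - a1 * ?R - b1)) - (h + h) * (a0 * (x * (w * w))) + a0 * (x * (w * w))"
        unfolding \<Phi>_def by (simp only: algebra_simps)
      also have "\<dots> = x * fps_D w - a1 * ?R - b1" unfolding h2 ua by simp
      finally show "x * fps_D w = a0 * (w + w + x * (w * w)) + a1 * ?R + b1"
        by (simp only: algebra_simps)
    qed
    finally show ?thesis .
  qed
  have form: "r = 1 + x * fps_shift 1 r" if "fps_nth r 0 = 1" for r :: "(gp_var, complex) dpoly fps"
  proof (rule fps_ext)
    fix n show "fps_nth r n = fps_nth (1 + x * fps_shift 1 r) n"
      using that by (cases n) auto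
  qed
  from ex obtain w where w: "\<Phi> w = w" by blast
  show ?thesis
  proof (rule ex1I)
    show "fps_nth (1 + x * w) 0 = 1 \<and> x * fps_D (1 + x * w) = gp_a * ((1 + x * w) * (1 + x * w)) + gp_b"
      using key w by simp
  next
    fix r
    assume r: "fps_nth r 0 = 1 \<and> x * fps_D r = gp_a * (r * r) + gp_b"
    then have "\<Phi> (fps_shift 1 r) = fps_shift 1 r"
      using form key by metis
    then have "fps_shift 1 r = w" using ex w by blast
    then show "r = 1 + x * w" using form r by metis
  qed
qed

abbreviation "r \<equiv> gp_r \<epsilon>"

lemma gp_r: "fps_nth r 0 = 1" "x * fps_D r = gp_a * (r * r) + gp_b"
  using theI'[OF gp_r_ex1] unfolding gp_r_def gp_r_iff by auto

lemma gp_a_nth_0: "fps_nth gp_a 0 = dp_const (1 / 2)"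
  unfolding gp_a_split by (simp add: fps_dc_def gp_a0_nth)

text \<open>The field-free terms collapse to \<open>- 1 / 4\<close> by the formula for \<lambda>^2.
  The others are, with opposite sign, \<open>x\<close> times the source of the equation for \<sigma>
  without its term in \<open>r\<close>.\<close>

lemma gp_ab:
  "gp_a * gp_b = - C (1 / 4) + C (1 / 2) * ((x + L) * x * M) - C (1 / 2) * (x * P * (x - L))
     + C (eps2 / 2) * (x * x * P * M)"
proof -
  let ?c = "C (1 / eps2)"
  have LL: "L * L = x * x - C (eps2 / 2)"
    using arg_cong[OF ell_sq, of "fps_dc :: _ \<Rightarrow> (gp_var, complex) dpoly fps"] by (simp only: fps_dc_simps)
  have "gp_a * gp_b = (C kap * C kap * ?c * ?c) * (x * x - L * L) - (C kap * C kap * ?c) * ((x + L) * x * M)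
      + (C kap * C kap * ?c) * (x * P * (x - L)) - (C kap * C kap) * (x * x * P * M)"
    unfolding gp_a_def gp_b_def by (simp only: algebra_simps)
  also have "C kap * C kap * ?c = C (- 1 / 2)"
    unfolding C_simps kap_sq by (simp del: dp_const_simps)
  also have "C kap * C kap = C (- (eps2 / 2))"
    unfolding C_simps kap_sq by (simp del: dp_const_simps)
  finally have "gp_a * gp_b = C (- 1 / 2) * ?c * C (eps2 / 2) - C (- 1 / 2) * ((x + L) * x * M)
      + C (- 1 / 2) * (x * P * (x - L)) - C (- (eps2 / 2)) * (x * x * P * M)"
    unfolding LL by (simp only: algebra_simps) simp
  also have "C (- 1 / 2) * ?c * C (eps2 / 2) = - C (1 / 4)"
    unfolding C_simps by (simp del: dp_const_simps)
  also have "C (- 1 / 2) = - C (1 / 2)"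
    unfolding C_simps by simp
  also have "C (- (eps2 / 2)) = - C (eps2 / 2)"
    unfolding C_simps by simp
  finally have E: "gp_a * gp_b = - C (1 / 4) - - C (1 / 2) * ((x + L) * x * M)
      + - C (1 / 2) * (x * P * (x - L)) - - C (eps2 / 2) * (x * x * P * M)" .
  show ?thesis
    unfolding E by (simp only: mult_minus_left diff_minus_eq_add add_uminus_conv_diff)
qed

definition "sig_src = C (1 / 2) * (- (C (eps2) * (x * (M * P))) - (x + L) * M + (x - L) * P
    - C (\<i> * sqrt 2 * \<epsilon>) * (x * fps_D P * r))"

lemma gp_sigma_iff:
  "fps_to_fls (fps_dp_D s) =
       fls_X_inv * fps_to_fls s - fps_to_fls s ^ 2
       + fls_scal (1 / 2) *
         (- (fls_scal (\<epsilon>\<^sup>2) * fls_const (Wm * Wp))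
          - (1 + gp_Lambda \<epsilon>) * fls_const Wm
          + (1 - gp_Lambda \<epsilon>) * fls_const Wp
          - fls_scal (\<i> * sqrt 2 * \<epsilon>) * fls_const (dp_D Wp) * fps_to_fls (gp_r \<epsilon>))
   \<longleftrightarrow> x * fps_D s = s - x * (s * s) + sig_src" (is "?l = ?r \<longleftrightarrow> _")
proof -
  have "fls_X * ?r = fls_X * (fls_X_inv * fps_to_fls s) - fls_X * (fps_to_fls s * fps_to_fls s)
       + fls_scal (1 / 2) *
         (- (fls_scal (\<epsilon>\<^sup>2) * (fls_X * (fls_const Wm * fls_const Wp)))
          - (fls_X + fls_X * gp_Lambda \<epsilon>) * fls_const Wm
          + (fls_X - fls_X * gp_Lambda \<epsilon>) * fls_const Wp
          - fls_scal (\<i> * sqrt 2 * \<epsilon>) * (fls_X * fls_const (dp_D Wp) * fps_to_fls (gp_r \<epsilon>)))"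
    unfolding power2_eq_square[of "fps_to_fls s"] fls_const_mult_const[symmetric, of Wm Wp]
    by (simp only: algebra_simps mult_1_right mult_1 mult_minus_right mult_minus_left)
  also have "\<dots> = fps_to_fls (s - x * (s * s) + sig_src)"
    unfolding gp_Lambda_X fls_X_inv_cancel
    by (simp add: sig_src_def fls_times_fps_to_fls)
  finally have "fls_X * ?r = fps_to_fls (s - x * (s * s) + sig_src)" .
  moreover have "fls_X * ?l = fps_to_fls (x * fps_D s)"
    by (simp add: fls_times_fps_to_fls fps_dp_D_eq)
  ultimately show ?thesis
    unfolding fls_X_eq_iff[of ?l] by (simp only: fps_to_fls_eq_iff)
qed

abbreviation "sg \<equiv> gp_sigma \<epsilon>"

text \<open>In the original variables \<open>\<sigma> = y / 2 - \<alpha> r\<close>, so that only the Riccati equation of \<open>r\<close> matters.\<close>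

lemma gp_sigma_r: "x * sg = C (1 / 2) - gp_a * r"
proof -
  \<comment> \<open>The constant terms of \<open>1 / 2\<close> and \<open>gp_a * r\<close> cancel,
    so division by \<open>x\<close> is possible.\<close>
  define s where "s = fps_shift 1 (C (1 / 2) - gp_a * r)"
  have xs: "x * s = C (1 / 2) - gp_a * r"
  proof (rule fps_ext)
    fix n show "fps_nth (x * s) n = fps_nth (C (1 / 2) - gp_a * r) n"
      by (cases n) (auto simp: s_def gp_a_nth_0 gp_r)
  qed
  have Da: "fps_D gp_a = C kap * (x * fps_D P)"
    unfolding gp_a_split fps_D_simps(1,4) C_dc by (simp only: fps_D_dc_mult fps_D_X_mult fps_D_simps) simp
  \<comment> \<open>The term with \<open>fps_D P\<close> in the source of \<sigma> comes from the
    derivative of \<open>gp_a\<close>, in which it has the coefficient \<open>kap\<close>.\<close>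
  have k: "C (1 / 2) * C (\<i> * sqrt 2 * \<epsilon>) = C kap"
  proof -
    have "(1 / 2) * (\<i> * sqrt 2 * \<epsilon>) = kap * ((complex_of_real (sqrt 2) * complex_of_real (sqrt 2)) / 2)"
      by (simp add: kap_def)
    then show ?thesis unfolding C_simps sqrt2_sq by (simp del: dp_const_simps)
  qed
  have "x * (x * fps_D s) = x * fps_D (x * s)" by simp
  also have "\<dots> = - (x * fps_D gp_a * r) - gp_a * (x * fps_D r)"
    unfolding xs C_dc fps_D_simps fps_D_mult by (simp add: algebra_simps)
  also have "\<dots> = - (x * fps_D gp_a * r) - gp_a * gp_b - gp_a * r * (gp_a * r)"
    unfolding gp_r(2) by (simp add: algebra_simps)
  also have "\<dots> = x * (s - x * (s * s) + sig_src)"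
  proof -
    have "x * (s - x * (s * s) + sig_src) = x * s - (x * s) * (x * s) + x * sig_src"
      by (simp only: algebra_simps)
    also have "\<dots> = (C (1 / 2) - C (1 / 2) * C (1 / 2)) - gp_a * r + (C (1 / 2) + C (1 / 2)) * (gp_a * r)
        - gp_a * r * (gp_a * r) + x * sig_src"
      unfolding xs by (simp only: algebra_simps)
    also have "\<dots> = C (1 / 4) - gp_a * r * (gp_a * r) + x * sig_src"
    proof -
      have "C (1 / 2) - C (1 / 2) * C (1 / 2) = C (1 / 4)"
        unfolding C_simps diff_conv_add_uminus by (simp del: dp_const_simps)
      then show ?thesis unfolding half by simp
    qed
    also have "x * sig_src = - (C (1 / 2) * C (eps2)) * (x * x * P * M)
        - C (1 / 2) * ((x + L) * x * M) + C (1 / 2) * (x * P * (x - L))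
        - (C (1 / 2) * C (\<i> * sqrt 2 * \<epsilon>)) * (x * x * fps_D P * r)"
      unfolding sig_src_def by (simp only: algebra_simps mult_minus_right mult_minus_left)
    also have "C (1 / 2) * C (eps2) = C (eps2 / 2)"
      unfolding C_simps by (simp del: dp_const_simps)
    finally have E: "x * (s - x * (s * s) + sig_src) = C (1 / 4) - gp_a * r * (gp_a * r) +
        (- C (eps2 / 2) * (x * x * P * M) - C (1 / 2) * ((x + L) * x * M)
        + C (1 / 2) * (x * P * (x - L)) - C (1 / 2) * C (\<i> * sqrt 2 * \<epsilon>) * (x * x * fps_D P * r))" .
    \<comment> \<open>The ring identity behind the comparison, with the composite factors treated as
      indeterminates.\<close>
    have "- (X * (K * (X * D)) * R) - (- q + h * m - h * p + e * w) - z =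
        q - z + (- e * w - h * m + h * p - K * (X * X * D * R))"
      for X K D R q h m p e w z :: "(gp_var, complex) dpoly fps"
      by (simp add: algebra_simps)
    then show ?thesis
      unfolding E k Da gp_ab .
  qed
  finally have s: "x * fps_D s = s - x * (s * s) + sig_src"
    by (simp only: fps_X_cancel)
  have iff: "x * fps_D t = t - x * (t * t) + sig_src \<longleftrightarrow> x * fps_D t + x * (t * t) - sig_src = t" for t
    by (auto simp: algebra_simps)
  have "\<exists>!t. x * fps_D t + x * (t * t) - sig_src = t"
    by (rule fps_contraction) (intro fps_agree_intros)
  then have "sg = s"
    unfolding gp_sigma_def gp_sigma_iff iff using s[unfolded iff] by (blast intro: the1_equality)
  then show ?thesis using xs by simp
qed

section \<open>The linearized triple and the gradient of \<sigma>\<close>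

text \<open>The adjoint equation \<open>x * fps_D p = - gp_a - 2 * gp_a * r * p\<close> as a fixed
  point problem. Since \<open>2 * gp_a * r\<close> has constant term 1, one copy of \<open>p\<close>
  is moved to the other side, and the factor left over is divisible by \<open>x\<close>.\<close>

definition "gp_p = (THE p. - gp_a - x * fps_D p - (gp_a * r + gp_a * r - 1) * p = p)"
definition "gp_s = r + gp_p * (r * r)"
definition "gp_f = 1 + 2 * (gp_p * r)"

lemma gp_p_eq: "- gp_a - x * fps_D gp_p - (gp_a * r + gp_a * r - 1) * gp_p = gp_p"
proof -
  have "\<exists>!p. - gp_a - x * fps_D p - (gp_a * r + gp_a * r - 1) * p = p"
  proof (rule fps_contraction)
    fix n and f g :: "(gp_var, complex) dpoly fps"
    assume "fps_agree n f g"
    define t where "t = fps_shift 1 (gp_a * r + gp_a * r - 1)"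
    have "gp_a * r + gp_a * r - 1 = x * t"
    proof (rule fps_ext)
      fix n
      have "dp_const (1 / 2) + dp_const (1 / 2) = (1 :: (gp_var, complex) dpoly)"
        by (simp flip: dp_const_simps(3) add: dp_const_simps(2))
      then show "fps_nth (gp_a * r + gp_a * r - 1) n = fps_nth (x * t) n"
        by (cases n) (auto simp: t_def gp_a_nth_0 gp_r)
    qed
    with \<open>fps_agree n f g\<close> show "fps_agree (Suc n) (- gp_a - x * fps_D f - (gp_a * r + gp_a * r - 1) * f)
        (- gp_a - x * fps_D g - (gp_a * r + gp_a * r - 1) * g)"
      by (simp only: mult.assoc) (intro fps_agree_intros)
  qed
  from theI'[OF this] show ?thesis unfolding gp_p_def .
qed

text \<open>The same passage from a Riccati equation to a linear system as for NLS, now with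
  \<open>gp_a\<close> and \<open>gp_b\<close> as off-diagonal entries.\<close>

lemma gp_psf:
  "x * fps_D gp_p = - (gp_a * gp_f)" "x * fps_D gp_s = gp_b * gp_f"
  "x * fps_D gp_f = 2 * (gp_b * gp_p) - 2 * (gp_a * gp_s)"
  "gp_f * gp_f = 1 + 4 * (gp_p * gp_s)"
proof -
  show p: "x * fps_D gp_p = - (gp_a * gp_f)"
    using gp_p_eq by (simp add: gp_f_def algebra_simps eq_neg_iff_add_eq_0)
  have "x * fps_D gp_s = (x * fps_D r) * (1 + 2 * (gp_p * r)) + (x * fps_D gp_p) * (r * r)"
    by (simp add: gp_s_def fps_D_mult algebra_simps)
  also have "\<dots> = gp_b * gp_f"
    unfolding p gp_r(2) gp_f_def by (simp add: algebra_simps)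
  finally show "x * fps_D gp_s = gp_b * gp_f" .
  have f: "gp_f = 1 + (gp_p * r + gp_p * r)"
    unfolding gp_f_def mult_2 by (rule refl)
  have "x * fps_D gp_f = x * fps_D (1 + (gp_p * r + gp_p * r))"
    by (subst f) (rule refl)
  also have "\<dots> = ((x * fps_D gp_p) * r + gp_p * (x * fps_D r)) + ((x * fps_D gp_p) * r + gp_p * (x * fps_D r))"
    unfolding fps_D_simps(1,6) fps_D_mult by (simp only: algebra_simps add_0)
  also have "\<dots> = 2 * (gp_b * gp_p) - 2 * (gp_a * gp_s)"
    unfolding p gp_r(2) gp_f_def gp_s_def by (simp add: algebra_simps)
  finally show "x * fps_D gp_f = 2 * (gp_b * gp_p) - 2 * (gp_a * gp_s)" .
  show "gp_f * gp_f = 1 + 4 * (gp_p * gp_s)"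
    by (simp add: gp_f_def gp_s_def algebra_simps)
qed

end

context gp
begin

lemma gp_adj_a: "fps_adj v gp_a H = (if v = W_plus then C kap * (x * H) else 0)"
  and gp_adj_b: "fps_adj v gp_b H = (if v = W_minus then - (C kap * (x * H)) else 0)"
  unfolding gp_a_split gp_b_split C_dc
  by (auto simp: fps_adj_add_left fps_adj_diff_left fps_adj_minus_left fps_adj_X_left fps_adj_dc_left
      fps_adj_var mult.left_commute[of fps_X])

text \<open>Varying \<open>gp_a * r\<close> leaves a term with the variation of \<open>r\<close>
  tested against \<open>gp_a\<close>. Substituting the adjoint equation for \<open>gp_a\<close>
  removes it by the Riccati equation; the variations of \<open>gp_a\<close> and \<open>gp_b\<close>
  remain, each of which contains only one field.\<close>

lemma gp_sigma_adj: "fps_adj v sg 1 = (if v = W_plus then - (C kap * gp_s) else C kap * gp_p)"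
proof -
  let ?L = "fps_adj v"
  have a: "gp_a = - (x * fps_D gp_p) - gp_a * r * gp_p - gp_a * r * gp_p"
    using gp_p_eq by (simp add: algebra_simps eq_neg_iff_add_eq_0)
  have "?L r gp_a = ?L r (- (x * fps_D gp_p) - gp_a * r * gp_p - gp_a * r * gp_p)"
    using a by simp
  also have "\<dots> = ?L (x * fps_D r) gp_p - ?L r (gp_a * r * gp_p) - ?L r (gp_a * r * gp_p)"
    by (simp only: fps_adj_diff_right fps_adj_minus_right fps_adj_X_right fps_adj_X_left fps_adj_D
        mult_minus_right)
  also have "?L (x * fps_D r) gp_p = ?L gp_a (r * r * gp_p) + (?L r (r * (gp_a * gp_p)) + ?L r (r * (gp_a * gp_p)))
      + ?L gp_b gp_p"
    unfolding gp_r(2) fps_adj_add_left fps_adj_mult[of v gp_a] fps_adj_mult[of v r] ..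
  also have "r * (gp_a * gp_p) = gp_a * r * gp_p"
    by (simp only: mult_ac)
  finally have rL: "?L r gp_a = ?L gp_a (r * r * gp_p) + ?L gp_b gp_p"
    by simp
  have "x * ?L sg 1 = ?L (x * sg) 1"
    by (simp only: fps_adj_X_left)
  also have "\<dots> = - (?L gp_a r + ?L r gp_a)"
    unfolding gp_sigma_r C_dc fps_adj_diff_left fps_adj_dc fps_adj_mult by simp
  also have "\<dots> = x * (if v = W_plus then - (C kap * gp_s) else C kap * gp_p)"
    unfolding rL gp_adj_a gp_adj_b gp_s_def by (cases v) (simp_all add: algebra_simps)
  finally show ?thesis unfolding fps_X_cancel .
qed

section \<open>Rotation to the NLS form\<close>

text \<open>To leading order \<open>gp_b = - gp_a\<close>. Then \<open>gp_N\<close> and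
  \<open>gp_K\<close> are the eigencombinations of the linear system, with eigenvalues
  \<open>- 2 * gp_a\<close> and \<open>2 * gp_a\<close>, and \<open>gp_e\<close> is the neutral
  one.\<close>

definition "gp_N = gp_s + gp_p + gp_f"
definition "gp_K = gp_s + gp_p - gp_f"
definition "gp_e = gp_s - gp_p"

definition "gp_w = complex_of_real sw"

lemma gp_w_nz [simp]: "gp_w \<noteq> 0"
  by (simp add: gp_w_def)

lemma gp_w_sq: "gp_w * gp_w = 2 * eps2"
  using sqrt2_sq by (simp add: gp_w_def power2_eq_square algebra_simps)

lemma gp_w_kap: "gp_w * kap = \<i> * eps2"
  by (simp add: gp_w_def kap_def power2_eq_square)

lemma gp_w_a: "C gp_w * gp_a = C \<i> * (x + L) + C (\<i> * eps2) * (x * P)"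
  and gp_w_b: "C gp_w * gp_b = C \<i> * (x - L) - C (\<i> * eps2) * (x * M)"
proof -
  have 1: "C gp_w * C kap = C (\<i> * eps2)"
    unfolding C_simps gp_w_kap ..
  have 2: "C gp_w * C kap * C (1 / eps2) = C \<i>"
    unfolding C_simps gp_w_kap by (simp del: dp_const_simps)
  have "C gp_w * gp_a = C gp_w * C kap * C (1 / eps2) * (x + L) + C gp_w * C kap * (x * P)"
    unfolding gp_a_def by (simp only: distrib_left mult.assoc)
  then show "C gp_w * gp_a = C \<i> * (x + L) + C (\<i> * eps2) * (x * P)"
    unfolding 2 unfolding 1 .
  have "C gp_w * gp_b = C gp_w * C kap * C (1 / eps2) * (x - L) - C gp_w * C kap * (x * M)"
    unfolding gp_b_def by (simp only: right_diff_distrib mult.assoc)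
  then show "C gp_w * gp_b = C \<i> * (x - L) - C (\<i> * eps2) * (x * M)"
    unfolding 2 unfolding 1 .
qed

text \<open>Under the ansatz \<open>gp_v\<close> becomes the phase gradient of the NLS field and
  \<open>gp_A2\<close> twice its modulus.\<close>

definition "gp_v = C (eps2) * (P + M)"
definition "gp_A2 = 2 + C (eps2) * (P - M)"

lemma gp_w_ab:
  "C gp_w * gp_b - C gp_w * gp_a = - (C \<i> * (L + L + x * gp_v))"
  "C gp_w * gp_b + C gp_w * gp_a = C \<i> * (x * gp_A2)"
proof -
  have 1: "C (\<i> * eps2) = C \<i> * C (eps2)" by simp
  show "C gp_w * gp_b - C gp_w * gp_a = - (C \<i> * (L + L + x * gp_v))"
    "C gp_w * gp_b + C gp_w * gp_a = C \<i> * (x * gp_A2)"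
    unfolding gp_w_a gp_w_b 1 gp_v_def gp_A2_def
    by (simp_all only: algebra_simps mult_2_right) simp_all
qed

lemma gp_NKe_x:
  "C gp_w * (x * fps_D gp_N) = - (C \<i> * (L + L + x * gp_v)) * gp_N - C \<i> * (x * gp_A2) * gp_e"
  "C gp_w * (x * fps_D gp_K) = C \<i> * (L + L + x * gp_v) * gp_K + C \<i> * (x * gp_A2) * gp_e"
proof -
  have "C gp_w * (x * fps_D gp_N) = C gp_w * (x * fps_D gp_s + x * fps_D gp_p + x * fps_D gp_f)"
    unfolding gp_N_def by (simp add: algebra_simps)
  also have "\<dots> = (C gp_w * gp_b - C gp_w * gp_a) * gp_N - (C gp_w * gp_b + C gp_w * gp_a) * gp_e"
    unfolding gp_psf gp_N_def gp_e_def by (simp add: algebra_simps)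
  finally show "C gp_w * (x * fps_D gp_N) = - (C \<i> * (L + L + x * gp_v)) * gp_N - C \<i> * (x * gp_A2) * gp_e"
    unfolding gp_w_ab .
  have "C gp_w * (x * fps_D gp_K) = C gp_w * (x * fps_D gp_s + x * fps_D gp_p - x * fps_D gp_f)"
    unfolding gp_K_def by (simp add: algebra_simps)
  also have "\<dots> = - (C gp_w * gp_b - C gp_w * gp_a) * gp_K + (C gp_w * gp_b + C gp_w * gp_a) * gp_e"
    unfolding gp_psf gp_K_def gp_e_def by (simp add: algebra_simps)
  finally show "C gp_w * (x * fps_D gp_K) = C \<i> * (L + L + x * gp_v) * gp_K + C \<i> * (x * gp_A2) * gp_e"
    unfolding gp_w_ab minus_minus .
qed

text \<open>The inverse of the spectral parameter \<open>2 \<i> \<lambda>\<close> of the NLS hierarchy, as a series in \<open>y\<^sup>-\<^sup>1\<close>.\<close>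

definition "gp_zeta = fps_const (1 / gp_w) * (fps_X * gp_B \<epsilon> (- 1 / 2))"

lemma gp_zeta_ell: "gp_zeta * (fps_const \<i> * (ell + ell)) = fps_X"
proof -
  \<comment> \<open>\<open>- 2 * \<i> * kap = sqrt 2 * \<epsilon>\<close>, so 2 \<i> \<lambda> / y
    is \<open>sqrt 2 * \<epsilon>\<close> times the square root series.\<close>
  have c: "1 / gp_w * (- 2 * \<i> * kap) = 1"
  proof -
    have "- 2 * \<i> * kap = (\<i> * \<i>) * (- 2 * complex_of_real \<epsilon> / complex_of_real (sqrt 2))"
      by (simp only: kap_def mult_ac times_divide_eq_left times_divide_eq_right)
    also have "\<dots> = gp_w * (2 / (complex_of_real (sqrt 2) * complex_of_real (sqrt 2)))"
      by (simp add: gp_w_def)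
    finally show ?thesis unfolding sqrt2_sq by simp
  qed
  have "fps_const \<i> * (ell + ell) = fps_const (- 2 * \<i> * kap) * gp_B \<epsilon> (1 / 2)"
    unfolding ell_def by (simp add: fps_eq_iff)
  then have "gp_zeta * (fps_const \<i> * (ell + ell)) =
      fps_const (1 / gp_w * (- 2 * \<i> * kap)) * (fps_X * (gp_B \<epsilon> (- 1 / 2) * gp_B \<epsilon> (1 / 2)))"
    unfolding gp_zeta_def fps_const_mult[symmetric] by (simp only: mult_ac)
  then show ?thesis unfolding c gp_B_add[symmetric] by simp
qed

lemma gp_zeta_0: "fps_nth gp_zeta 0 = 0"
  by (simp add: gp_zeta_def)

text \<open>Multiplication by \<open>gp_zeta\<close> and cancellation of \<open>x\<close> normalize
  the coefficients of \<open>gp_N\<close> and \<open>gp_K\<close> to -1 and 1, as in the NLS system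
  with \<open>gp_zeta\<close> in place of \<open>X\<close>.\<close>

lemma gp_NKe:
  "fps_dc gp_zeta * (C gp_w * fps_D gp_N) = - gp_N - fps_dc gp_zeta * (C \<i> * (gp_v * gp_N + gp_A2 * gp_e))"
  "fps_dc gp_zeta * (C gp_w * fps_D gp_K) = gp_K + fps_dc gp_zeta * (C \<i> * (gp_v * gp_K + gp_A2 * gp_e))"
  "gp_e * gp_e - gp_N * gp_K = 1"
proof -
  let ?z = "fps_dc gp_zeta"
  have z: "?z * (C \<i> * (L + L)) = x"
    using arg_cong[OF gp_zeta_ell, of "fps_dc :: _ \<Rightarrow> (gp_var, complex) dpoly fps"] by (simp only: fps_dc_simps)
  have "x * (?z * (C gp_w * fps_D gp_N)) = ?z * (C gp_w * (x * fps_D gp_N))"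
    by (simp only: mult_ac)
  also have "\<dots> = - (?z * (C \<i> * (L + L))) * gp_N - x * (?z * (C \<i> * (gp_v * gp_N + gp_A2 * gp_e)))"
    unfolding gp_NKe_x by (simp add: algebra_simps)
  also have "\<dots> = x * (- gp_N - ?z * (C \<i> * (gp_v * gp_N + gp_A2 * gp_e)))"
    unfolding z by (simp add: algebra_simps)
  finally show "?z * (C gp_w * fps_D gp_N) = - gp_N - ?z * (C \<i> * (gp_v * gp_N + gp_A2 * gp_e))"
    unfolding fps_X_cancel .
  have "x * (?z * (C gp_w * fps_D gp_K)) = ?z * (C gp_w * (x * fps_D gp_K))"
    by (simp only: mult_ac)
  also have "\<dots> = (?z * (C \<i> * (L + L))) * gp_K + x * (?z * (C \<i> * (gp_v * gp_K + gp_A2 * gp_e)))"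
    unfolding gp_NKe_x by (simp add: algebra_simps)
  also have "\<dots> = x * (gp_K + ?z * (C \<i> * (gp_v * gp_K + gp_A2 * gp_e)))"
    unfolding z by (simp add: algebra_simps)
  finally show "?z * (C gp_w * fps_D gp_K) = gp_K + ?z * (C \<i> * (gp_v * gp_K + gp_A2 * gp_e))"
    unfolding fps_X_cancel .
  have "gp_e * gp_e - gp_N * gp_K = gp_f * gp_f - 4 * (gp_p * gp_s)"
    unfolding gp_e_def gp_N_def gp_K_def by (simp add: algebra_simps)
  then show "gp_e * gp_e - gp_N * gp_K = 1"
    unfolding gp_psf by simp
qed

lemma dp_const_half2: "dp_const (1 / 2 :: complex) + dp_const (1 / 2) = 1" "dp_const (1 / 2 :: complex) * 2 = 1"
  "2 * dp_const (1 / 2 :: complex) = 1"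
  by (simp_all add: dp_const_simps(3)[symmetric] mult_2_right mult_2 del: dp_const_simps(3))

lemma gp_ps_0: "fps_nth gp_p 0 = - dp_const (1 / 2)" (is ?p) "fps_nth gp_s 0 = dp_const (1 / 2)"
proof -
  show p: ?p
    using arg_cong[OF gp_p_eq, of "\<lambda>f. fps_nth f 0"] by (simp add: gp_a_nth_0 gp_r dp_const_half2)
  show "fps_nth gp_s 0 = dp_const (1 / 2)"
    using dp_const_half2(1) by (simp add: gp_s_def p gp_r algebra_simps)
qed

lemma gp_NKe_0: "fps_nth gp_N 0 = 0" "fps_nth gp_K 0 = 0" "fps_nth gp_e 0 = 1"
proof -
  have "fps_nth gp_f 0 = 0"
    using dp_const_half2(2) by (simp add: gp_f_def gp_ps_0 gp_r mult.commute)
  then show "fps_nth gp_N 0 = 0" "fps_nth gp_K 0 = 0" "fps_nth gp_e 0 = 1"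
    by (simp_all add: gp_N_def gp_K_def gp_e_def gp_ps_0 dp_const_half2)
qed

section \<open>Gradients of the GP Hamiltonians\<close>

lemma gp_sigma_euler:
  "dp_euler W_plus (fps_nth sg n) = - (dp_const kap * fps_nth gp_s n)"
  "dp_euler W_minus (fps_nth sg n) = dp_const kap * fps_nth gp_p n"
  using arg_cong[OF gp_sigma_adj[of W_plus], of "\<lambda>f. fps_nth f n"]
    arg_cong[OF gp_sigma_adj[of W_minus], of "\<lambda>f. fps_nth f n"]
  by (simp_all add: fps_adj_1_nth)

text \<open>The index \<open>n\<close> belongs to the Hamiltonian of index \<open>n - 1\<close>, since these start at \<open>- 1\<close>.\<close>

definition "gp_gam n = kap * \<i> * (- \<i>) ^ n * gp_w ^ n"

text \<open>Multiplication by this series turns gradients of the plain Hamiltonians into those of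
  the modified ones. For odd \<open>n\<close> the Hamiltonian has even index and is
  unchanged.\<close>

definition "gp_om n = (if odd n then 1 else gp_B \<epsilon> (- 1 / 2))"

lemma minus_i_powi: "(- \<i>) powi (int n - 1) = \<i> * (- \<i>) ^ n"
  by (simp add: power_int_diff field_simps)

lemma gp_H_euler:
  assumes "n > 0"
  shows "dp_euler W_plus (gp_H \<epsilon> (int n - 1)) = dp_const (gp_gam n) * fps_nth gp_s n"
    "dp_euler W_minus (gp_H \<epsilon> (int n - 1)) = - (dp_const (gp_gam n) * fps_nth gp_p n)"
proof -
  have H: "gp_H \<epsilon> (int n - 1) = dp_const (- (\<i> * (- \<i>) ^ n * gp_w ^ n)) * fps_nth sg n"
    using assms minus_i_powi[of n]
    by (simp add: gp_H_def gp_w_def power_int_def del: dp_const_simps dp_const_minus dp_const_power)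
       (simp del: dp_const_simps dp_const_power)
  show "dp_euler W_plus (gp_H \<epsilon> (int n - 1)) = dp_const (gp_gam n) * fps_nth gp_s n"
    "dp_euler W_minus (gp_H \<epsilon> (int n - 1)) = - (dp_const (gp_gam n) * fps_nth gp_p n)"
    unfolding H dp_euler_const_mult gp_sigma_euler gp_gam_def
    by (simp_all add: mult_ac)
qed

text \<open>The weight \<open>1 / 2\<close> given to the Hamiltonian of index -1 makes it fit the
  general pattern, as \<open>gp_s\<close> and \<open>gp_p\<close> have constant terms
  \<open>1 / 2\<close> and \<open>- 1 / 2\<close>.\<close>

lemma gp_H_euler_m1:
  "dp_euler W_plus (dp_const (1 / 2) * gp_H \<epsilon> (- 1)) = dp_const (gp_gam 0) * fps_nth gp_s 0"
  "dp_euler W_minus (dp_const (1 / 2) * gp_H \<epsilon> (- 1)) = - (dp_const (gp_gam 0) * fps_nth gp_p 0)"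
proof -
  have "kap * \<i> = - complex_of_real (\<epsilon> / sqrt 2)"
  proof -
    have "kap * \<i> = (\<i> * \<i>) * (complex_of_real \<epsilon> / complex_of_real (sqrt 2))"
      by (simp only: kap_def mult_ac times_divide_eq_left times_divide_eq_right)
    then show ?thesis by simp
  qed
  then have H: "gp_H \<epsilon> (- 1) = dp_const (kap * \<i>) * (Wp + Wm)"
    by (simp add: gp_H_def del: dp_const_simps)
  have v: "dp_euler v (dp_var u 0) = (if u = v then 1 else 0)" for u v :: gp_var
    by (simp add: dp_euler_adj dp_adj_var)
  show "dp_euler W_plus (dp_const (1 / 2) * gp_H \<epsilon> (- 1)) = dp_const (gp_gam 0) * fps_nth gp_s 0"
    "dp_euler W_minus (dp_const (1 / 2) * gp_H \<epsilon> (- 1)) = - (dp_const (gp_gam 0) * fps_nth gp_p 0)"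
    unfolding dp_euler_const_mult H gp_ps_0 gp_gam_def
    by (simp_all add: dp_euler_add v mult.commute)
qed

text \<open>Two steps of the index multiply \<open>gp_gam\<close> by
  \<open>- 2 \<epsilon>^2\<close>, and this times \<open>- 2 / \<epsilon>^2\<close> is 4: the origin
  of the powers of 4 in the modified Hamiltonians.\<close>

lemma gp_gam_rec: "gp_gam (2 * m) * 4 ^ j = gp_gam (2 * (m + j)) * (- 2 / eps2) ^ j"
proof -
  let ?c = "- 2 / eps2"
  have 1: "(- \<i>) ^ (2 * (m + j)) = (- \<i>) ^ (2 * m) * (- 1) ^ j"
    by (simp add: power_add power_mult)
  have 2: "gp_w ^ (2 * (m + j)) = gp_w ^ (2 * m) * (2 * eps2) ^ j"
    by (simp add: power_add power_mult power2_eq_square[of gp_w] gp_w_sq)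
  have "(- 1) * (2 * eps2) * ?c = 4"
    by simp
  then have 3: "(- 1) ^ j * (2 * eps2) ^ j * ?c ^ j = 4 ^ j"
    unfolding power_mult_distrib[symmetric] by (rule arg_cong)
  have "gp_gam (2 * (m + j)) * ?c ^ j = gp_gam (2 * m) * ((- 1) ^ j * (2 * eps2) ^ j * ?c ^ j)"
    unfolding gp_gam_def 1 2 by (simp only: mult_ac)
  then show ?thesis
    unfolding 3 by (rule sym)
qed

lemma sum_even_index:
  fixes f :: "nat \<Rightarrow> 'a::comm_monoid_add"
  assumes "\<And>i. odd i \<Longrightarrow> i \<le> 2 * n \<Longrightarrow> f i = 0"
  shows "(\<Sum>i=0..2*n. f i) = (\<Sum>j\<le>n. f (2 * j))"
  using assms
proof (induction n)
  case (Suc n)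
  have "{0..2 * Suc n} = insert (2 * n + 2) (insert (2 * n + 1) {0..2 * n})" by auto
  then have "(\<Sum>i=0..2 * Suc n. f i) = f (2 * n + 2) + (f (2 * n + 1) + (\<Sum>i=0..2*n. f i))" by simp
  then show ?case using Suc by (simp add: add.commute)
qed simp

text \<open>The binomial sum is a Cauchy product with \<open>gp_B \<epsilon> (- 1 / 2)\<close>,
  whose odd coefficients vanish.\<close>

lemma gpt_H_euler:
  "dp_euler W_plus (gpt_H \<epsilon> (int n - 1)) = dp_const (gp_gam n) * fps_nth (fps_dc (gp_om n) * gp_s) n"
  "dp_euler W_minus (gpt_H \<epsilon> (int n - 1)) = - (dp_const (gp_gam n) * fps_nth (fps_dc (gp_om n) * gp_p) n)"
proof -
  consider (odd) "odd n" | (even) \<nu> where "n = 2 * \<nu>" by (auto elim: evenE)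
  then have "dp_euler W_plus (gpt_H \<epsilon> (int n - 1)) = dp_const (gp_gam n) * fps_nth (fps_dc (gp_om n) * gp_s) n
    \<and> dp_euler W_minus (gpt_H \<epsilon> (int n - 1)) = - (dp_const (gp_gam n) * fps_nth (fps_dc (gp_om n) * gp_p) n)"
  proof cases
    case odd
    then have "n > 0" "even (int n - 1)" by (auto intro: Nat.gr0I)
    then show ?thesis
      using odd by (simp add: gpt_H_def gp_H_euler gp_om_def fps_dc_simps)
  next
    case even
    have H: "gpt_H \<epsilon> (int n - 1) = (\<Sum>m\<le>\<nu>. dp_const (((- 1 / 2) gchoose (\<nu> - m)) * 4 ^ (\<nu> - m)) *
        (dp_const (if m = 0 then 1 / 2 else 1) * gp_H \<epsilon> (int (2 * m) - 1)))"
      unfolding even gpt_H_def by (simp add: Let_def mult.assoc)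
    have co: "dp_const (((- 1 / 2) gchoose (\<nu> - m)) * 4 ^ (\<nu> - m)) * (dp_const (gp_gam (2 * m)) * z) =
        dp_const (gp_gam n) * (fps_nth (fps_dc (gp_om n)) (2 * \<nu> - 2 * m) * z)" if "m \<le> \<nu>" for m
      and z :: "(gp_var, complex) dpoly"
    proof -
      have "gp_gam (2 * m) * 4 ^ (\<nu> - m) = gp_gam n * (- 2 / eps2) ^ (\<nu> - m)"
        using gp_gam_rec[of m "\<nu> - m"] that unfolding even by simp
      then have "((- 1 / 2) gchoose (\<nu> - m)) * 4 ^ (\<nu> - m) * gp_gam (2 * m) =
          gp_gam n * fps_nth (gp_om n) (2 * (\<nu> - m))"
        by (simp add: gp_om_def gp_B_nth even mult_ac)
      moreover have "2 * \<nu> - 2 * m = 2 * (\<nu> - m)" by simp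
      ultimately have "((- 1 / 2) gchoose (\<nu> - m)) * 4 ^ (\<nu> - m) * gp_gam (2 * m) =
          gp_gam n * fps_nth (gp_om n) (2 * \<nu> - 2 * m)" by simp
      then show ?thesis
        unfolding mult.assoc[symmetric] dp_const_simps(4)[symmetric] fps_dc_def fps_nth_Abs_fps by simp
    qed
    have nth: "fps_nth (fps_dc (gp_om n) * S) n =
        (\<Sum>m\<le>\<nu>. fps_nth (fps_dc (gp_om n)) (2 * \<nu> - 2 * m) * fps_nth S (2 * m))" for S :: "(gp_var, complex) dpoly fps"
    proof -
      have "fps_nth (fps_dc (gp_om n) * S) n = (\<Sum>i=0..2*\<nu>. fps_nth S i * fps_nth (fps_dc (gp_om n)) (2 * \<nu> - i))"
        by (subst mult.commute, subst fps_mult_nth) (simp only: even)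
      also have "\<dots> = (\<Sum>m\<le>\<nu>. fps_nth S (2 * m) * fps_nth (fps_dc (gp_om n)) (2 * \<nu> - 2 * m))"
        by (rule sum_even_index) (simp add: fps_dc_def gp_om_def gp_B_nth even)
      finally show ?thesis by (simp only: mult.commute)
    qed
    have e1: "dp_euler W_plus (dp_const (if m = 0 then 1 / 2 else 1) * gp_H \<epsilon> (int (2 * m) - 1)) =
        dp_const (gp_gam (2 * m)) * fps_nth gp_s (2 * m)" for m
      using gp_H_euler_m1 gp_H_euler[of "2 * m"] by (cases "m = 0") auto
    have e2: "dp_euler W_minus (dp_const (if m = 0 then 1 / 2 else 1) * gp_H \<epsilon> (int (2 * m) - 1)) =
        dp_const (gp_gam (2 * m)) * (- fps_nth gp_p (2 * m))" for m
      using gp_H_euler_m1 gp_H_euler[of "2 * m"] by (cases "m = 0") auto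
    show ?thesis
      unfolding H dp_euler_sum dp_euler_const_mult[of _ "(_ gchoose _) * _"] e1 e2 nth
        sum_distrib_left sum_negf[symmetric]
      by (intro conjI sum.cong refl) (simp_all only: co atMost_iff mult_minus_right)
  qed
  then show "dp_euler W_plus (gpt_H \<epsilon> (int n - 1)) = dp_const (gp_gam n) * fps_nth (fps_dc (gp_om n) * gp_s) n"
    "dp_euler W_minus (gpt_H \<epsilon> (int n - 1)) = - (dp_const (gp_gam n) * fps_nth (fps_dc (gp_om n) * gp_p) n)"
    by blast+
qed

text \<open>Index \<open>n\<close> here is \<open>l + 1\<close> and \<open>j\<close> is \<open>j' + 1\<close> for the entry in row \<open>j'\<close> and column \<open>l\<close> of
  the transition matrix.\<close>

lemma gp_zeta_power_nth:
  "fps_nth (gp_om n * gp_zeta ^ j) n =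
     (if j \<le> n \<and> even j = even n then
        (1 / gp_w) ^ j * ((- (of_nat (j div 2)) - 1 / 2) gchoose (n div 2 - j div 2)) *
          (- 2 / eps2) ^ (n div 2 - j div 2)
      else 0)"
proof -
  have z: "gp_zeta ^ j = fps_const ((1 / gp_w) ^ j) * (fps_X ^ j * gp_B \<epsilon> (- of_nat j / 2))"
    by (simp add: gp_zeta_def power_mult_distrib gp_B_power fps_const_power)
  \<comment> \<open>The exponents \<open>- j / 2\<close> of the power and \<open>- 1 / 2\<close> of
    \<open>gp_om\<close> give \<open>- (j div 2) - 1 / 2\<close> for either common parity of
    \<open>j\<close> and \<open>n\<close>.\<close>
  define c where "c = (if odd n then - of_nat j / 2 else - 1 / 2 - of_nat j / 2 :: complex)"
  have "gp_om n * gp_zeta ^ j = fps_const ((1 / gp_w) ^ j) * (fps_X ^ j * gp_B \<epsilon> c)"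
    unfolding z by (auto simp: gp_om_def c_def gp_B_add[symmetric] mult_ac)
  then have *: "fps_nth (gp_om n * gp_zeta ^ j) n = (1 / gp_w) ^ j * (if n < j then 0 else fps_nth (gp_B \<epsilon> c) (n - j))"
    by (simp add: fps_X_power_mult_nth)
  show ?thesis
  proof (cases "j \<le> n \<and> even j = even n")
    case True
    then have 1: "(n - j) div 2 = n div 2 - j div 2" "even (n - j)"
      by (auto elim!: evenE oddE)
    have 2: "c = - of_nat (j div 2) - 1 / 2"
    proof (cases "odd n")
      case odd: True
      then obtain i where "j = 2 * i + 1" using True by (auto elim: oddE)
      then show ?thesis using odd by (simp add: c_def field_simps)
    next
      case False
      then obtain i where "j = 2 * i" using True by (auto elim: evenE)
      then show ?thesis using False by (simp add: c_def field_simps)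
    qed
    show ?thesis unfolding * using True 1 by (simp add: gp_B_nth 2)
  next
    case False
    then show ?thesis unfolding * by (auto simp: gp_B_nth)
  qed
qed

end

lemma nls_e_D: "fps_D nls_e = 2 * (nq * nls_k) - 2 * (nqbar * nls_n)"
proof -
  have g: "fps_X * fps_D nls_g = nls_g - nq * (fps_X * (nls_g * nls_g)) + fps_X * nqbar"
    using nls_g_eq by (simp add: algebra_simps)
  have e: "nls_e = 1 - (nls_n * nls_g + nls_n * nls_g)"
    unfolding nls_e_def mult_2 by (rule refl)
  have "fps_X * fps_D nls_e = fps_X * fps_D (1 - (nls_n * nls_g + nls_n * nls_g))"
    by (subst e) (rule refl)
  also have "\<dots> = - ((fps_X * fps_D nls_n) * nls_g + nls_n * (fps_X * fps_D nls_g)) -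
      ((fps_X * fps_D nls_n) * nls_g + nls_n * (fps_X * fps_D nls_g))"
    unfolding fps_D_simps(1,2,6) fps_D_mult by (simp add: algebra_simps)
  also have "\<dots> = fps_X * (2 * (nq * nls_k) - 2 * (nqbar * nls_n))"
    unfolding g nls_resolvent(1) nls_k_def nls_e_def by (simp add: algebra_simps)
  finally show ?thesis unfolding fps_X_cancel .
qed

lemma dp_eval_power [simp]: "dp_eval (p ^ n) w x = dp_eval p w x ^ n"
  by (induction n) auto

lemma dp_eval_numeral [simp]: "dp_eval (numeral n) w x = numeral n"
  using dp_eval_simps(1)[of "numeral n" w x] by simp

section \<open>Resolvents of functions\<close>

definition fps_ev :: "('v \<Rightarrow> real \<Rightarrow> complex) \<Rightarrow> real \<Rightarrow> ('v, complex) dpoly fps \<Rightarrow> complex fps" where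
  "fps_ev w y S = Abs_fps (\<lambda>n. dp_eval (fps_nth S n) w y)"

lemma fps_ev_nth [simp]: "fps_nth (fps_ev w y S) n = dp_eval (fps_nth S n) w y"
  by (simp add: fps_ev_def)

lemma fps_ev_simps [simp]:
  "fps_ev w y (S + S') = fps_ev w y S + fps_ev w y S'"
  "fps_ev w y (S - S') = fps_ev w y S - fps_ev w y S'"
  "fps_ev w y (- S) = - fps_ev w y S"
  "fps_ev w y (S * S') = fps_ev w y S * fps_ev w y S'"
  "fps_ev w y 0 = 0" "fps_ev w y 1 = 1"
  "fps_ev w y (fps_dc c) = c" "fps_ev w y fps_X = fps_X"
  "fps_ev w y (fps_const p) = fps_const (dp_eval p w y)"
  by (simp_all add: fps_eq_iff fps_mult_nth dp_eval_sum fps_dc_def)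

lemma fps_ev_numeral [simp]: "fps_ev w y (numeral n) = numeral n"
proof -
  have "(numeral n :: ('a, complex) dpoly fps) = fps_dc (numeral n)"
    by (simp add: numeral_fps_const fps_dc_simps(8))
  then show ?thesis by (metis fps_ev_simps(7))
qed

abbreviation "nls_ev u \<equiv> fps_ev (nls_field u)"

definition fps_has_deriv :: "(real \<Rightarrow> complex fps) \<Rightarrow> complex fps \<Rightarrow> real \<Rightarrow> bool" where
  "fps_has_deriv F F' y \<longleftrightarrow> (\<forall>n. ((\<lambda>z. fps_nth (F z) n) has_vector_derivative fps_nth F' n) (at y))"

lemma fps_has_deriv_ev:
  assumes "\<And>v. smooth (w v)"
  shows "fps_has_deriv (\<lambda>y. fps_ev w (c * y) S) (fps_const (complex_of_real c) * fps_ev w (c * y) (fps_D S)) y"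
  unfolding fps_has_deriv_def
proof
  fix n
  let ?f = "dp_eval (fps_nth S n) w"
  have "((\<lambda>y. c * y) has_vector_derivative c) (at y)"
    by (auto intro!: derivative_eq_intros)
  then have "((\<lambda>y. ?f (c * y)) has_vector_derivative complex_of_real c * dp_eval (dp_D (fps_nth S n)) w (c * y)) (at y)"
    using vector_diff_chain_at[of "\<lambda>y. c * y" c y ?f] dp_eval_has_deriv[of w "fps_nth S n" "c * y", OF assms]
    by (simp add: o_def scaleR_conv_of_real)
  then show "((\<lambda>z. fps_nth (fps_ev w (c * z) S) n) has_vector_derivative
      fps_nth (fps_const (complex_of_real c) * fps_ev w (c * y) (fps_D S)) n) (at y)"
    by (simp add: fps_D_def)
qed

lemma fps_has_deriv_ev1:
  "(\<And>v. smooth (w v)) \<Longrightarrow> fps_has_deriv (\<lambda>y. fps_ev w y S) (fps_ev w y (fps_D S)) y"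
  using fps_has_deriv_ev[of w 1 S y] by simp

lemma fps_has_deriv_scale:
  assumes "(f has_vector_derivative f') (at y)" "fps_has_deriv F F' y"
  shows "fps_has_deriv (\<lambda>y. fps_const (f y) * F y) (fps_const f' * F y + fps_const (f y) * F') y"
  unfolding fps_has_deriv_def
proof
  fix n
  show "((\<lambda>z. fps_nth (fps_const (f z) * F z) n) has_vector_derivative
      fps_nth (fps_const f' * F y + fps_const (f y) * F') n) (at y)"
    using has_vector_derivative_mult[OF assms(1), of "\<lambda>z. fps_nth (F z) n" "fps_nth F' n"] assms(2)
    by (simp add: fps_has_deriv_def add.commute)
qed

lemma fps_has_deriv_compose:
  assumes "fps_has_deriv F F' y"
  shows "fps_has_deriv (\<lambda>y. F y oo \<zeta>) (F' oo \<zeta>) y"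
  unfolding fps_has_deriv_def fps_compose_nth
proof (intro allI has_vector_derivative_sum)
  fix n i
  show "((\<lambda>z. fps_nth (F z) i * fps_nth (\<zeta> ^ i) n) has_vector_derivative fps_nth F' i * fps_nth (\<zeta> ^ i) n) (at y)"
    using assms has_vector_derivative_mult_left unfolding fps_has_deriv_def by blast
qed

lemma fps_agree_times_zeta:
  fixes f g \<zeta> :: "'a::comm_ring_1 fps"
  assumes "fps_nth \<zeta> 0 = 0" "fps_agree n f g"
  shows "fps_agree (Suc n) (\<zeta> * f) (\<zeta> * g)"
proof -
  have "\<zeta> = fps_X * fps_shift 1 \<zeta>"
    using assms(1) by (intro fps_ext) (simp add: gr0_conv_Suc split: nat.splits)
  then obtain \<zeta>' where "\<zeta> = fps_X * \<zeta>'" by blast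
  then show ?thesis
    using assms(2) by (simp add: mult.assoc fps_agree_X fps_agree_mult)
qed

lemma fps_mult_nth_low:
  fixes d h :: "'a::comm_ring_1 fps"
  assumes "\<And>k. k < m \<Longrightarrow> fps_nth d k = 0"
  shows "fps_nth (d * h) m = fps_nth d m * fps_nth h 0"
proof -
  have "fps_nth (d * h) m = (\<Sum>i=0..m. if i = m then fps_nth d m * fps_nth h 0 else 0)"
    unfolding fps_mult_nth by (intro sum.cong) (use assms in auto)
  then show ?thesis by simp
qed

section \<open>Uniqueness of resolvents\<close>

text \<open>The linear system with spectral parameter 1 / \<zeta>, multiplied by \<zeta> to avoid
  poles. The constraint and the constant term of \<open>e\<close> take the place of a differential
  equation for \<open>e\<close>.\<close>

locale resolvent =
  fixes \<zeta> :: "complex fps" and q qb :: "real \<Rightarrow> complex" and n k e n' k' :: "real \<Rightarrow> complex fps"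
  assumes zeta: "fps_nth \<zeta> 0 = 0"
    and dn: "fps_has_deriv n (n' y) y" and dk: "fps_has_deriv k (k' y) y"
    and n: "\<zeta> * n' y = - n y - \<zeta> * (fps_const (q y) * e y)"
    and k: "\<zeta> * k' y = k y + \<zeta> * (fps_const (qb y) * e y)"
    and e: "e y * e y + 4 * n y * k y = 1"
    and e0: "fps_nth (e y) 0 = 1"

text \<open>As \<zeta> has no constant term, the differential equations give coefficient
  \<open>m\<close> of \<open>n\<close> and \<open>k\<close> from lower ones. The induction treats
  all points at once because derivatives enter.\<close>

lemma resolvent_unique:
  assumes 1: "resolvent \<zeta> q qb n k e n' k'" and 2: "resolvent \<zeta> q qb n2 k2 e2 n2' k2'"
  shows "n = n2 \<and> k = k2 \<and> e = e2"
proof -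
  interpret r1: resolvent \<zeta> q qb n k e n' k' by fact
  interpret r2: resolvent \<zeta> q qb n2 k2 e2 n2' k2' by fact
  have "\<forall>y. fps_agree m (n y) (n2 y) \<and> fps_agree m (k y) (k2 y) \<and> fps_agree m (e y) (e2 y)" for m
  proof (induction m)
    case (Suc m)
    have deriv: "fps_agree m (f' y) (g' y)"
      if "\<And>y. fps_agree m (f y) (g y)" "\<And>y. fps_has_deriv f (f' y) y" "\<And>y. fps_has_deriv g (g' y) y"
      for f g f' g' and y
      unfolding fps_agree_def
    proof (intro allI impI)
      fix i
      assume "i < m"
      then have "(\<lambda>z. fps_nth (f z) i) = (\<lambda>z. fps_nth (g z) i)"
        using that(1) by (auto simp: fps_agree_def)
      then show "fps_nth (f' y) i = fps_nth (g' y) i"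
        using that(2,3) unfolding fps_has_deriv_def by (metis vector_derivative_at)
    qed
    show ?case
    proof
      fix y
      have e: "fps_agree (Suc m) (\<zeta> * (fps_const c * e y)) (\<zeta> * (fps_const c * e2 y))" for c
        using Suc r1.zeta by (intro fps_agree_times_zeta fps_agree_mult) auto
      have "n y = - (\<zeta> * n' y) - \<zeta> * (fps_const (q y) * e y)"
        "n2 y = - (\<zeta> * n2' y) - \<zeta> * (fps_const (q y) * e2 y)"
        using r1.n[of y] r2.n[of y] by simp_all
      moreover have "fps_agree (Suc m) (\<zeta> * n' y) (\<zeta> * n2' y)"
        by (rule fps_agree_times_zeta[OF r1.zeta deriv[of n n2]]) (use Suc r1.dn r2.dn in auto)
      ultimately have n: "fps_agree (Suc m) (n y) (n2 y)"
        using e by (metis fps_agree_diff fps_agree_minus)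
      have "k y = \<zeta> * k' y - \<zeta> * (fps_const (qb y) * e y)"
        "k2 y = \<zeta> * k2' y - \<zeta> * (fps_const (qb y) * e2 y)"
        using r1.k[of y] r2.k[of y] by simp_all
      moreover have "fps_agree (Suc m) (\<zeta> * k' y) (\<zeta> * k2' y)"
        by (rule fps_agree_times_zeta[OF r1.zeta deriv[of k k2]]) (use Suc r1.dk r2.dk in auto)
      ultimately have k: "fps_agree (Suc m) (k y) (k2 y)"
        using e by (metis fps_agree_diff)
      have "fps_agree (Suc m) (4 * (n2 y * k2 y)) (4 * (n y * k y))"
        using n k by (intro fps_agree_mult) (auto simp: fps_agree_def)
      \<comment> \<open>The constraint yields coefficient \<open>m\<close> of \<open>e\<close>: the
        lower coefficients of \<open>e y - e2 y\<close> vanish, and \<open>e y + e2 y\<close> has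
        constant term 2.\<close>
      moreover have "(e y - e2 y) * (e y + e2 y) = 4 * (n2 y * k2 y) - 4 * (n y * k y)"
        using r1.e[of y] r2.e[of y] by (simp add: algebra_simps)
      ultimately have "fps_nth ((e y - e2 y) * (e y + e2 y)) m = 0"
        by (simp add: fps_agree_def)
      moreover have "fps_nth ((e y - e2 y) * (e y + e2 y)) m = fps_nth (e y - e2 y) m * fps_nth (e y + e2 y) 0"
        using Suc by (intro fps_mult_nth_low) (auto simp: fps_agree_def)
      ultimately have "fps_nth (e y) m = fps_nth (e2 y) m"
        by (simp add: r1.e0 r2.e0)
      then have "fps_agree (Suc m) (e y) (e2 y)"
        using Suc by (auto simp: fps_agree_def less_Suc_eq)
      with n k show "fps_agree (Suc m) (n y) (n2 y) \<and> fps_agree (Suc m) (k y) (k2 y) \<and> fps_agree (Suc m) (e y) (e2 y)"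
        by blast
    qed
  qed simp
  then show ?thesis by (blast intro: fps_agree_all)
qed

lemma smooth_nls_field: "smooth u \<Longrightarrow> smooth (nls_field u v)"
  by (cases v) (auto simp: nls_field_def [abs_def] intro: smooth_cnj)

lemma nls_resolvent_ev:
  assumes "smooth u"
  shows "resolvent fps_X u (\<lambda>y. cnj (u y)) (\<lambda>y. nls_ev u y nls_n) (\<lambda>y. nls_ev u y nls_k)
    (\<lambda>y. nls_ev u y nls_e) (\<lambda>y. nls_ev u y (fps_D nls_n))
    (\<lambda>y. nls_ev u y (fps_D nls_k))"
proof
  fix y
  let ?ev = "nls_ev u y"
  show "fps_has_deriv (\<lambda>y. nls_ev u y nls_n) (?ev (fps_D nls_n)) y"
    "fps_has_deriv (\<lambda>y. nls_ev u y nls_k) (?ev (fps_D nls_k)) y"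
    using assms by (auto intro: fps_has_deriv_ev1 smooth_nls_field)
  show "fps_X * ?ev (fps_D nls_n) = - ?ev nls_n - fps_X * (fps_const (u y) * ?ev nls_e)"
    using arg_cong[OF nls_resolvent(1), of ?ev] by (simp add: nls_field_def mult.assoc)
  show "fps_X * ?ev (fps_D nls_k) = ?ev nls_k + fps_X * (fps_const (cnj (u y)) * ?ev nls_e)"
    using arg_cong[OF nls_resolvent(2), of ?ev] by (simp add: nls_field_def mult.assoc)
  show "?ev nls_e * ?ev nls_e + 4 * ?ev nls_n * ?ev nls_k = 1"
    using arg_cong[OF nls_resolvent(3), of ?ev] by simp
  show "fps_nth (?ev nls_e) 0 = 1"
    by (simp add: nls_resolvent)
qed simp

text \<open>Composition with a series without constant term is a ring homomorphism that commutes
  with differentiation in \<open>y\<close>, so the system persists.\<close>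

lemma nls_resolvent_compose:
  assumes "smooth u" "fps_nth \<zeta> 0 = 0"
  shows "resolvent \<zeta> u (\<lambda>y. cnj (u y)) (\<lambda>y. nls_ev u y nls_n oo \<zeta>)
    (\<lambda>y. nls_ev u y nls_k oo \<zeta>) (\<lambda>y. nls_ev u y nls_e oo \<zeta>)
    (\<lambda>y. nls_ev u y (fps_D nls_n) oo \<zeta>) (\<lambda>y. nls_ev u y (fps_D nls_k) oo \<zeta>)"
proof -
  interpret r: resolvent fps_X u "\<lambda>y. cnj (u y)" "\<lambda>y. nls_ev u y nls_n"
    "\<lambda>y. nls_ev u y nls_k" "\<lambda>y. nls_ev u y nls_e"
    "\<lambda>y. nls_ev u y (fps_D nls_n)" "\<lambda>y. nls_ev u y (fps_D nls_k)"
    by (rule nls_resolvent_ev[OF assms(1)])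
  note hom = fps_compose_mult_distrib[OF assms(2)] fps_compose_add_distrib fps_compose_sub_distrib
    fps_compose_uminus fps_const_compose
  have X: "fps_X oo \<zeta> = \<zeta>" using assms(2) by simp
  have four: "(4 :: complex fps) oo \<zeta> = 4"
    using fps_const_compose[of 4 \<zeta>] by (simp add: numeral_fps_const)
  show ?thesis
  proof
    fix y
    show "\<zeta> * (nls_ev u y (fps_D nls_n) oo \<zeta>) = - (nls_ev u y nls_n oo \<zeta>) -
        \<zeta> * (fps_const (u y) * (nls_ev u y nls_e oo \<zeta>))"
      using arg_cong[OF r.n[of y], of "\<lambda>f. f oo \<zeta>"] unfolding hom X .
    show "\<zeta> * (nls_ev u y (fps_D nls_k) oo \<zeta>) = (nls_ev u y nls_k oo \<zeta>) +
        \<zeta> * (fps_const (cnj (u y)) * (nls_ev u y nls_e oo \<zeta>))"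
      using arg_cong[OF r.k[of y], of "\<lambda>f. f oo \<zeta>"] unfolding hom X .
    show "(nls_ev u y nls_e oo \<zeta>) * (nls_ev u y nls_e oo \<zeta>) +
        4 * (nls_ev u y nls_n oo \<zeta>) * (nls_ev u y nls_k oo \<zeta>) = 1"
      using arg_cong[OF r.e[of y], of "\<lambda>f. f oo \<zeta>"] unfolding hom four fps_compose_1 .
  qed (use assms(2) r.dn r.dk r.e0 fps_has_deriv_compose in auto)
qed

section \<open>The conjugation symmetry of the NLS resolvent\<close>

text \<open>Conjugation combined with \<open>X \<mapsto> - X\<close>; the sign change is what
  exchanges the two linear equations.\<close>

definition fps_tw :: "complex fps \<Rightarrow> complex fps" where
  "fps_tw F = Abs_fps (\<lambda>n. (- 1) ^ n * cnj (fps_nth F n))"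

lemma fps_tw_simps [simp]:
  "fps_tw (F + G) = fps_tw F + fps_tw G" "fps_tw (F - G) = fps_tw F - fps_tw G"
  "fps_tw (- F) = - fps_tw F" "fps_tw (F * G) = fps_tw F * fps_tw G"
  "fps_tw 1 = 1" "fps_tw fps_X = - fps_X" "fps_tw (fps_const c) = fps_const (cnj c)"
proof -
  show "fps_tw (F * G) = fps_tw F * fps_tw G"
  proof (rule fps_ext)
    fix n
    have "(- 1) ^ n * (cnj (fps_nth F i) * cnj (fps_nth G (n - i))) =
        (- 1) ^ i * cnj (fps_nth F i) * ((- 1) ^ (n - i) * cnj (fps_nth G (n - i)))" if "i \<le> n" for i
      using that by (simp flip: power_add add: mult_ac)
    then show "fps_nth (fps_tw (F * G)) n = fps_nth (fps_tw F * fps_tw G) n"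
      unfolding fps_tw_def fps_nth_Abs_fps fps_mult_nth cnj_sum sum_distrib_left complex_cnj_mult
      by (intro sum.cong refl) simp
  qed
qed (auto simp: fps_tw_def fps_eq_iff algebra_simps)

lemma fps_has_deriv_tw:
  "fps_has_deriv F F' y \<Longrightarrow> fps_has_deriv (\<lambda>y. fps_tw (F y)) (fps_tw F') y"
  unfolding fps_has_deriv_def fps_tw_def fps_nth_Abs_fps
  by (intro allI has_vector_derivative_mult_right has_vector_derivative_cnj) auto

lemma fps_has_deriv_minus:
  "fps_has_deriv F F' y \<Longrightarrow> fps_has_deriv (\<lambda>y. - F y) (- F') y"
  unfolding fps_has_deriv_def by (auto intro: has_vector_derivative_minus)

text \<open>The twisted triple, with \<open>n\<close> and \<open>k\<close> exchanged up to sign, is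
  again a resolvent for the same \<open>u\<close>, hence the original one.\<close>

lemma nls_resolvent_cnj:
  assumes "smooth u"
  shows "cnj (dp_eval (fps_nth nls_n (Suc j)) (nls_field u) y) =
      (- 1) ^ j * dp_eval (fps_nth nls_k (Suc j)) (nls_field u) y"
proof -
  interpret r: resolvent fps_X u "\<lambda>y. cnj (u y)" "\<lambda>y. nls_ev u y nls_n"
    "\<lambda>y. nls_ev u y nls_k" "\<lambda>y. nls_ev u y nls_e"
    "\<lambda>y. nls_ev u y (fps_D nls_n)" "\<lambda>y. nls_ev u y (fps_D nls_k)"
    by (rule nls_resolvent_ev[OF assms(1)])
  have four: "fps_tw 4 = 4"
    using fps_tw_simps(7)[of 4] by (simp add: numeral_fps_const del: fps_tw_simps)
  have "resolvent fps_X u (\<lambda>y. cnj (u y)) (\<lambda>y. - fps_tw (nls_ev u y nls_k))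
      (\<lambda>y. - fps_tw (nls_ev u y nls_n)) (\<lambda>y. fps_tw (nls_ev u y nls_e))
      (\<lambda>y. - fps_tw (nls_ev u y (fps_D nls_k))) (\<lambda>y. - fps_tw (nls_ev u y (fps_D nls_n)))"
  proof
    fix y
    let ?t = "\<lambda>S. fps_tw (nls_ev u y S)"
    show "fps_X * - ?t (fps_D nls_k) = - (- ?t nls_k) - fps_X * (fps_const (u y) * ?t nls_e)"
      using arg_cong[OF r.k[of y], of fps_tw] unfolding fps_tw_simps by simp
    show "fps_X * - ?t (fps_D nls_n) = - ?t nls_n + fps_X * (fps_const (cnj (u y)) * ?t nls_e)"
      using arg_cong[OF r.n[of y], of fps_tw] unfolding fps_tw_simps by simp
    show "?t nls_e * ?t nls_e + 4 * - ?t nls_k * - ?t nls_n = 1"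
      using arg_cong[OF r.e[of y], of fps_tw] unfolding fps_tw_simps four by (simp add: mult_ac)
    show "fps_nth (?t nls_e) 0 = 1"
      using r.e0[of y] by (simp add: fps_tw_def)
  qed (simp_all add: fps_has_deriv_minus fps_has_deriv_tw r.dn r.dk)
  from resolvent_unique[OF this nls_resolvent_ev[OF assms]]
  have "- fps_tw (nls_ev u y nls_n) = nls_ev u y nls_k"
    by meson
  from arg_cong[OF this, of "\<lambda>f. fps_nth f (Suc j)"]
  have "dp_eval (fps_nth nls_k (Suc j)) (nls_field u) y = (- 1) ^ j * cnj (dp_eval (fps_nth nls_n (Suc j)) (nls_field u) y)"
    by (simp add: fps_tw_def)
  then show ?thesis
    by (simp flip: mult.assoc power_mult_distrib)
qed

section \<open>Identification of the two resolvents\<close>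

context gp
begin

text \<open>\<open>u = a h\<close> is the polar decomposition of the NLS field in terms of \<open>W\<^sub>+, W\<^sub>-\<close>; the gauge
  factor \<open>h\<close> turns the resolvent of GP into that of NLS, so that uniqueness identifies them.\<close>

lemma gp_nls_link:
  fixes u h a :: "real \<Rightarrow> complex" and wf :: "gp_var \<Rightarrow> real \<Rightarrow> complex"
  assumes u: "smooth u" and wf: "\<And>v. smooth (wf v)"
    and uah: "\<And>y. u y = a y * h y"
    and a: "\<And>y. a y = 1 + eps2 / 2 * (wf W_plus (sw * y) - wf W_minus (sw * y))"
    and cnj_a: "\<And>y. cnj (a y) = a y" and hh: "\<And>y. cnj (h y) * h y = 1"
    and h: "\<And>y. (h has_vector_derivative
      \<i> * eps2 * (wf W_plus (sw * y) + wf W_minus (sw * y)) * h y) (at y)"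
  shows "nls_ev u y nls_n oo gp_zeta = fps_const (h y * (- \<i> / 2)) * fps_ev wf (sw * y) gp_N"
    "nls_ev u y nls_k oo gp_zeta = fps_const (cnj (h y) * (- \<i> / 2)) * fps_ev wf (sw * y) gp_K"
    "nls_ev u y nls_e oo gp_zeta = fps_ev wf (sw * y) gp_e"
proof -
  define v where "v y = eps2 * (wf W_plus (sw * y) + wf W_minus (sw * y))" for y
  have v: "fps_ev wf (sw * y) gp_v = fps_const (v y)" for y
    unfolding gp_v_def by (simp add: v_def)
  have A2: "fps_ev wf (sw * y) gp_A2 = fps_const (2 * a y)" for y
    unfolding gp_A2_def by (simp add: a numeral_fps_const field_simps)
  let ?ev = "\<lambda>y. fps_ev wf (sw * y)"
  \<comment> \<open>The modulus of \<open>h\<close> is constant, so its logarithmic derivative is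
    imaginary and \<open>v\<close> is real.\<close>
  have wf_real: "cnj (v y) = v y" for y
  proof -
    have "((\<lambda>y. cnj (h y) * h y) has_vector_derivative cnj (h y) * (\<i> * v y * h y) + cnj (\<i> * v y * h y) * h y) (at y)"
      using h[of y] by (intro has_vector_derivative_mult has_vector_derivative_cnj) (simp_all add: v_def mult.assoc)
    moreover have "((\<lambda>y. cnj (h y) * h y) has_vector_derivative 0) (at y)"
      unfolding hh by simp
    ultimately have "cnj (h y) * (\<i> * v y * h y) + cnj (\<i> * v y * h y) * h y = 0"
      by (rule vector_derivative_unique_at)
    then have "(cnj (h y) * h y) * (\<i> * (v y - cnj (v y))) = 0"
      by (simp add: algebra_simps)
    then show ?thesis unfolding hh by simp
  qed
  have hc: "((\<lambda>y. cnj (h y)) has_vector_derivative - (\<i> * v y * cnj (h y))) (at y)" for y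
    using has_vector_derivative_cnj[OF h[of y]] wf_real[of y]
    by (simp add: v_def mult.assoc)
  have N: "gp_zeta * (fps_const gp_w * ?ev y (fps_D gp_N)) = - ?ev y gp_N
      - gp_zeta * (fps_const \<i> * (fps_const (v y) * ?ev y gp_N + fps_const (2 * a y) * ?ev y gp_e))" for y
    using arg_cong[OF gp_NKe(1), of "?ev y"] unfolding fps_ev_simps v A2 by simp
  have K: "gp_zeta * (fps_const gp_w * ?ev y (fps_D gp_K)) = ?ev y gp_K
      + gp_zeta * (fps_const \<i> * (fps_const (v y) * ?ev y gp_K + fps_const (2 * a y) * ?ev y gp_e))" for y
    using arg_cong[OF gp_NKe(2), of "?ev y"] unfolding fps_ev_simps v A2 by simp
  \<comment> \<open>The factor \<open>- \<i> / 2\<close> turns the coupling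
    \<open>\<i> * 2 * a\<close> into \<open>a\<close> and \<open>4 n k\<close> into minus the
    product of \<open>gp_N\<close> and \<open>gp_K\<close>; the derivative of \<open>h\<close>
    absorbs the terms with \<open>v\<close>.\<close>
  let ?n = "\<lambda>y. fps_const (h y * (- \<i> / 2)) * ?ev y gp_N"
  let ?k = "\<lambda>y. fps_const (cnj (h y) * (- \<i> / 2)) * ?ev y gp_K"
  let ?n' = "\<lambda>y. fps_const (\<i> * v y * h y * (- \<i> / 2)) * ?ev y gp_N +
      fps_const (h y * (- \<i> / 2)) * (fps_const gp_w * ?ev y (fps_D gp_N))"
  let ?k' = "\<lambda>y. fps_const (- (\<i> * v y * cnj (h y)) * (- \<i> / 2)) * ?ev y gp_K +
      fps_const (cnj (h y) * (- \<i> / 2)) * (fps_const gp_w * ?ev y (fps_D gp_K))"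
  have "resolvent gp_zeta u (\<lambda>y. cnj (u y)) ?n ?k (\<lambda>y. ?ev y gp_e) ?n' ?k'"
  proof
    fix y
    show "fps_nth gp_zeta 0 = 0" by (rule gp_zeta_0)
    have hd: "(h has_vector_derivative \<i> * v y * h y) (at y)"
      using h[of y] by (simp add: v_def mult.assoc)
    show "fps_has_deriv ?n (?n' y) y"
      unfolding gp_w_def
      by (intro fps_has_deriv_scale fps_has_deriv_ev wf has_vector_derivative_mult_left hd)
    show "fps_has_deriv ?k (?k' y) y"
      unfolding gp_w_def
      by (intro fps_has_deriv_scale fps_has_deriv_ev wf has_vector_derivative_mult_left hc)
    have "gp_zeta * ?n' y = fps_const (h y * (- \<i> / 2)) * (gp_zeta * (fps_const \<i> * (fps_const (v y) * ?ev y gp_N))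
        + gp_zeta * (fps_const gp_w * ?ev y (fps_D gp_N)))"
      by (simp add: algebra_simps flip: fps_const_mult)
    also have "\<dots> = - ?n y - (fps_const (- \<i> / 2) * fps_const \<i> * fps_const 2) * (gp_zeta * (fps_const (h y) * fps_const (a y) * ?ev y gp_e))"
      unfolding N by (simp add: algebra_simps flip: fps_const_mult)
    also have "\<dots> = - ?n y - gp_zeta * (fps_const (u y) * ?ev y gp_e)"
      by (simp add: uah mult.commute)
    finally show "gp_zeta * ?n' y = - ?n y - gp_zeta * (fps_const (u y) * ?ev y gp_e)" .
    have "gp_zeta * ?k' y = fps_const (cnj (h y) * (- \<i> / 2)) * (gp_zeta * (fps_const gp_w * ?ev y (fps_D gp_K))
        - gp_zeta * (fps_const \<i> * (fps_const (v y) * ?ev y gp_K)))"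
    proof -
      have "fps_const (- (\<i> * v y * cnj (h y)) * (- \<i> / 2)) =
          - (fps_const (cnj (h y) * (- \<i> / 2)) * (fps_const \<i> * fps_const (v y)))"
        by (simp add: mult_ac)
      then show ?thesis
        by (simp only: distrib_left right_diff_distrib mult_minus_left mult_minus_right mult_ac) simp
    qed
    also have "\<dots> = ?k y + (fps_const (- \<i> / 2) * fps_const \<i> * fps_const 2) * (gp_zeta * (fps_const (cnj (h y)) * fps_const (a y) * ?ev y gp_e))"
      unfolding K by (simp add: algebra_simps flip: fps_const_mult)
    also have "\<dots> = ?k y + gp_zeta * (fps_const (cnj (u y)) * ?ev y gp_e)"
      by (simp add: uah cnj_a mult.commute)
    finally show "gp_zeta * ?k' y = ?k y + gp_zeta * (fps_const (cnj (u y)) * ?ev y gp_e)" .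
    have "4 * ?n y * ?k y = (4 * fps_const ((cnj (h y) * h y) * ((- \<i> / 2) * (- \<i> / 2)))) * (?ev y gp_N * ?ev y gp_K)"
      by (simp only: mult_ac fps_const_mult[symmetric])
    also have "\<dots> = - (?ev y gp_N * ?ev y gp_K)"
      unfolding hh by (simp add: numeral_fps_const fps_eq_iff)
    finally show "?ev y gp_e * ?ev y gp_e + 4 * ?n y * ?k y = 1"
      using arg_cong[OF gp_NKe(3), of "?ev y"] by simp
    show "fps_nth (?ev y gp_e) 0 = 1"
      by (simp add: gp_NKe_0)
  qed
  from resolvent_unique[OF nls_resolvent_compose[OF u gp_zeta_0] this]
  show "nls_ev u y nls_n oo gp_zeta = fps_const (h y * (- \<i> / 2)) * fps_ev wf (sw * y) gp_N"
    "nls_ev u y nls_k oo gp_zeta = fps_const (cnj (h y) * (- \<i> / 2)) * fps_ev wf (sw * y) gp_K"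
    "nls_ev u y nls_e oo gp_zeta = fps_ev wf (sw * y) gp_e"
    by metis+
qed

end

section \<open>The GP flow in terms of the NLS field\<close>

text \<open>For \<open>S = nls_n\<close>, and up to a factor \<open>\<i>\<close>, this is the
  derivative of the NLS field when the unscaled times move in the direction
  \<open>d\<close>.\<close>

definition nls_sum :: "nat \<Rightarrow> (nat \<Rightarrow> real) \<Rightarrow> (nls_var, complex) dpoly fps \<Rightarrow> (real \<Rightarrow> complex) \<Rightarrow> real \<Rightarrow> complex"
  where "nls_sum N d S u y =
    (\<Sum>j\<le>N. complex_of_real (d j) * (- \<i>) ^ j * dp_eval (fps_nth S (Suc j)) (nls_field u) y)"

text \<open>With \<open>z\<close> the time derivative of the field divided by the field,
  \<open>nls_Q\<close> is \<open>2 Im z\<close> and \<open>nls_S\<close> is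
  \<open>2 |u| Re z\<close>, by the conjugation symmetry. The form in \<open>nls_n\<close> and
  \<open>nls_k\<close> is the one that the GP gradients yield.\<close>

definition "nls_Q N d u y = nls_sum N d nls_n u y / u y + nls_sum N d nls_k u y / cnj (u y)"

definition "nls_S N d u y = \<i> * complex_of_real (cmod (u y)) *
  (nls_sum N d nls_n u y / u y - nls_sum N d nls_k u y / cnj (u y))"

text \<open>The velocity of \<open>(W\<^sub>+, W\<^sub>-)\<close> when the NLS times move in the direction \<open>d\<close>.\<close>

definition nls_flow :: "real \<Rightarrow> nat \<Rightarrow> (nat \<Rightarrow> real) \<Rightarrow> (real \<Rightarrow> complex) \<Rightarrow> real \<Rightarrow> complex \<times> complex" where
  "nls_flow \<epsilon> N d u y =
    (xderiv (nls_Q N d u) y / (4 * (complex_of_real \<epsilon>)\<^sup>2) + nls_S N d u y / (2 * (complex_of_real \<epsilon>)\<^sup>2),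
     xderiv (nls_Q N d u) y / (4 * (complex_of_real \<epsilon>)\<^sup>2) - nls_S N d u y / (2 * (complex_of_real \<epsilon>)\<^sup>2))"

lemma nls_sum_has_deriv:
  assumes "smooth u"
  shows "(nls_sum N d S u has_vector_derivative nls_sum N d (fps_D S) u y) (at y)"
  unfolding nls_sum_def[abs_def] fps_D_def fps_nth_Abs_fps
  by (intro has_vector_derivative_sum has_vector_derivative_mult_right dp_eval_has_deriv)
    (rule smooth_nls_field[OF assms])

lemma smooth_nls_sum: "smooth u \<Longrightarrow> smooth (nls_sum N d S u)"
proof -
  assume u: "smooth u"
  have "cdiff n (nls_sum N d S u)" for n
  proof (induction n arbitrary: S)
    case (Suc n)
    show ?case by (rule cdiff_SucI[OF nls_sum_has_deriv[OF u] Suc])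
  qed simp
  then show ?thesis by (simp add: smooth_def)
qed

lemma smooth_divide: "smooth f \<Longrightarrow> smooth g \<Longrightarrow> (\<And>y. g y \<noteq> 0) \<Longrightarrow> smooth (\<lambda>y. f y / g y)"
  unfolding divide_inverse by (intro smooth_mult smooth_inverse)

lemma smooth_nls_Q:
  assumes "smooth u" "\<And>y. u y \<noteq> 0"
  shows "smooth (nls_Q N d u)"
  unfolding nls_Q_def[abs_def]
  by (intro smooth_add smooth_divide smooth_nls_sum smooth_cnj) (simp_all add: assms)

lemma nls_sum_linear:
  "nls_sum N (\<lambda>j. \<Sum>m\<in>I. c m * d m j) S u y = (\<Sum>m\<in>I. complex_of_real (c m) * nls_sum N (d m) S u y)"
  unfolding nls_sum_def of_real_sum sum_distrib_left sum_distrib_right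
  by (subst sum.swap) (simp add: mult_ac)

lemma nls_flow_linear:
  assumes "smooth u" "\<And>y. u y \<noteq> 0"
  shows "nls_flow \<epsilon> N (\<lambda>j. \<Sum>m\<in>I. c m * d m j) u y = (\<Sum>m\<in>I. c m *\<^sub>R nls_flow \<epsilon> N (d m) u y)"
proof -
  have Q: "nls_Q N (\<lambda>j. \<Sum>m\<in>I. c m * d m j) u = (\<lambda>y. \<Sum>m\<in>I. complex_of_real (c m) * nls_Q N (d m) u y)"
    by (simp add: fun_eq_iff nls_Q_def nls_sum_linear sum_divide_distrib sum.distrib[symmetric] distrib_left)
  have "xderiv (nls_Q N (\<lambda>j. \<Sum>m\<in>I. c m * d m j) u) y = (\<Sum>m\<in>I. complex_of_real (c m) * xderiv (nls_Q N (d m) u) y)"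
    unfolding Q
    by (intro xderiv_eqI has_vector_derivative_sum has_vector_derivative_mult_right smooth_has_deriv
        smooth_nls_Q assms)
  moreover have "nls_S N (\<lambda>j. \<Sum>m\<in>I. c m * d m j) u y = (\<Sum>m\<in>I. complex_of_real (c m) * nls_S N (d m) u y)"
    by (simp add: nls_S_def nls_sum_linear sum_divide_distrib sum_subtractf[symmetric] sum_distrib_left
        algebra_simps)
  ultimately show ?thesis
    by (simp add: nls_flow_def prod_eq_iff fst_sum snd_sum sum_divide_distrib scaleR_conv_of_real
        sum.distrib[symmetric] sum_subtractf[symmetric] algebra_simps)
qed

section \<open>The transition coefficients\<close>

text \<open>Substitution acts on coefficients by a triangular matrix, here expressed through the
  powers of \<zeta>.\<close>

lemma fps_compose_times_nth:
  fixes g E \<zeta> :: "complex fps"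
  assumes "fps_nth \<zeta> 0 = 0"
  shows "fps_nth (g * (E oo \<zeta>)) n = (\<Sum>j\<le>n. fps_nth E j * fps_nth (g * \<zeta> ^ j) n)"
proof -
  have *: "fps_nth (E oo \<zeta>) m = (\<Sum>j=0..n. fps_nth E j * fps_nth (\<zeta> ^ j) m)" if "m \<le> n" for m
    unfolding fps_compose_nth
    using that startsby_zero_power_prefix[OF assms] by (intro sum.mono_neutral_left) auto
  have "fps_nth (g * (E oo \<zeta>)) n = (\<Sum>i=0..n. \<Sum>j=0..n. fps_nth g i * (fps_nth E j * fps_nth (\<zeta> ^ j) (n - i)))"
    unfolding fps_mult_nth by (intro sum.cong refl) (simp add: * sum_distrib_left)
  also have "\<dots> = (\<Sum>j=0..n. fps_nth E j * fps_nth (g * \<zeta> ^ j) n)"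
    by (subst sum.swap) (simp add: fps_mult_nth sum_distrib_left mult_ac)
  finally show ?thesis by (simp add: atMost_atLeast0)
qed

lemma of_real_gchoose: "complex_of_real (a gchoose k) = (complex_of_real a gchoose k)"
  by (simp add: gbinomial_prod_rev)

context gp
begin

lemma time_scale_nz [simp]: "time_scale \<epsilon> n \<noteq> 0"
  using eps by (simp add: time_scale_def)

lemma time_scale_add: "time_scale \<epsilon> (i + 2 * d) = time_scale \<epsilon> i * (2 * \<epsilon>\<^sup>2) ^ d"
proof -
  have s: "sw \<noteq> 0" using eps by simp
  have "sw powi (n + 2 * int d) = sw powi n * (2 * \<epsilon>\<^sup>2) ^ d" for n
  proof -
    have "sw powi (2 * int d) = (2 * \<epsilon>\<^sup>2) ^ d"
      using power_int_of_nat[of "sw" "2 * d"] by (simp add: power_mult power_mult_distrib)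
    then show ?thesis using s by (simp add: power_int_add)
  qed
  from this[of "int i - 1"] this[of "int i"] show ?thesis
    by (simp add: time_scale_def algebra_simps)
qed

text \<open>The indices are shifted by one because coefficient \<open>l + 1\<close> belongs to the
  Hamiltonian of index \<open>l\<close>. The time scales convert scaled directions into unscaled
  ones.\<close>

lemma gp_transition_coeff:
  "gp_gam (Suc l) * fps_nth (gp_om (Suc l) * gp_zeta ^ Suc i) (Suc l) =
     complex_of_real (time_scale \<epsilon> l) * (kap * (- \<i>) ^ i * complex_of_real (c_matrix \<epsilon> i l / time_scale \<epsilon> i))"
proof (cases "i \<le> l \<and> even i = even l")
  case True
  define d where "d = (l - i) div 2"
  have "even (l - i)" using True by auto
  then have l: "l = i + 2 * d" using True unfolding d_def by auto
  define b where "b = Suc i div 2"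
  define B where "B = ((real b + real d - 1 / 2) gchoose d)"
  have div: "Suc l div 2 = b + d" unfolding l b_def by simp
  \<comment> \<open>Upper negation of the binomial; its sign cancels the one from
    \<open>(- \<i>) ^ (2 * d)\<close>.\<close>
  have bin: "(- (of_nat b) - 1 / 2 :: complex) gchoose d = (- 1) ^ d * complex_of_real B"
    using gbinomial_minus[of "of_nat b + 1 / 2 :: complex" d]
    by (simp add: B_def of_real_gchoose algebra_simps)
  have "fps_nth (gp_om (Suc l) * gp_zeta ^ Suc i) (Suc l) =
      (1 / gp_w) ^ Suc i * ((- (of_nat b) - 1 / 2) gchoose d) * (- 2 / eps2) ^ d"
    using True unfolding gp_zeta_power_nth div b_def[symmetric] by simp
  moreover have "gp_gam (Suc l) = kap * (- \<i>) ^ i * gp_w ^ Suc i * ((- 1) ^ d * (2 * eps2) ^ d)"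
  proof -
    have "(- \<i>) ^ Suc l = (- \<i>) ^ i * (- \<i>) * (- 1) ^ d"
      unfolding l by (simp add: power_add power_mult)
    moreover have "gp_w ^ Suc l = gp_w ^ Suc i * (2 * eps2) ^ d"
      unfolding l by (simp add: power_add power_mult power2_eq_square[of gp_w] gp_w_sq)
    ultimately show ?thesis
      unfolding gp_gam_def by (simp add: mult_ac)
  qed
  ultimately have "gp_gam (Suc l) * fps_nth (gp_om (Suc l) * gp_zeta ^ Suc i) (Suc l) =
      kap * (- \<i>) ^ i * ((gp_w * (1 / gp_w)) ^ Suc i) * ((- 1) ^ d * (- 1) ^ d) * (2 * eps2) ^ d *
        complex_of_real B * (- 2 / eps2) ^ d"
    unfolding bin power_mult_distrib by (simp only: mult_ac)
  also have "\<dots> = kap * (- \<i>) ^ i * (2 * eps2) ^ d * complex_of_real B * (- 2 / eps2) ^ d"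
  proof -
    have "(gp_w * (1 / gp_w)) ^ Suc i = 1" by simp
    moreover have "(- 1) ^ d * (- 1) ^ d = (1 :: complex)"
      unfolding power_mult_distrib[symmetric] by simp
    ultimately show ?thesis by (simp only: mult_1_right)
  qed
  also have "\<dots> = complex_of_real (time_scale \<epsilon> l) * (kap * (- \<i>) ^ i * complex_of_real (c_matrix \<epsilon> i l / time_scale \<epsilon> i))"
  proof -
    have "c_matrix \<epsilon> i l = B * (- (2 / \<epsilon>\<^sup>2)) ^ d"
      using True div by (simp add: c_matrix_def Let_def B_def b_def[symmetric])
    moreover have "time_scale \<epsilon> l = time_scale \<epsilon> i * (2 * \<epsilon>\<^sup>2) ^ d"
      unfolding l by (rule time_scale_add)
    ultimately show ?thesis by simp
  qed
  finally show ?thesis .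
next
  case False
  have "fps_nth (gp_om (Suc l) * gp_zeta ^ Suc i) (Suc l) = 0"
    unfolding gp_zeta_power_nth using False by auto
  moreover have "c_matrix \<epsilon> i l = 0"
    unfolding c_matrix_def using False by auto
  ultimately show ?thesis by (simp del: power_Suc)
qed

end

section \<open>Modulus and phase at fixed time\<close>

text \<open>The modulus is the square root of \<open>u * cnj u\<close>, which stays off the branch
  cut as \<open>u\<close> has no zeros.\<close>

lemma smooth_cmod:
  assumes "smooth u" "\<And>y. u y \<noteq> 0"
  shows "smooth (\<lambda>y. complex_of_real (cmod (u y)))"
proof -
  have eq: "u y * cnj (u y) = complex_of_real ((cmod (u y))\<^sup>2)" for y
    using complex_norm_square[of "u y"] by simp
  have "smooth (\<lambda>y. csqrt (u y * cnj (u y)))"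
  proof (rule smooth_csqrt)
    show "u y * cnj (u y) \<notin> \<real>\<^sub>\<le>\<^sub>0" for y
      unfolding eq using assms(2)[of y] by (simp add: complex_nonpos_Reals_iff)
  qed (intro smooth_mult smooth_cnj assms)
  moreover have "csqrt (u y * cnj (u y)) = complex_of_real (cmod (u y))" for y
    unfolding eq by (subst of_real_sqrt[symmetric]) simp_all
  ultimately show ?thesis by simp
qed

lemma smooth_Im:
  assumes "smooth f" shows "smooth (\<lambda>y. complex_of_real (Im (f y)))"
proof -
  have "complex_of_real (Im z) = (z - cnj z) * (1 / (2 * \<i>))" for z
    by (simp add: complex_diff_cnj)
  then show ?thesis
    using assms by (simp only:) (intro smooth_mult smooth_diff smooth_cnj smooth_const)
qed

text \<open>The ansatz in differentiated form: modulus and phase gradient of \<open>u\<close> give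
  the difference and the sum of the fields, with neither the integral nor the constant
  phase.\<close>

locale polar = gp +
  fixes w :: "real \<Rightarrow> real \<times> real" and u :: "real \<Rightarrow> complex"
  assumes u: "smooth u" and u_nz: "u y \<noteq> 0"
    and polar_A: "gp_A \<epsilon> w (sw * y) = complex_of_real (cmod (u y))"
    and polar_v: "eps2 * (gp_field w W_plus (sw * y) + gp_field w W_minus (sw * y)) =
      complex_of_real (Im (xderiv u y / u y))"
begin

abbreviation "cm y \<equiv> complex_of_real (cmod (u y))"

lemma sw_nz [simp]: "sw \<noteq> 0"
  using eps by simp

lemma cm_nz: "cm y \<noteq> 0"
  using u_nz by simp

lemma cm_sq: "cm y * cm y = u y * cnj (u y)"
  using complex_norm_square[of "u y"] by (simp add: power2_eq_square)

lemma smooth_cm: "smooth cm"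
  by (rule smooth_cmod[OF u u_nz])

text \<open>Solving the two linear relations of the locale for the fields transfers smoothness from
  \<open>u\<close> to \<open>w\<close>.\<close>

lemma smooth_field: "smooth (gp_field w v)"
proof -
  let ?v = "\<lambda>y. complex_of_real (Im (xderiv u y / u y))"
  let ?e = "eps2"
  have v: "smooth ?v"
    by (intro smooth_Im smooth_divide smooth_xderiv u u_nz)
  have p: "gp_field w W_plus (sw * y) = (1 / (2 * ?e)) * (?v y + 2 * (cm y - 1))"
    and m: "gp_field w W_minus (sw * y) = (1 / (2 * ?e)) * (?v y - 2 * (cm y - 1))" for y
    unfolding polar_v[symmetric] polar_A[symmetric] gp_A_def by (simp_all add: field_simps)
  have "smooth (\<lambda>y. gp_field w v (sw * y))"
    by (cases v) (simp_all only: p m, (intro smooth_mult smooth_add smooth_diff smooth_const v smooth_cm)+)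
  from smooth_scale[OF this, of "1 / sw"] show ?thesis
    using sw_nz by (simp add: o_def)
qed

lemma h_deriv:
  "((\<lambda>y. u y / cm y) has_vector_derivative
     \<i> * eps2 * (gp_field w W_plus (sw * y) + gp_field w W_minus (sw * y)) * (u y / cm y)) (at y)"
proof -
  define c' u' where "c' = xderiv cm y" and "u' = xderiv u y"
  have c: "(cm has_vector_derivative c') (at y)"
    unfolding c'_def by (rule smooth_has_deriv[OF smooth_cm])
  have u': "(u has_vector_derivative u') (at y)"
    unfolding u'_def by (rule smooth_has_deriv[OF u])
  \<comment> \<open>The derivative of the modulus is found by differentiating its square
    \<open>u * cnj u\<close>.\<close>
  have "((\<lambda>y. cm y * cm y) has_vector_derivative cm y * c' + c' * cm y) (at y)"
    by (intro has_vector_derivative_mult c)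
  moreover have "((\<lambda>y. cm y * cm y) has_vector_derivative u y * cnj u' + u' * cnj (u y)) (at y)"
    unfolding cm_sq by (intro has_vector_derivative_mult has_vector_derivative_cnj u')
  ultimately have "cm y * c' + c' * cm y = u y * cnj u' + u' * cnj (u y)"
    by (rule vector_derivative_unique_at)
  then have cc: "c' = (u y * cnj u' + u' * cnj (u y)) / (2 * cm y)"
    using cm_nz[of y] by (simp add: field_simps)
  have "smooth (\<lambda>y. u y / cm y)"
    by (intro smooth_divide u smooth_cm cm_nz)
  from smooth_has_deriv[OF this] have h: "((\<lambda>y. u y / cm y) has_vector_derivative xderiv (\<lambda>y. u y / cm y) y) (at y)" .
  have "((\<lambda>y. (u y / cm y) * cm y) has_vector_derivative (u y / cm y) * c' + xderiv (\<lambda>y. u y / cm y) y * cm y) (at y)"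
    by (intro has_vector_derivative_mult h c)
  moreover have "(\<lambda>y. (u y / cm y) * cm y) = u"
    using cm_nz by (auto simp: fun_eq_iff)
  ultimately have "(u y / cm y) * c' + xderiv (\<lambda>y. u y / cm y) y * cm y = u'"
    using u' vector_derivative_unique_at by fastforce
  then have x: "xderiv (\<lambda>y. u y / cm y) y = (u' - (u y / cm y) * c') / cm y"
    using cm_nz[of y] by (simp add: field_simps)
  have im: "\<i> * complex_of_real (Im (u' / u y)) = (u' / u y - cnj u' / cnj (u y)) / 2"
    using complex_diff_cnj[of "u' / u y"] by simp
  have "(u' - (u y / cm y) * c') / cm y = (u' / u y - c' / cm y) * (u y / cm y)"
    using u_nz[of y] cm_nz[of y] by (simp add: field_simps)
  also have "c' / cm y = (u y * cnj u' + u' * cnj (u y)) / (2 * (cm y * cm y))"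
    unfolding cc by simp
  also have "\<dots> = (u' / u y + cnj u' / cnj (u y)) / 2"
    unfolding cm_sq using u_nz[of y] by (simp add: field_simps)
  also have "u' / u y - (u' / u y + cnj u' / cnj (u y)) / 2 = \<i> * complex_of_real (Im (u' / u y))"
    unfolding im by (simp add: field_simps)
  finally have "xderiv (\<lambda>y. u y / cm y) y = \<i> * complex_of_real (Im (u' / u y)) * (u y / cm y)"
    unfolding x .
  then show ?thesis
    using h unfolding mult.assoc[of \<i>] polar_v u'_def by simp
qed

lemma h_unit: "cnj (u y / cm y) * (u y / cm y) = 1"
  using cm_sq[of y] cm_nz[of y] by (simp add: field_simps)

lemma link:
  "nls_ev u y nls_n oo gp_zeta = fps_const (u y / cm y * (- \<i> / 2)) * fps_ev (gp_field w) (sw * y) gp_N"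
  "nls_ev u y nls_k oo gp_zeta = fps_const (cnj (u y / cm y) * (- \<i> / 2)) * fps_ev (gp_field w) (sw * y) gp_K"
  "nls_ev u y nls_e oo gp_zeta = fps_ev (gp_field w) (sw * y) gp_e"
proof -
  have 1: "u y = cm y * (u y / cm y)" for y using cm_nz[of y] by simp
  have 2: "cm y = 1 + eps2 / 2 * (gp_field w W_plus (sw * y) - gp_field w W_minus (sw * y))" for y
    unfolding polar_A[symmetric] gp_A_def by simp
  note l = gp_nls_link[OF u smooth_field 1 2 _ h_unit h_deriv]
  show "nls_ev u y nls_n oo gp_zeta = fps_const (u y / cm y * (- \<i> / 2)) * fps_ev (gp_field w) (sw * y) gp_N"
    by (rule l(1)) simp
  show "nls_ev u y nls_k oo gp_zeta = fps_const (cnj (u y / cm y) * (- \<i> / 2)) * fps_ev (gp_field w) (sw * y) gp_K"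
    by (rule l(2)) simp
  show "nls_ev u y nls_e oo gp_zeta = fps_ev (gp_field w) (sw * y) gp_e"
    by (rule l(3)) simp
qed

text \<open>Coefficient 0 of \<open>S\<close> stands apart: it is zero for \<open>nls_n\<close> and
  \<open>nls_k\<close> and one for \<open>nls_e\<close>. The rest is column \<open>l\<close> of the
  matrix, which is zero below row \<open>l\<close>.\<close>

lemma transition_sum:
  assumes "l \<le> N"
  shows "gp_gam (Suc l) * fps_nth (gp_om (Suc l) * (nls_ev u y S oo gp_zeta)) (Suc l) =
    gp_gam (Suc l) * fps_nth (gp_om (Suc l)) (Suc l) * dp_eval (fps_nth S 0) (nls_field u) y +
    complex_of_real (time_scale \<epsilon> l) * (kap * nls_sum N (\<lambda>j. c_matrix \<epsilon> j l / time_scale \<epsilon> j) S u y)"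
proof -
  let ?E = "\<lambda>j. dp_eval (fps_nth S j) (nls_field u) y"
  have "gp_gam (Suc l) * fps_nth (gp_om (Suc l) * (nls_ev u y S oo gp_zeta)) (Suc l) =
      (\<Sum>j\<le>Suc l. gp_gam (Suc l) * fps_nth (gp_om (Suc l) * gp_zeta ^ j) (Suc l) * ?E j)"
    by (simp add: fps_compose_times_nth[OF gp_zeta_0] sum_distrib_left mult_ac del: sum.atMost_Suc)
  also have "\<dots> = gp_gam (Suc l) * fps_nth (gp_om (Suc l)) (Suc l) * ?E 0 +
      (\<Sum>i\<le>l. gp_gam (Suc l) * fps_nth (gp_om (Suc l) * gp_zeta ^ Suc i) (Suc l) * ?E (Suc i))"
    by (subst sum.atMost_Suc_shift) simp
  also have "(\<Sum>i\<le>l. gp_gam (Suc l) * fps_nth (gp_om (Suc l) * gp_zeta ^ Suc i) (Suc l) * ?E (Suc i)) =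
      (\<Sum>i\<le>N. gp_gam (Suc l) * fps_nth (gp_om (Suc l) * gp_zeta ^ Suc i) (Suc l) * ?E (Suc i))"
  proof (rule sum.mono_neutral_left)
    show "\<forall>i\<in>{..N} - {..l}. gp_gam (Suc l) * fps_nth (gp_om (Suc l) * gp_zeta ^ Suc i) (Suc l) * ?E (Suc i) = 0"
      unfolding gp_transition_coeff by (simp add: c_matrix_def)
  qed (use assms in auto)
  also have "\<dots> = complex_of_real (time_scale \<epsilon> l) * (kap * nls_sum N (\<lambda>j. c_matrix \<epsilon> j l / time_scale \<epsilon> j) S u y)"
    unfolding gp_transition_coeff nls_sum_def sum_distrib_left by (intro sum.cong refl) (simp only: mult_ac)
  finally show ?thesis .
qed

lemma nls_e_deriv:
  "(nls_sum N d nls_e u has_vector_derivative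
     2 * (u y * nls_sum N d nls_k u y) - 2 * (cnj (u y) * nls_sum N d nls_n u y)) (at y)"
proof -
  have "dp_eval (fps_nth (fps_D nls_e) j) (nls_field u) y =
      2 * (u y * dp_eval (fps_nth nls_k j) (nls_field u) y) - 2 * (cnj (u y) * dp_eval (fps_nth nls_n j) (nls_field u) y)" for j
    using arg_cong[OF nls_e_D, of "\<lambda>S. fps_nth (nls_ev u y S) j"]
    by (simp add: nls_field_def numeral_fps_const)
  then have "nls_sum N d (fps_D nls_e) u y = 2 * (u y * nls_sum N d nls_k u y) - 2 * (cnj (u y) * nls_sum N d nls_n u y)"
    unfolding nls_sum_def sum_distrib_left sum_subtractf[symmetric]
    by (intro sum.cong refl) (simp only: right_diff_distrib mult_ac)
  then show ?thesis using nls_sum_has_deriv[OF u, of N d nls_e y] by simp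
qed

text \<open>The constant \<open>c0\<close> stems from the constant term of \<open>nls_e\<close>. It
  does no harm, since \<open>gp_J\<close> only uses the derivative of the sum of the
  components.\<close>

lemma gpt_grad:
  fixes l N
  defines "d \<equiv> \<lambda>j. c_matrix \<epsilon> j l / time_scale \<epsilon> j"
  assumes "l \<le> N"
  shows "\<exists>c0. \<forall>y. fst (gp_grad (gpt_H \<epsilon> (int l)) w (sw * y)) + snd (gp_grad (gpt_H \<epsilon> (int l)) w (sw * y)) =
      c0 + complex_of_real (time_scale \<epsilon> l) * kap * nls_sum N d nls_e u y"
    "fst (gp_grad (gpt_H \<epsilon> (int l)) w (sw * y)) - snd (gp_grad (gpt_H \<epsilon> (int l)) w (sw * y)) =
      complex_of_real (time_scale \<epsilon> l) * kap * \<i> * (cm y * nls_Q N d u y)"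
proof -
  let ?om = "gp_om (Suc l)" and ?g = "gp_gam (Suc l)"
  let ?ev = "\<lambda>y. fps_ev (gp_field w) (sw * y)"
  have ev: "dp_eval (fps_nth (fps_dc c * S) n) (gp_field w) (sw * y) = fps_nth (c * ?ev y S) n" for c S n y
    using fps_ev_nth[of "gp_field w" "sw * y" "fps_dc c * S" n] by simp
  have g1: "fst (gp_grad (gpt_H \<epsilon> (int l)) w (sw * y)) = ?g * fps_nth (?om * ?ev y gp_s) (Suc l)"
    and g2: "snd (gp_grad (gpt_H \<epsilon> (int l)) w (sw * y)) = - (?g * fps_nth (?om * ?ev y gp_p) (Suc l))" for y
    using gpt_H_euler[of "Suc l"] by (simp_all add: gp_grad_def ev)
  have "fst (gp_grad (gpt_H \<epsilon> (int l)) w (sw * y)) + snd (gp_grad (gpt_H \<epsilon> (int l)) w (sw * y)) =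
      ?g * fps_nth ?om (Suc l) + complex_of_real (time_scale \<epsilon> l) * kap * nls_sum N d nls_e u y" for y
  proof -
    have "fst (gp_grad (gpt_H \<epsilon> (int l)) w (sw * y)) + snd (gp_grad (gpt_H \<epsilon> (int l)) w (sw * y)) =
        ?g * fps_nth (?om * (nls_ev u y nls_e oo gp_zeta)) (Suc l)"
      unfolding g1 g2 link(3) gp_e_def by (simp add: right_diff_distrib)
    then show ?thesis
      unfolding transition_sum[OF assms(2)] by (simp add: nls_resolvent d_def mult.assoc)
  qed
  then show "\<exists>c0. \<forall>y. fst (gp_grad (gpt_H \<epsilon> (int l)) w (sw * y)) + snd (gp_grad (gpt_H \<epsilon> (int l)) w (sw * y)) =
      c0 + complex_of_real (time_scale \<epsilon> l) * kap * nls_sum N d nls_e u y"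
    by blast
  define h where "h = u y / cm y"
  have hh: "cnj h * h = 1" unfolding h_def by (rule h_unit)
  let ?n = "nls_ev u y nls_n oo gp_zeta" and ?k = "nls_ev u y nls_k oo gp_zeta"
  have "fps_const (\<i> * cnj h) * ?n + fps_const (\<i> * h) * ?k =
      fps_const ((cnj h * h) * (1 / 2)) * ?ev y gp_N + fps_const ((cnj h * h) * (1 / 2)) * ?ev y gp_K"
    unfolding link h_def[symmetric] mult.assoc[symmetric] fps_const_mult by (simp add: mult_ac)
  also have "\<dots> = fps_const (1 / 2) * (?ev y gp_N + ?ev y gp_K)"
    unfolding hh by (simp add: distrib_left)
  also have "?ev y gp_N + ?ev y gp_K = fps_const 2 * ?ev y (gp_s + gp_p)"
    unfolding gp_N_def gp_K_def by (simp add: numeral_fps_const[symmetric])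
  also have "fps_const (1 / 2) * (fps_const 2 * ?ev y (gp_s + gp_p)) = ?ev y (gp_s + gp_p)"
    unfolding mult.assoc[symmetric] by simp
  finally have sp: "?ev y (gp_s + gp_p) = fps_const (\<i> * cnj h) * ?n + fps_const (\<i> * h) * ?k" by simp
  have "fst (gp_grad (gpt_H \<epsilon> (int l)) w (sw * y)) - snd (gp_grad (gpt_H \<epsilon> (int l)) w (sw * y)) =
      ?g * fps_nth (?om * ?ev y (gp_s + gp_p)) (Suc l)"
    unfolding g1 g2 by (simp add: distrib_left)
  also have "\<dots> = \<i> * cnj h * (?g * fps_nth (?om * ?n) (Suc l)) + \<i> * h * (?g * fps_nth (?om * ?k) (Suc l))"
    unfolding sp distrib_left mult.left_commute[of ?om] fps_add_nth fps_mult_left_const_nth by (simp only: mult_ac)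
  also have "\<dots> = complex_of_real (time_scale \<epsilon> l) * kap * \<i> * (cnj h * nls_sum N d nls_n u y + h * nls_sum N d nls_k u y)"
    unfolding transition_sum[OF assms(2)] by (simp add: nls_resolvent d_def algebra_simps)
  also have "cnj h * nls_sum N d nls_n u y + h * nls_sum N d nls_k u y = cm y * nls_Q N d u y"
  proof -
    have "h = cm y / cnj (u y)" "cnj h = cm y / u y"
      using cm_sq[of y] cm_nz[of y] u_nz[of y] by (simp_all add: h_def field_simps)
    then show ?thesis by (simp add: nls_Q_def algebra_simps)
  qed
  finally show "fst (gp_grad (gpt_H \<epsilon> (int l)) w (sw * y)) - snd (gp_grad (gpt_H \<epsilon> (int l)) w (sw * y)) =
      complex_of_real (time_scale \<epsilon> l) * kap * \<i> * (cm y * nls_Q N d u y)" .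
qed

text \<open>The operator sees the pair only through \<open>(f - g) / A\<close> and
  \<open>f + g\<close>, the combinations for which the GP gradient is known in NLS terms.\<close>

lemma gp_J_eq:
  assumes "smooth (\<lambda>Y. fst (F Y))" "smooth (\<lambda>Y. snd (F Y))"
  shows "gp_J \<epsilon> w F X =
    (- xderiv (\<lambda>Y. (fst (F Y) - snd (F Y)) / gp_A \<epsilon> w Y) X - xderiv (\<lambda>Y. fst (F Y) + snd (F Y)) X / gp_A \<epsilon> w X,
     - xderiv (\<lambda>Y. (fst (F Y) - snd (F Y)) / gp_A \<epsilon> w Y) X + xderiv (\<lambda>Y. fst (F Y) + snd (F Y)) X / gp_A \<epsilon> w X)"
proof -
  have A: "smooth (gp_A \<epsilon> w)"
    unfolding gp_A_def[abs_def] by (intro smooth_add smooth_mult smooth_diff smooth_const smooth_field)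
  have A_nz: "gp_A \<epsilon> w Y \<noteq> 0" for Y
    using polar_A[of "Y / sw"] cm_nz[of "Y / sw"] by simp
  have "((\<lambda>Y. fst (F Y) / gp_A \<epsilon> w Y - snd (F Y) / gp_A \<epsilon> w Y) has_vector_derivative
      xderiv (\<lambda>Y. fst (F Y) / gp_A \<epsilon> w Y) X - xderiv (\<lambda>Y. snd (F Y) / gp_A \<epsilon> w Y) X) (at X)"
    by (intro has_vector_derivative_diff smooth_has_deriv smooth_divide assms A A_nz)
  then have 1: "xderiv (\<lambda>Y. (fst (F Y) - snd (F Y)) / gp_A \<epsilon> w Y) X =
      xderiv (\<lambda>Y. fst (F Y) / gp_A \<epsilon> w Y) X - xderiv (\<lambda>Y. snd (F Y) / gp_A \<epsilon> w Y) X"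
    unfolding diff_divide_distrib by (rule xderiv_eqI)
  have 2: "xderiv (\<lambda>Y. fst (F Y) + snd (F Y)) X = xderiv (\<lambda>Y. fst (F Y)) X + xderiv (\<lambda>Y. snd (F Y)) X"
    by (intro xderiv_eqI has_vector_derivative_add smooth_has_deriv assms)
  show ?thesis
    unfolding gp_J_def Let_def 1 2 by (simp add: add_divide_distrib)
qed

lemma smooth_grad: "smooth (\<lambda>Y. fst (gp_grad H w Y))" "smooth (\<lambda>Y. snd (gp_grad H w Y))"
  unfolding gp_grad_def fst_conv snd_conv by (intro smooth_dp_eval smooth_field)+

lemma xderiv_scale:
  assumes "(f has_vector_derivative f') (at (X / sw))"
  shows "xderiv (\<lambda>Y. c0 + c * f (Y / sw)) X = c * (f' / complex_of_real sw)"
proof -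
  have "((\<lambda>Y. Y / sw) has_vector_derivative (1 / sw)) (at X)"
    by (auto intro!: derivative_eq_intros)
  from vector_diff_chain_at[OF this assms]
  have "((\<lambda>Y. f (Y / sw)) has_vector_derivative f' / complex_of_real sw) (at X)"
    by (simp add: o_def scaleR_conv_of_real)
  then have "((\<lambda>Y. c0 + c * f (Y / sw)) has_vector_derivative 0 + c * (f' / complex_of_real sw)) (at X)"
    by (intro has_vector_derivative_add has_vector_derivative_const has_vector_derivative_mult_right)
  then show ?thesis by (simp add: xderiv_eqI)
qed

lemma gpt_flow:
  assumes "l \<le> N"
  shows "((1 / time_scale \<epsilon> l) * (1 / (2 * \<epsilon>\<^sup>2))) *\<^sub>R gp_J \<epsilon> w (gp_grad (gpt_H \<epsilon> (int l)) w) X =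
    nls_flow \<epsilon> N (\<lambda>j. c_matrix \<epsilon> j l / time_scale \<epsilon> j) u (X / sw)"
proof -
  define d where "d = (\<lambda>j. c_matrix \<epsilon> j l / time_scale \<epsilon> j)"
  define y where "y = X / sw"
  define ts where "ts = complex_of_real (time_scale \<epsilon> l)"
  let ?F = "gp_grad (gpt_H \<epsilon> (int l)) w"
  note grad = gpt_grad[OF assms, folded d_def]
  obtain c0 where "\<forall>y. fst (?F (sw * y)) + snd (?F (sw * y)) = c0 + ts * kap * nls_sum N d nls_e u y"
    using grad(1) unfolding ts_def by blast
  from this[rule_format, of "_ / sw"]
  have sum: "fst (?F Y) + snd (?F Y) = c0 + ts * kap * nls_sum N d nls_e u (Y / sw)" for Y
    by simp
  have A: "gp_A \<epsilon> w Y = cm (Y / sw)" for Y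
    using polar_A[of "Y / sw"] by simp
  have diff: "(fst (?F Y) - snd (?F Y)) / gp_A \<epsilon> w Y = 0 + ts * kap * \<i> * nls_Q N d u (Y / sw)" for Y
    using grad(2)[of "Y / sw"] cm_nz[of "Y / sw"] by (simp add: A ts_def)
  have x1: "xderiv (\<lambda>Y. (fst (?F Y) - snd (?F Y)) / gp_A \<epsilon> w Y) X =
      ts * kap * \<i> * (xderiv (nls_Q N d u) y / complex_of_real sw)"
    unfolding diff y_def by (intro xderiv_scale smooth_has_deriv smooth_nls_Q u u_nz)
  have x2: "xderiv (\<lambda>Y. fst (?F Y) + snd (?F Y)) X =
      ts * kap * ((2 * (u y * nls_sum N d nls_k u y) - 2 * (cnj (u y) * nls_sum N d nls_n u y)) / complex_of_real sw)"
    unfolding sum y_def by (intro xderiv_scale nls_e_deriv)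
  \<comment> \<open>Spectral constant against the chain rule factor of \<open>X = sw * y\<close>.
    The unit \<i> that remains squares to -1 in the first term and is part of \<open>nls_S\<close>
    in the second.\<close>
  have k: "kap / complex_of_real sw = \<i> / 2"
    using sqrt2_sq by (simp add: kap_def field_simps)
  have 1: "xderiv (\<lambda>Y. (fst (?F Y) - snd (?F Y)) / gp_A \<epsilon> w Y) X = - (ts / 2 * xderiv (nls_Q N d u) y)"
  proof -
    have "xderiv (\<lambda>Y. (fst (?F Y) - snd (?F Y)) / gp_A \<epsilon> w Y) X =
        ts * (kap / complex_of_real sw) * \<i> * xderiv (nls_Q N d u) y"
      unfolding x1 by simp
    also have "\<dots> = (\<i> * \<i>) * (ts / 2 * xderiv (nls_Q N d u) y)"
      unfolding k by (simp only: mult_ac times_divide_eq_right times_divide_eq_left)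
    finally show ?thesis by simp
  qed
  have 2: "xderiv (\<lambda>Y. fst (?F Y) + snd (?F Y)) X / gp_A \<epsilon> w X = - (ts * nls_S N d u y)"
  proof -
    have "xderiv (\<lambda>Y. fst (?F Y) + snd (?F Y)) X / gp_A \<epsilon> w X =
        ts * (kap / complex_of_real sw) * 2 * ((u y * nls_sum N d nls_k u y - cnj (u y) * nls_sum N d nls_n u y) / cm y)"
      unfolding x2 A y_def[symmetric] by (simp add: algebra_simps diff_divide_distrib)
    also have "(u y * nls_sum N d nls_k u y - cnj (u y) * nls_sum N d nls_n u y) / cm y =
        cm y * (nls_sum N d nls_k u y / cnj (u y) - nls_sum N d nls_n u y / u y)"
    proof -
      have "u y / cm y = cm y / cnj (u y)" "cnj (u y) / cm y = cm y / u y"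
        using cm_sq[of y] cm_nz[of y] u_nz[of y] by (simp_all add: field_simps)
      then show ?thesis
        by (simp add: diff_divide_distrib right_diff_distrib times_divide_eq_left[symmetric] del: times_divide_eq_left)
    qed
    finally show ?thesis unfolding k nls_S_def by (simp add: algebra_simps)
  qed
  have ts: "ts \<noteq> 0" by (simp add: ts_def)
  show ?thesis
    unfolding gp_J_eq[OF smooth_grad] 1 2 d_def[symmetric] y_def[symmetric] nls_flow_def
    using ts eps by (simp add: prod_eq_iff scaleR_conv_of_real ts_def[symmetric] field_simps)
qed

end

section \<open>The KdV form of the GP flow\<close>

definition kdv_flow :: "real \<Rightarrow> (int \<Rightarrow> (gp_var, complex poly) dpoly) \<Rightarrow> int \<Rightarrow>
    (real \<Rightarrow> real \<times> real) \<Rightarrow> real \<Rightarrow> complex \<times> complex" where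
  "kdv_flow \<epsilon> P k w X =
    (- (if even k then 1 else - 1) * (1 / 2) *
       xderiv (kdv_E_deriv ((k - 1) div 2) (\<lambda>Y. complex_of_real (fst (w Y)))) X,
     - (1 / 2) * xderiv (kdv_E_deriv ((k - 1) div 2) (\<lambda>Y. - complex_of_real (snd (w Y)))) X)
    + \<epsilon>\<^sup>2 *\<^sub>R residual \<epsilon> P k w X"

context polar
begin

lemma smooth_A: "smooth (gp_A \<epsilon> w)"
  unfolding gp_A_def[abs_def] by (intro smooth_add smooth_mult smooth_diff smooth_const smooth_field)

lemma A_nz: "gp_A \<epsilon> w Y \<noteq> 0"
  using polar_A[of "Y / sw"] cm_nz[of "Y / sw"] by simp

text \<open>Writing \<open>1 / A = 1 + (1 / A - 1)\<close> splits off the part with constant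
  coefficients; the quotient rule produces the zeroth order part of \<open>gp_E\<close>.\<close>

lemma gp_J_quarter:
  assumes f: "smooth (\<lambda>Y. fst (F Y))" and g: "smooth (\<lambda>Y. snd (F Y))"
  shows "(1 / 4) *\<^sub>R gp_J \<epsilon> w F X = gp_D F X + \<epsilon>\<^sup>2 *\<^sub>R gp_E \<epsilon> w F X"
proof -
  let ?A = "gp_A \<epsilon> w"
  have quot: "xderiv (\<lambda>Y. k Y / ?A Y) X = xderiv k X / ?A X - k X * xderiv ?A X / (?A X)\<^sup>2" if "smooth k" for k
  proof -
    have "smooth (\<lambda>Y. k Y / ?A Y)" by (intro smooth_divide smooth_A that A_nz)
    then have "((\<lambda>Y. k Y / ?A Y * ?A Y) has_vector_derivative
        k X / ?A X * xderiv ?A X + xderiv (\<lambda>Y. k Y / ?A Y) X * ?A X) (at X)"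
      by (intro has_vector_derivative_mult smooth_has_deriv smooth_A)
    moreover have "(\<lambda>Y. k Y / ?A Y * ?A Y) = k" using A_nz by auto
    ultimately have "xderiv k X = k X / ?A X * xderiv ?A X + xderiv (\<lambda>Y. k Y / ?A Y) X * ?A X"
      using xderiv_eqI by metis
    then show ?thesis using A_nz[of X] by (simp add: field_simps power2_eq_square)
  qed
  show ?thesis
    using A_nz[of X] eps
    unfolding gp_J_def gp_D_def gp_E_def Let_def quot[OF f] quot[OF g]
    by (simp add: prod_eq_iff scaleR_conv_of_real) (simp add: field_simps power2_eq_square)
qed

lemma gp_D_add:
  assumes "smooth (\<lambda>Y. fst (F Y))" "smooth (\<lambda>Y. snd (F Y))" "smooth (\<lambda>Y. fst (G Y))" "smooth (\<lambda>Y. snd (G Y))"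
  shows "gp_D (\<lambda>Y. F Y + c *\<^sub>R G Y) X = gp_D F X + c *\<^sub>R gp_D G X"
    "gp_E \<epsilon> w (\<lambda>Y. F Y + c *\<^sub>R G Y) X = gp_E \<epsilon> w F X + c *\<^sub>R gp_E \<epsilon> w G X"
proof -
  have d: "xderiv (\<lambda>Y. f Y + c *\<^sub>R g Y) X = xderiv f X + c *\<^sub>R xderiv g X" if "smooth f" "smooth g" for f g
    unfolding scaleR_conv_of_real
    by (intro xderiv_eqI has_vector_derivative_add has_vector_derivative_mult_right smooth_has_deriv that)
  show "gp_D (\<lambda>Y. F Y + c *\<^sub>R G Y) X = gp_D F X + c *\<^sub>R gp_D G X"
    "gp_E \<epsilon> w (\<lambda>Y. F Y + c *\<^sub>R G Y) X = gp_E \<epsilon> w F X + c *\<^sub>R gp_E \<epsilon> w G X"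
    using assms by (simp_all add: gp_D_def gp_E_def Let_def prod_eq_iff d)
      (simp_all add: scaleR_conv_of_real algebra_simps add_divide_distrib diff_divide_distrib)
qed

lemma gp_J_scale:
  assumes f: "smooth (\<lambda>Y. fst (F Y))" and g: "smooth (\<lambda>Y. snd (F Y))"
  shows "gp_J \<epsilon> w (\<lambda>Y. c *\<^sub>R F Y) X = c *\<^sub>R gp_J \<epsilon> w F X"
proof -
  have d: "xderiv (\<lambda>Y. c *\<^sub>R f Y) X = c *\<^sub>R xderiv f X" if "smooth f" for f
    unfolding scaleR_conv_of_real
    by (intro xderiv_eqI has_vector_derivative_mult_right smooth_has_deriv that)
  have q: "xderiv (\<lambda>Y. c *\<^sub>R f Y / gp_A \<epsilon> w Y) X = c *\<^sub>R xderiv (\<lambda>Y. f Y / gp_A \<epsilon> w Y) X" if "smooth f" for f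
    using d[OF smooth_divide[OF that smooth_A A_nz]] by (simp add: scaleR_conv_of_real)
  show ?thesis
    using f g by (simp add: gp_J_def Let_def prod_eq_iff d q)
      (simp add: scaleR_conv_of_real algebra_simps)
qed

text \<open>The inner derivative of \<open>- W_-\<close> contributes a sign, which turns the
  \<open>1 / 2\<close> in \<open>gp_D\<close> into the \<open>- 1 / 2\<close> of the KdV
  flow.\<close>

lemma kdv_grad:
  "fst (gp_grad (kdv_E_Wp m) w Y) = kdv_E_deriv m (gp_field w W_plus) Y"
  "snd (gp_grad (kdv_E_Wp m) w Y) = 0"
  "fst (gp_grad (kdv_E_mWm m) w Y) = 0"
  "snd (gp_grad (kdv_E_mWm m) w Y) = - kdv_E_deriv m (\<lambda>Y. - gp_field w W_minus Y) Y"
proof -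
  have p: "dp_euler v (kdv_E_Wp m) = (if v = W_plus then dp_subst (\<lambda>_. Wp) (dp_euler KdV_U (kdv_E m)) else 0)" for v
    using dp_euler_subst[of v 1 W_plus "kdv_E m"] by (simp add: kdv_E_Wp_def)
  have mm: "dp_euler v (kdv_E_mWm m) = (if v = W_minus then - dp_subst (\<lambda>_. - Wm) (dp_euler KdV_U (kdv_E m)) else 0)" for v
    using dp_euler_subst[of v "- 1" W_minus "kdv_E m"] by (simp add: kdv_E_mWm_def)
  have 1: "dp_eval Wp (gp_field w) = gp_field w W_plus"
    and 2: "dp_eval (- Wm) (gp_field w) = (\<lambda>Y. - gp_field w W_minus Y)" by auto
  show "fst (gp_grad (kdv_E_Wp m) w Y) = kdv_E_deriv m (gp_field w W_plus) Y"
    "snd (gp_grad (kdv_E_Wp m) w Y) = 0"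
    "fst (gp_grad (kdv_E_mWm m) w Y) = 0"
    "snd (gp_grad (kdv_E_mWm m) w Y) = - kdv_E_deriv m (\<lambda>Y. - gp_field w W_minus Y) Y"
    by (simp_all add: gp_grad_def p mm dp_eval_subst[OF smooth_field] 1 2 kdv_E_deriv_def del: dp_eval_minus)
      (simp add: dp_eval_subst[OF smooth_field] 2)
qed

definition kdv_F :: "int \<Rightarrow> real \<Rightarrow> complex \<times> complex" where
  "kdv_F k Y = ((if even k then 1 else - 1) * fst (gp_grad (kdv_E_Wp ((k - 1) div 2)) w Y),
      snd (gp_grad (kdv_E_mWm ((k - 1) div 2)) w Y))"

lemma smooth_kdv_F: "smooth (\<lambda>Y. fst (kdv_F k Y))" "smooth (\<lambda>Y. snd (kdv_F k Y))"
  unfolding kdv_F_def fst_conv snd_conv by (intro smooth_mult smooth_const smooth_grad)+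

lemma gp_D_kdv_F:
  "gp_D (kdv_F k) X =
    (- (if even k then 1 else - 1) * (1 / 2) *
       xderiv (kdv_E_deriv ((k - 1) div 2) (\<lambda>Y. complex_of_real (fst (w Y)))) X,
     - (1 / 2) * xderiv (kdv_E_deriv ((k - 1) div 2) (\<lambda>Y. - complex_of_real (snd (w Y)))) X)"
proof -
  have f: "gp_field w W_plus = (\<lambda>Y. complex_of_real (fst (w Y)))"
    "gp_field w W_minus = (\<lambda>Y. complex_of_real (snd (w Y)))"
    by (auto simp: gp_field_def cpair_def fun_eq_iff)
  let ?m = "(k - 1) div 2"
  have s1: "smooth (\<lambda>Y. fst (gp_grad (kdv_E_Wp ?m) w Y))" and s2: "smooth (\<lambda>Y. snd (gp_grad (kdv_E_mWm ?m) w Y))"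
    by (rule smooth_grad)+
  have 1: "xderiv (\<lambda>Y. c * fst (gp_grad (kdv_E_Wp ?m) w Y)) X = c * xderiv (\<lambda>Y. fst (gp_grad (kdv_E_Wp ?m) w Y)) X" for c
    by (intro xderiv_eqI has_vector_derivative_mult_right smooth_has_deriv s1)
  have e1: "(\<lambda>Y. fst (gp_grad (kdv_E_Wp ?m) w Y)) = kdv_E_deriv ?m (\<lambda>Y. complex_of_real (fst (w Y)))"
    unfolding kdv_grad f by (rule refl)
  have e2: "kdv_E_deriv ?m (\<lambda>Y. - complex_of_real (snd (w Y))) = (\<lambda>Y. (- 1) * snd (gp_grad (kdv_E_mWm ?m) w Y))"
    unfolding kdv_grad f by simp
  have 2: "xderiv (kdv_E_deriv ?m (\<lambda>Y. - complex_of_real (snd (w Y)))) X =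
      (- 1) * xderiv (\<lambda>Y. snd (gp_grad (kdv_E_mWm ?m) w Y)) X"
    unfolding e2 by (intro xderiv_eqI has_vector_derivative_mult_right smooth_has_deriv s2)
  show ?thesis
    unfolding gp_D_def kdv_F_def fst_conv snd_conv 1 2 e1 by simp
qed

text \<open>\<open>cc\<close> is the prefactor of the KdV expansion of the Hamiltonian; the time
  scales are such that it cancels up to the 4 in \<open>J / 4\<close>.\<close>

lemma kdv_flow_eq:
  assumes cc: "cc \<noteq> 0"
    and grad: "\<And>Y. gp_grad (gpt_H \<epsilon> k) w Y = cc *\<^sub>R (kdv_F k Y + \<epsilon>\<^sup>2 *\<^sub>R gp_grad (at_eps \<epsilon> (R k)) w Y)"
  shows "(1 / (4 * cc)) *\<^sub>R gp_J \<epsilon> w (gp_grad (gpt_H \<epsilon> k) w) X = kdv_flow \<epsilon> R k w X"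
proof -
  let ?G = "gp_grad (at_eps \<epsilon> (R k)) w"
  let ?FG = "\<lambda>Y. kdv_F k Y + \<epsilon>\<^sup>2 *\<^sub>R ?G Y"
  have sm: "smooth (\<lambda>Y. fst (?FG Y))" "smooth (\<lambda>Y. snd (?FG Y))"
    unfolding fst_add snd_add fst_scaleR snd_scaleR scaleR_conv_of_real
    by (intro smooth_add smooth_mult smooth_const smooth_kdv_F smooth_grad)+
  have g: "gp_grad (gpt_H \<epsilon> k) w = (\<lambda>Y. cc *\<^sub>R ?FG Y)"
    using grad by auto
  have "(1 / (4 * cc)) *\<^sub>R gp_J \<epsilon> w (gp_grad (gpt_H \<epsilon> k) w) X = (1 / 4) *\<^sub>R gp_J \<epsilon> w ?FG X"
    unfolding g gp_J_scale[OF sm] using cc by simp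
  also have "\<dots> = gp_D (kdv_F k) X + \<epsilon>\<^sup>2 *\<^sub>R (gp_E \<epsilon> w (kdv_F k) X + (gp_D ?G X + \<epsilon>\<^sup>2 *\<^sub>R gp_E \<epsilon> w ?G X))"
    unfolding gp_J_quarter[OF sm] gp_D_add[OF smooth_kdv_F smooth_grad] by (simp add: scaleR_add_right add_ac)
  also have "gp_E \<epsilon> w (kdv_F k) X + (gp_D ?G X + \<epsilon>\<^sup>2 *\<^sub>R gp_E \<epsilon> w ?G X) = residual \<epsilon> R k w X"
    unfolding residual_def Let_def kdv_F_def[abs_def] ..
  finally show ?thesis
    unfolding kdv_flow_def gp_D_kdv_F .
qed

lemma gpt_H_grad:
  assumes R: "residual_densities R"
  shows "gp_grad (gpt_H \<epsilon> (2 * int n)) w Y = (sw ^ (2 * n + 1) / 2) *\<^sub>R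
      (kdv_F (2 * int n) Y + \<epsilon>\<^sup>2 *\<^sub>R gp_grad (at_eps \<epsilon> (R (2 * int n))) w Y)"
    "gp_grad (gpt_H \<epsilon> (2 * int n - 1)) w Y = (sw ^ (2 * n + 1) / 4) *\<^sub>R
      (kdv_F (2 * int n - 1) Y + \<epsilon>\<^sup>2 *\<^sub>R gp_grad (at_eps \<epsilon> (R (2 * int n - 1))) w Y)"
proof -
  have d1: "(2 * int n - 1) div 2 = int n - 1" and d2: "(2 * int n - 1 - 1) div 2 = int n - 1"
    by (simp_all add: div_diff)
  have eq1: "dp_equiv (gpt_H \<epsilon> (2 * int n))
       (dp_const (complex_of_real (sw ^ (2 * n + 1) / 2)) *
         (kdv_E_mWm (int n - 1) + kdv_E_Wp (int n - 1)
          + dp_const (complex_of_real (\<epsilon>\<^sup>2)) * at_eps \<epsilon> (R (2 * int n))))"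
    and eq2: "dp_equiv (gpt_H \<epsilon> (2 * int n - 1))
       (dp_const (complex_of_real (sw ^ (2 * n + 1) / 4)) *
         (kdv_E_mWm (int n - 1) - kdv_E_Wp (int n - 1)
          + dp_const (complex_of_real (\<epsilon>\<^sup>2)) * at_eps \<epsilon> (R (2 * int n - 1))))"
    using R eps unfolding residual_densities_def by blast+
  have grad: "gp_grad H w Y = (c * (fst (gp_grad K w Y) + fst (gp_grad K' w Y) + e * fst (gp_grad S w Y)),
      c * (snd (gp_grad K w Y) + snd (gp_grad K' w Y) + e * snd (gp_grad S w Y)))"
    if "dp_equiv H (dp_const c * (K + K' + dp_const e * S))" for H K K' S c e
    using that[THEN dp_equiv_euler]
    by (simp add: gp_grad_def dp_euler_const_mult dp_euler_add del: dp_const_simps)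
  have neg: "gp_grad (- K) w Y = - gp_grad K w Y" for K
    by (simp add: gp_grad_def dp_euler_minus)
  show "gp_grad (gpt_H \<epsilon> (2 * int n)) w Y = (sw ^ (2 * n + 1) / 2) *\<^sub>R
      (kdv_F (2 * int n) Y + \<epsilon>\<^sup>2 *\<^sub>R gp_grad (at_eps \<epsilon> (R (2 * int n))) w Y)"
    unfolding grad[OF eq1] kdv_F_def d1
    by (simp add: kdv_grad prod_eq_iff scaleR_conv_of_real)
  show "gp_grad (gpt_H \<epsilon> (2 * int n - 1)) w Y = (sw ^ (2 * n + 1) / 4) *\<^sub>R
      (kdv_F (2 * int n - 1) Y + \<epsilon>\<^sup>2 *\<^sub>R gp_grad (at_eps \<epsilon> (R (2 * int n - 1))) w Y)"
    unfolding grad[OF eq2[unfolded diff_conv_add_uminus[of "kdv_E_mWm _"]]] kdv_F_def d2 neg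
    by (simp add: kdv_grad prod_eq_iff scaleR_conv_of_real)
qed

lemma gpt_kdv_flow:
  assumes R: "residual_densities R"
  shows "((1 / time_scale \<epsilon> l) * (1 / (2 * \<epsilon>\<^sup>2))) *\<^sub>R gp_J \<epsilon> w (gp_grad (gpt_H \<epsilon> (int l)) w) X =
    kdv_flow \<epsilon> R (int l) w X"
proof (cases "even l")
  case True
  then obtain n where l: "l = 2 * n" by (elim evenE)
  have "2 * (sw powi (2 * int n - 1)) * (2 * \<epsilon>\<^sup>2) = 2 * sw ^ (2 * n + 1)"
  proof -
    have "sw powi (2 * int n - 1) * (sw * sw) = sw ^ (2 * n + 1)"
      using sw_nz power_int_of_nat[of sw "2 * n"]
      by (simp add: power_int_diff del: mult_eq_0_iff)
    moreover have "2 * \<epsilon>\<^sup>2 = sw * sw" by (simp add: power2_eq_square)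
    ultimately show ?thesis by (simp only: mult.assoc)
  qed
  then have E: "(1 / time_scale \<epsilon> l) * (1 / (2 * \<epsilon>\<^sup>2)) = 1 / (4 * (sw ^ (2 * n + 1) / 2))"
    by (simp add: time_scale_def l field_simps)
  show ?thesis
    unfolding E using kdv_flow_eq[of "sw ^ (2 * n + 1) / 2" "2 * int n" R X, OF _ gpt_H_grad(1)[OF R]] sw_nz by (simp add: l)
next
  case False
  then obtain n where l: "l = 2 * n - 1" "n \<ge> 1" by (metis Suc_eq_plus1 diff_Suc_1 le_add2 mult_Suc_right oddE add_2_eq_Suc diff_Suc_Suc One_nat_def)
  then have il: "int l = 2 * int n - 1" by simp
  have "sw powi (int l) * (2 * \<epsilon>\<^sup>2) = sw ^ (2 * n + 1)"
  proof -
    have "2 * n + 1 = l + 2" using l by simp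
    then show ?thesis by (simp add: power2_eq_square)
  qed
  then have E: "(1 / time_scale \<epsilon> l) * (1 / (2 * \<epsilon>\<^sup>2)) = 1 / (4 * (sw ^ (2 * n + 1) / 4))"
    using False by (simp add: time_scale_def field_simps)
  show ?thesis
    unfolding E using kdv_flow_eq[of "sw ^ (2 * n + 1) / 4" "2 * int n - 1" R X, OF _ gpt_H_grad(2)[OF R]] sw_nz by (simp add: il)
qed

text \<open>The gradient of the Hamiltonian of index -1 has equal constant components: their
  difference is zero and their sum has derivative zero.\<close>

lemma kdv_flow_minus_one:
  assumes R: "residual_densities R"
  shows "kdv_flow \<epsilon> R (- 1) w X = 0"
proof -
  \<comment> \<open>Index -1 is the case \<open>n = 0\<close> of \<open>gpt_H_euler\<close>, and
    \<open>gp_s\<close> and \<open>- gp_p\<close> have the same constant term.\<close>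
  have g: "gp_grad (gpt_H \<epsilon> (- 1)) w = (\<lambda>Y. (fst (gp_grad (gpt_H \<epsilon> (- 1)) w 0), fst (gp_grad (gpt_H \<epsilon> (- 1)) w 0)))"
    using gpt_H_euler[of 0] by (simp add: gp_grad_def gp_ps_0 gp_gam_def fun_eq_iff fps_dc_def)
  have "gp_J \<epsilon> w (gp_grad (gpt_H \<epsilon> (- 1)) w) X = 0"
    by (subst g, subst gp_J_eq) (simp_all add: smooth_const xderiv_def prod_eq_iff)
  moreover have "gp_grad (gpt_H \<epsilon> (- 1)) w Y = (sw / 4) *\<^sub>R
      (kdv_F (- 1) Y + \<epsilon>\<^sup>2 *\<^sub>R gp_grad (at_eps \<epsilon> (R (- 1))) w Y)" for Y
    using gpt_H_grad(2)[OF R, of 0 Y] by simp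
  ultimately show ?thesis
    using kdv_flow_eq[of "sw / 4" "- 1" R X] sw_nz by simp
qed

end

section \<open>Time derivatives\<close>

lemma smooth_tx_ex:
  assumes "smooth_tx N f"
  shows "\<exists>h g. continuous_on (time_space N \<times> UNIV) (\<lambda>(t, x). f t x) \<and>
    (\<forall>t\<in>time_space N. \<forall>x. (f t has_vector_derivative h t x) (at x)) \<and> smooth_tx N h \<and>
    (\<forall>n\<le>N. \<forall>t\<in>time_space N. \<forall>x. ((\<lambda>s. f (t(n := s)) x) has_vector_derivative g n t x) (at (t n))) \<and>
    (\<forall>n\<le>N. smooth_tx N (g n))"
  using assms by (cases rule: smooth_tx.cases) blast

lemma smooth_tx_cont: "smooth_tx N f \<Longrightarrow> continuous_on (time_space N \<times> UNIV) (\<lambda>(t, x). f t x)"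
  using smooth_tx_ex by blast

lemma smooth_tx_smooth:
  assumes "smooth_tx N f" "t \<in> time_space N" shows "smooth (f t)"
proof -
  have "cdiff n (f t)" for n
    using assms(1)
  proof (induction n arbitrary: f)
    case (Suc n)
    obtain h where h: "(\<forall>t\<in>time_space N. \<forall>x. (f t has_vector_derivative h t x) (at x)) \<and> smooth_tx N h"
      using smooth_tx_ex[OF Suc.prems] by blast
    then have "cdiff n (h t)" by (intro Suc.IH) blast
    then show ?case using h assms(2) by (intro cdiff_SucI[of _ "h t"]) blast+
  qed simp
  then show ?thesis by (simp add: smooth_def)
qed

lemma time_space_line: "t \<in> time_space N \<Longrightarrow> d \<in> time_space N \<Longrightarrow> (\<lambda>k. t k + s * d k) \<in> time_space N"
  by (simp add: time_space_def)

text \<open>Continuous partial derivatives give directional ones. The induction adds one moving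
  coordinate at a time, as a second parameter besides that of the earlier coordinates.\<close>

lemma line_deriv:
  fixes f :: "(nat \<Rightarrow> real) \<Rightarrow> complex" and g :: "nat \<Rightarrow> (nat \<Rightarrow> real) \<Rightarrow> complex"
  assumes cont: "\<And>n. n \<le> N \<Longrightarrow> continuous_on (time_space N) (g n)"
    and partial: "\<And>n t. n \<le> N \<Longrightarrow> t \<in> time_space N \<Longrightarrow>
      ((\<lambda>s. f (t(n := s))) has_vector_derivative g n t) (at (t n))"
    and t: "t \<in> time_space N" and d: "d \<in> time_space N"
  shows "((\<lambda>s. f (\<lambda>k. t k + s * d k)) has_vector_derivative
    (\<Sum>n\<le>N. complex_of_real (d n) * g n (\<lambda>k. t k + s0 * d k))) (at s0)"
proof -
  have "((\<lambda>s. f (\<lambda>k. t k + s * d k)) has_vector_derivative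
      (\<Sum>n<m. complex_of_real (d n) * g n (\<lambda>k. t k + s0 * d k))) (at s0)"
    if "m \<le> Suc N" "t \<in> time_space N" "\<And>k. k \<ge> m \<Longrightarrow> d k = 0" for m t d s0
    using that
  proof (induction m arbitrary: t d s0)
    case 0
    then have "d = (\<lambda>_. 0)" by auto
    then show ?case by simp
  next
    case (Suc m)
    define d' where "d' = d(m := 0)"
    \<comment> \<open>The line is the diagonal of this two-parameter surface.\<close>
    define pt where "pt z = (\<lambda>k. t k + fst z * d' k + (if k = m then snd z * d m else 0))" for z
    have TS: "pt z \<in> time_space N" for z
      using Suc.prems unfolding pt_def d'_def time_space_def by auto
    have m: "m \<le> N" using Suc.prems by simp
    have pt_cont: "continuous_on UNIV pt"
    proof (rule continuous_on_coordinatewise_then_product)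
      fix i show "continuous_on UNIV (\<lambda>z. pt z i)"
        unfolding pt_def by (cases "i = m") (auto intro!: continuous_intros)
    qed
    have gm_cont: "continuous_on UNIV (\<lambda>z. blinfun_scaleR_left (complex_of_real (d m) * g m (pt z)))"
      by (intro bounded_linear.continuous_on[OF bounded_linear_blinfun_scaleR_left] continuous_intros
          continuous_on_compose2[OF cont[OF m] pt_cont]) (use TS in auto)
    have s: "((\<lambda>s. f (pt (s, s0))) has_vector_derivative (\<Sum>n<m. complex_of_real (d' n) * g n (pt (s0, s0)))) (at s0)"
    proof -
      have eq: "pt (s, s0) = (\<lambda>k. (t(m := t m + s0 * d m)) k + s * d' k)" for s
        by (auto simp: pt_def d'_def)
      have TS': "t(m := t m + s0 * d m) \<in> time_space N"
        using Suc.prems m by (auto simp: time_space_def)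
      have d'0: "d' k = 0" if "k \<ge> m" for k
        using Suc.prems(3)[of k] that by (auto simp: d'_def)
      show ?thesis
        unfolding eq by (rule Suc.IH[OF _ TS' d'0]) (use Suc.prems in simp_all)
    qed
    have r: "((\<lambda>r. f (pt (s, r))) has_derivative blinfun_apply (blinfun_scaleR_left (complex_of_real (d m) * g m (pt (s, r))))) (at r)" for s r
    proof -
      have eq: "pt (s, r') = (pt (s, r))(m := t m + r' * d m)" for r'
        by (auto simp: pt_def d'_def)
      have ptm: "pt (s, r) m = t m + r * d m" by (simp add: pt_def d'_def)
      have "((\<lambda>r'. t m + r' * d m) has_vector_derivative d m) (at r)"
        by (auto intro!: derivative_eq_intros)
      moreover have "((\<lambda>z. f ((pt (s, r))(m := z))) has_vector_derivative g m (pt (s, r))) (at (t m + r * d m))"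
        using partial[OF m TS[of "(s, r)"]] unfolding ptm .
      ultimately have "(((\<lambda>z. f ((pt (s, r))(m := z))) \<circ> (\<lambda>r'. t m + r' * d m)) has_vector_derivative d m *\<^sub>R g m (pt (s, r))) (at r)"
        by (rule vector_diff_chain_at)
      then show ?thesis
        unfolding o_def eq[symmetric] has_vector_derivative_def by (simp add: scaleR_conv_of_real)
    qed
    have "((\<lambda>(s, r). f (pt (s, r))) has_derivative
        (\<lambda>(hs, hr). hs *\<^sub>R (\<Sum>n<m. complex_of_real (d' n) * g n (pt (s0, s0))) +
           blinfun_apply (blinfun_scaleR_left (complex_of_real (d m) * g m (pt (s0, s0)))) hr)) (at (s0, s0) within UNIV \<times> UNIV)"
    proof (rule has_derivative_partialsI[where f = "\<lambda>s r. f (pt (s, r))" and x = s0 and y = s0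
          and X = UNIV and Y = UNIV and fy = "\<lambda>s r. blinfun_scaleR_left (complex_of_real (d m) * g m (pt (s, r)))"
          and fx = "\<lambda>hs. hs *\<^sub>R (\<Sum>n<m. complex_of_real (d' n) * g n (pt (s0, s0)))"])
      show "continuous (at (s0, s0) within UNIV \<times> UNIV) (\<lambda>(s, r). blinfun_scaleR_left (complex_of_real (d m) * g m (pt (s, r))))"
        using gm_cont by (simp add: continuous_on_eq_continuous_at split_def)
    qed (use s r in \<open>simp_all add: has_vector_derivative_def\<close>)
    then have 1: "((\<lambda>(s, r). f (pt (s, r))) has_derivative
        (\<lambda>(hs, hr). hs *\<^sub>R (\<Sum>n<m. complex_of_real (d' n) * g n (pt (s0, s0))) +
           hr *\<^sub>R (complex_of_real (d m) * g m (pt (s0, s0))))) (at (s0, s0))"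
      by simp
    have 2: "((\<lambda>s. (s, s)) has_derivative (\<lambda>h. (h, h))) (at s0)"
      by (intro has_derivative_Pair has_derivative_ident)
    have "((\<lambda>s. f (pt (s, s))) has_vector_derivative
        (\<Sum>n<m. complex_of_real (d' n) * g n (pt (s0, s0))) + complex_of_real (d m) * g m (pt (s0, s0))) (at s0)"
      using diff_chain_at[OF 2 1]
      by (simp add: o_def has_vector_derivative_def scaleR_add_right)
    moreover have "pt (s, s) = (\<lambda>k. t k + s * d k)" for s
      by (auto simp: pt_def d'_def)
    moreover have "(\<Sum>n<m. complex_of_real (d' n) * z n) = (\<Sum>n<m. complex_of_real (d n) * z n)" for z
      by (intro sum.cong) (auto simp: d'_def)
    ultimately show ?case by simp
  qed
  from this[of "Suc N" t d] t d show ?thesis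
    by (simp add: time_space_def lessThan_Suc_atMost Suc_le_eq)
qed

lemma smooth_tx_partial_cont:
  assumes "smooth_tx N f" shows "continuous_on (time_space N) (\<lambda>t. f t x)"
proof -
  have "continuous_on (time_space N) (\<lambda>t. (t, x))" by (intro continuous_intros)
  from continuous_on_compose2[OF smooth_tx_cont[OF assms] this] show ?thesis by auto
qed

text \<open>\<open>f t y - f t a\<close> is the integral of \<open>h t\<close>; differentiating
  under the integral sign and then in \<open>y\<close> gives the space derivative of the time
  derivative.\<close>

lemma mixed_partials:
  fixes f h g k :: "(nat \<Rightarrow> real) \<Rightarrow> real \<Rightarrow> complex"
  assumes t: "t \<in> time_space N" and n: "n \<le> N"
    and f: "\<And>t x. t \<in> time_space N \<Longrightarrow> (f t has_vector_derivative h t x) (at x)"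
    and g: "\<And>t x. t \<in> time_space N \<Longrightarrow> ((\<lambda>s. f (t(n := s)) x) has_vector_derivative g t x) (at (t n))"
    and hg: "\<And>t x. t \<in> time_space N \<Longrightarrow> ((\<lambda>s. h (t(n := s)) x) has_vector_derivative k t x) (at (t n))"
    and hc: "continuous_on (time_space N \<times> UNIV) (\<lambda>(t, x). h t x)"
    and kc: "continuous_on (time_space N \<times> UNIV) (\<lambda>(t, x). k t x)"
  shows "(g t has_vector_derivative k t x) (at x)"
proof -
  \<comment> \<open>A base point to the left of \<open>x\<close>: the integral representation holds
    from \<open>a\<close> on, hence in a neighbourhood of \<open>x\<close>.\<close>
  define a where "a = x - 1"
  have TS: "t(n := s) \<in> time_space N" for s
    using t n by (auto simp: time_space_def)
  have upd_cont: "continuous_on S (\<lambda>s. t(n := s))" for S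
  proof (rule continuous_on_coordinatewise_then_product)
    fix i show "continuous_on S (\<lambda>s. (t(n := s)) i)"
      by (cases "i = n") (auto intro!: continuous_intros)
  qed
  have h_cont: "continuous_on S (h s)" if "s \<in> time_space N" for s S
  proof -
    have "continuous_on S (\<lambda>x. (s, x))" by (intro continuous_intros)
    from continuous_on_compose2[OF hc this] that show ?thesis by auto
  qed
  have k_cont: "continuous_on S (k s)" if "s \<in> time_space N" for s S
  proof -
    have "continuous_on S (\<lambda>x. (s, x))" by (intro continuous_intros)
    from continuous_on_compose2[OF kc this] that show ?thesis by auto
  qed
  have int: "integral {a..y} (h s) = f s y - f s a" if "a \<le> y" "s \<in> time_space N" for y s
    using that f by (intro integral_unique fundamental_theorem_of_calculus)
      (auto intro: has_vector_derivative_at_within)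
  have eq: "g t y = g t a + integral {a..y} (k t)" if "a \<le> y" for y
  proof -
    have "((\<lambda>s. integral (cbox a y) (h (t(n := s)))) has_vector_derivative
        integral (cbox a y) (k (t(n := t n)))) (at (t n) within UNIV)"
    proof (rule leibniz_rule_vector_derivative)
      show "((\<lambda>s. h (t(n := s)) z) has_vector_derivative k (t(n := s)) z) (at s within UNIV)" for s z
        using hg[OF TS[of s], of z] by simp
      show "h (t(n := s)) integrable_on cbox a y" for s
        by (intro integrable_continuous h_cont TS)
      show "continuous_on (UNIV \<times> cbox a y) (\<lambda>(s, z). k (t(n := s)) z)"
        unfolding split_def
      proof (rule continuous_on_compose2[OF kc[unfolded split_def], of _ "\<lambda>p. (t(n := fst p), snd p)", unfolded fst_conv snd_conv])
        have "continuous_on (UNIV \<times> cbox a y) (\<lambda>p. t(n := fst p))"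
          by (rule continuous_on_compose2[OF upd_cont[of UNIV]]) (auto intro!: continuous_intros)
        then show "continuous_on (UNIV \<times> cbox a y) (\<lambda>p. (t(n := fst p), snd p))"
          by (intro continuous_on_Pair continuous_on_snd continuous_on_id)
      qed (auto simp: TS)
    qed auto
    then have "((\<lambda>s. f (t(n := s)) y - f (t(n := s)) a) has_vector_derivative integral {a..y} (k t)) (at (t n))"
      using int[OF that TS] by simp
    moreover have "((\<lambda>s. f (t(n := s)) y - f (t(n := s)) a) has_vector_derivative g t y - g t a) (at (t n))"
      by (intro has_vector_derivative_diff g t)
    ultimately have "integral {a..y} (k t) = g t y - g t a"
      by (rule vector_derivative_unique_at)
    then show ?thesis by simp
  qed
  have "((\<lambda>y. integral {a..y} (k t)) has_vector_derivative k t x) (at x within {a..x + 1})"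
    by (rule integral_has_vector_derivative[OF k_cont[OF t]]) (simp add: a_def)
  then have "((\<lambda>y. g t a + integral {a..y} (k t)) has_vector_derivative k t x) (at x)"
  proof -
    have "at x within {a..x + 1} = at x"
      by (rule at_within_interior) (simp add: a_def)
    then show ?thesis
      using has_vector_derivative_add[OF has_vector_derivative_const \<open>((\<lambda>y. integral {a..y} (k t)) has_vector_derivative k t x) (at x within {a..x + 1})\<close>, of "g t a"]
      by simp
  qed
  then show ?thesis
    by (rule has_vector_derivative_transform_within_open[where S = "{a<..}"])
      (simp_all add: eq[symmetric], simp add: a_def)
qed

lemma nls_H_euler:
  "dp_euler NLS_qbar (nls_H n) = - (dp_const ((- \<i>) ^ n) * fps_nth nls_n (Suc n))"
  by (simp add: nls_H_def dp_euler_minus dp_euler_const_mult nls_sigma_euler del: dp_const_power)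

text \<open>A column of the transition matrix moves several times at once, so the flows are needed
  along lines. The second part exchanges space and time derivatives.\<close>

lemma nls_hierarchy_line:
  assumes smooth: "smooth_tx N q" and nls: "nls_hierarchy N q"
    and t: "t \<in> time_space N" and d: "d \<in> time_space N"
  shows "((\<lambda>s. q (\<lambda>k. t k + s * d k) y) has_vector_derivative \<i> * nls_sum N d nls_n (q t) y) (at 0)"
    "((\<lambda>s. xderiv (q (\<lambda>k. t k + s * d k)) y) has_vector_derivative
       xderiv (\<lambda>y. \<i> * nls_sum N d nls_n (q t) y) y) (at 0)"
proof -
  obtain h g where q: "(\<forall>t\<in>time_space N. \<forall>x. (q t has_vector_derivative h t x) (at x)) \<and> smooth_tx N h \<and>
    (\<forall>n\<le>N. \<forall>t\<in>time_space N. \<forall>x. ((\<lambda>s. q (t(n := s)) x) has_vector_derivative g n t x) (at (t n))) \<and>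
    (\<forall>n\<le>N. smooth_tx N (g n))"
    using smooth_tx_ex[OF smooth] by blast
  then have "smooth_tx N h" by blast
  from smooth_tx_ex[OF this] obtain k where
    kk: "(\<forall>n\<le>N. \<forall>t\<in>time_space N. \<forall>x. ((\<lambda>s. h (t(n := s)) x) has_vector_derivative k n t x) (at (t n))) \<and>
    (\<forall>n\<le>N. smooth_tx N (k n))" by blast
  have h: "(q t has_vector_derivative h t x) (at x)" "smooth_tx N h" if "t \<in> time_space N" for t x
    using q that by blast+
  have g: "((\<lambda>s. q (t(n := s)) x) has_vector_derivative g n t x) (at (t n))" "smooth_tx N (g n)"
    if "n \<le> N" "t \<in> time_space N" for n t x
    using q that by blast+
  have k: "((\<lambda>s. h (t(n := s)) x) has_vector_derivative k n t x) (at (t n))" "smooth_tx N (k n)"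
    if "n \<le> N" "t \<in> time_space N" for n t x
    using kk that by blast+
  have g_eq: "g n t y = \<i> * ((- \<i>) ^ n * dp_eval (fps_nth nls_n (Suc n)) (nls_field (q t)) y)" if "n \<le> N" for n y
  proof -
    have "\<i> * g n t y = - ((- \<i>) ^ n * dp_eval (fps_nth nls_n (Suc n)) (nls_field (q t)) y)"
    proof -
      have "\<i> * vector_derivative (\<lambda>s. q (t(n := s)) y) (at (t n)) = dp_eval (dp_euler NLS_qbar (nls_H n)) (nls_field (q t)) y"
        using nls that t unfolding nls_hierarchy_def by blast
      then show ?thesis
        unfolding vector_derivative_at[OF g(1)[OF that t]] nls_H_euler by (simp del: dp_const_power)
    qed
    then have "- \<i> * (\<i> * g n t y) = \<i> * ((- \<i>) ^ n * dp_eval (fps_nth nls_n (Suc n)) (nls_field (q t)) y)"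
      by simp
    then show ?thesis by (simp flip: mult.assoc)
  qed
  have G: "(\<Sum>n\<le>N. complex_of_real (d n) * g n t y) = \<i> * nls_sum N d nls_n (q t) y" for y
    by (simp add: nls_sum_def sum_distrib_left g_eq mult_ac)
  show "((\<lambda>s. q (\<lambda>k. t k + s * d k) y) has_vector_derivative \<i> * nls_sum N d nls_n (q t) y) (at 0)"
    using line_deriv[of N "\<lambda>n t. g n t y" "\<lambda>t. q t y" t d 0] g t d
    by (simp add: smooth_tx_partial_cont G)
  have "((\<lambda>y. \<Sum>n\<le>N. complex_of_real (d n) * g n t y) has_vector_derivative
      (\<Sum>n\<le>N. complex_of_real (d n) * k n t y)) (at y)"
  proof (intro has_vector_derivative_sum has_vector_derivative_mult_right)
    fix n
    assume "n \<in> {..N}"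
    then have n: "n \<le> N" by simp
    show "(g n t has_vector_derivative k n t y) (at y)"
      by (rule mixed_partials[OF t n, of q h "g n" "k n"])
        (use h g(1)[OF n] k[OF n] t smooth_tx_cont in blast)+
  qed
  then have "xderiv (\<lambda>y. \<i> * nls_sum N d nls_n (q t) y) y = (\<Sum>n\<le>N. complex_of_real (d n) * k n t y)"
    unfolding G by (rule xderiv_eqI)
  moreover have "xderiv (q (\<lambda>k. t k + s * d k)) y = h (\<lambda>k. t k + s * d k) y" for s
    by (intro xderiv_eqI h time_space_line t d)
  ultimately show "((\<lambda>s. xderiv (q (\<lambda>k. t k + s * d k)) y) has_vector_derivative
       xderiv (\<lambda>y. \<i> * nls_sum N d nls_n (q t) y) y) (at 0)"
    using line_deriv[of N "\<lambda>n t. k n t y" "\<lambda>t. h t y" t d 0] k t d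
    by (simp add: smooth_tx_partial_cont)
qed

section \<open>The ansatz\<close>

lemma polar_ansatz:
  assumes eps: "\<epsilon> > 0" and u: "smooth u" and nz: "\<And>y. u y \<noteq> 0"
    and w: "continuous_on UNIV w" and lim: "(w \<longlongrightarrow> 0) at_top"
    and ansatz: "\<And>y X. X = sqrt 2 * \<epsilon> * y \<Longrightarrow> u y = complex_of_real (1 + \<epsilon>\<^sup>2 / 2 * (fst (w X) - snd (w X)))
           * exp (\<i> * complex_of_real (\<epsilon> / sqrt 2 * (LBINT Y=ereal 0..ereal X. fst (w Y) + snd (w Y))))
           * exp (\<i> * complex_of_real \<phi>)"
  shows "polar \<epsilon> w u"
proof -
  let ?s = "sqrt 2 * \<epsilon>"
  define a where "a X = 1 + \<epsilon>\<^sup>2 / 2 * (fst (w X) - snd (w X))" for X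
  define \<theta> where "\<theta> X = \<epsilon> / sqrt 2 * (LBINT Y=ereal 0..ereal X. fst (w Y) + snd (w Y))" for X
  define v where "v y = \<epsilon>\<^sup>2 * (fst (w (?s * y)) + snd (w (?s * y)))" for y
  have uy: "u y = complex_of_real (a (?s * y)) * exp (\<i> * complex_of_real (\<theta> (?s * y))) * exp (\<i> * complex_of_real \<phi>)" for y
    unfolding a_def \<theta>_def by (rule ansatz) simp
  have a_nz: "a X \<noteq> 0" for X
    using nz[of "X / ?s"] uy[of "X / ?s"] eps by auto
  have a_cont: "continuous_on S a" for S
    unfolding a_def by (intro continuous_intros continuous_on_subset[OF w]) auto
  have a_lim: "(a \<longlongrightarrow> 1) at_top"
  proof -
    have "(a \<longlongrightarrow> 1 + \<epsilon>\<^sup>2 / 2 * (fst (0 :: real \<times> real) - snd (0 :: real \<times> real))) at_top"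
      unfolding a_def by (intro tendsto_intros lim)
    then show ?thesis by simp
  qed
  \<comment> \<open>The amplitude is continuous, has no zeros and tends to 1, so by the intermediate
    value theorem it is positive and equals the modulus of \<open>u\<close>.\<close>
  have a_pos: "a X > 0" for X
  proof (rule ccontr)
    assume neg: "\<not> a X > 0"
    have "\<forall>\<^sub>F Y in at_top. a Y > 0"
      using order_tendstoD(1)[OF a_lim, of 0] by simp
    then obtain Z where "\<And>Y. Y \<ge> Z \<Longrightarrow> a Y > 0"
      unfolding eventually_at_top_linorder by blast
    then have "a (max X Z) > 0" by simp
    then have "\<exists>Y\<ge>X. Y \<le> max X Z \<and> a Y = 0"
      using neg by (intro IVT' a_cont) auto
    then show False using a_nz by auto
  qed
  have norm: "cmod (u y) = a (?s * y)" for y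
    unfolding uy norm_mult norm_exp_i_times using a_pos[of "?s * y"] by simp
  define cm where "cm y = complex_of_real (cmod (u y))" for y
  have cm: "smooth cm"
    unfolding cm_def by (rule smooth_cmod[OF u nz])
  have \<theta>: "(\<theta> has_vector_derivative \<epsilon> / sqrt 2 * (fst (w X) + snd (w X))) (at X)" for X
  proof -
    \<comment> \<open>The interval must contain the base point 0 and have \<open>X\<close> in its
      interior.\<close>
    let ?A = "- \<bar>X\<bar> - 1" and ?B = "\<bar>X\<bar> + 1"
    have "((\<lambda>z. LBINT Y=ereal 0..ereal z. fst (w Y) + snd (w Y)) has_vector_derivative
        fst (w X) + snd (w X)) (at X within {?A..?B})"
      using w by (intro interval_integral_FTC2 continuous_intros continuous_on_subset[OF w]) auto
    then have "((\<lambda>z. LBINT Y=ereal 0..ereal z. fst (w Y) + snd (w Y)) has_vector_derivative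
        fst (w X) + snd (w X)) (at X)"
      by (subst (asm) at_within_interior) auto
    then show ?thesis
      unfolding \<theta>_def by (rule has_vector_derivative_mult_right)
  qed
  define h where "h y = exp (\<i> * complex_of_real (\<theta> (?s * y))) * exp (\<i> * complex_of_real \<phi>)" for y
  have h: "(h has_vector_derivative \<i> * complex_of_real (v y) * h y) (at y)" for y
  proof -
    have "((\<lambda>y. ?s * y) has_vector_derivative ?s) (at y)"
      by (auto intro!: derivative_eq_intros)
    from vector_diff_chain_at[OF this \<theta>]
    have "((\<lambda>y. \<theta> (?s * y)) has_vector_derivative v y) (at y)"
      by (simp add: o_def v_def power2_eq_square mult_ac)
    then have "((\<lambda>y. \<i> * complex_of_real (\<theta> (?s * y))) has_vector_derivative \<i> * complex_of_real (v y)) (at y)"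
      by (intro has_vector_derivative_mult_right has_vector_derivative_of_real
          has_real_derivative_iff_has_vector_derivative[THEN iffD2])
    from field_vector_diff_chain_at[OF this DERIV_exp]
    have "((\<lambda>y. exp (\<i> * complex_of_real (\<theta> (?s * y)))) has_vector_derivative
        \<i> * complex_of_real (v y) * exp (\<i> * complex_of_real (\<theta> (?s * y)))) (at y)"
      by (simp add: o_def)
    then show ?thesis
      unfolding h_def mult.assoc[symmetric] by (rule has_vector_derivative_mult_left)
  qed
  have u_eq: "u y = cm y * h y" for y
  proof -
    have "cm y = complex_of_real (a (?s * y))" by (simp only: cm_def norm)
    then show ?thesis unfolding h_def uy by (simp only: mult.assoc)
  qed
  have "Im (xderiv u y / u y) = v y" for y
  proof -
    have "(u has_vector_derivative cm y * (\<i> * complex_of_real (v y) * h y) + xderiv cm y * h y) (at y)"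
    proof -
      have "u = (\<lambda>y. cm y * h y)" using u_eq by (rule ext)
      then show ?thesis
        using has_vector_derivative_mult[OF smooth_has_deriv[OF cm] h] by (simp only:)
    qed
    then have "xderiv u y / u y = \<i> * complex_of_real (v y) + xderiv cm y / cm y"
      using nz[of y] unfolding u_eq[of y] by (simp add: xderiv_eqI field_simps)
    \<comment> \<open>The modulus is real, so its logarithmic derivative does not contribute to the
      imaginary part.\<close>
    moreover have "cnj (xderiv cm y) = xderiv cm y"
    proof -
      have "((\<lambda>y. cnj (cm y)) has_vector_derivative cnj (xderiv cm y)) (at y)"
        by (intro has_vector_derivative_cnj smooth_has_deriv cm)
      moreover have "(\<lambda>y. cnj (cm y)) = cm" by (auto simp: cm_def)
      ultimately show ?thesis using smooth_has_deriv[OF cm] vector_derivative_unique_at by metis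
    qed
    then have "Im (xderiv cm y / cm y) = 0"
      by (simp add: cm_def complex_eq_iff Im_divide)
    ultimately show ?thesis by simp
  qed
  then show ?thesis
    by unfold_locales
      (use eps u nz in \<open>auto simp: norm gp_A_def gp_field_def cpair_def a_def v_def\<close>)
qed

context polar
begin

lemma field_formula:
  "cpair (w (sw * y)) =
    ((complex_of_real (Im (xderiv u y / u y)) + 2 * (cm y - 1)) / (2 * eps2),
     (complex_of_real (Im (xderiv u y / u y)) - 2 * (cm y - 1)) / (2 * eps2))"
  using polar_v[of y, symmetric] polar_A[of y, symmetric] eps
  by (simp add: gp_A_def gp_field_def prod_eq_iff field_simps)

text \<open>Conjugation turns \<open>(- \<i>) ^ j\<close> into \<open>\<i> ^ j\<close>, and the sign
  \<open>(- 1) ^ j\<close> of the resolvent symmetry turns it back.\<close>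

lemma nls_sum_cnj: "cnj (nls_sum N d nls_n u y) = nls_sum N d nls_k u y"
proof -
  have "cnj ((- \<i>) ^ j * dp_eval (fps_nth nls_n (Suc j)) (nls_field u) y) =
      (- \<i>) ^ j * dp_eval (fps_nth nls_k (Suc j)) (nls_field u) y" for j
    by (simp add: nls_resolvent_cnj[OF u] flip: mult.assoc power_mult_distrib)
  then show ?thesis
    unfolding nls_sum_def by (simp add: mult.assoc)
qed

text \<open>The right-hand side is \<open>field_formula\<close> differentiated in time when the
  field evolves with logarithmic velocity \<open>z\<close>. Here the reality of the flows
  enters.\<close>

lemma nls_flow_real_imag:
  defines "z \<equiv> \<lambda>N d y. \<i> * nls_sum N d nls_n u y / u y"
  shows "nls_flow \<epsilon> N d u y =
    ((complex_of_real (Im (xderiv (z N d) y)) + 2 * (cm y * complex_of_real (Re (z N d y)))) / (2 * eps2),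
     (complex_of_real (Im (xderiv (z N d) y)) - 2 * (cm y * complex_of_real (Re (z N d y)))) / (2 * eps2))"
proof -
  have zs: "smooth (z N d)"
    unfolding z_def by (intro smooth_divide smooth_mult smooth_const smooth_nls_sum u u_nz)
  have ratio: "nls_sum N d nls_n u y / u y = - \<i> * z N d y" for y
    by (simp add: z_def)
  have ratio2: "nls_sum N d nls_k u y / cnj (u y) = \<i> * cnj (z N d y)" for y
    unfolding nls_sum_cnj[symmetric] z_def by simp
  have "nls_Q N d u = (\<lambda>y. 2 * complex_of_real (Im (z N d y)))"
    unfolding nls_Q_def[abs_def] ratio ratio2 by (simp add: complex_eq_iff fun_eq_iff)
  moreover have "((\<lambda>y. 2 * complex_of_real (Im (z N d y))) has_vector_derivative
      2 * complex_of_real (Im (xderiv (z N d) y))) (at y)"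
    by (intro has_vector_derivative_mult_right has_vector_derivative_of_real
        has_real_derivative_iff_has_vector_derivative[THEN iffD2] bounded_linear.has_vector_derivative[OF bounded_linear_Im] smooth_has_deriv zs)
  ultimately have Q: "xderiv (nls_Q N d u) y = 2 * complex_of_real (Im (xderiv (z N d) y))"
    by (simp add: xderiv_eqI)
  have S: "nls_S N d u y = 2 * (cm y * complex_of_real (Re (z N d y)))"
    unfolding nls_S_def ratio ratio2 by (simp add: complex_eq_iff)
  show ?thesis
    unfolding nls_flow_def Q S using eps by (simp add: field_simps)
qed

end

lemma has_vector_derivative_quotient:
  fixes f g :: "real \<Rightarrow> complex"
  assumes "(f has_vector_derivative f') (at x)" "(g has_vector_derivative g') (at x)" "g x \<noteq> 0"
  shows "((\<lambda>x. f x / g x) has_vector_derivative (f' * g x - f x * g') / (g x)\<^sup>2) (at x)"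
proof -
  have "((\<lambda>x. inverse (g x)) has_vector_derivative g' * - (inverse (g x) ^ 2)) (at x)"
    using field_vector_diff_chain_at[OF assms(2) DERIV_inverse[OF assms(3)]] by (simp add: o_def power2_eq_square)
  from has_vector_derivative_mult[OF assms(1) this] show ?thesis
    using assms(3) by (simp add: divide_inverse power2_eq_square algebra_simps)
qed

lemma has_vector_derivative_cmod:
  assumes "(f has_vector_derivative f') (at x)" "f x \<noteq> 0"
  shows "((\<lambda>x. cmod (f x)) has_vector_derivative cmod (f x) * Re (f' / f x)) (at x)"
proof -
  have "((\<lambda>x. cmod (f x)) has_derivative (\<lambda>h. inner (h *\<^sub>R f') (sgn (f x)))) (at x)"
    using has_derivative_compose[OF assms(1)[unfolded has_vector_derivative_def] has_derivative_norm[OF assms(2)]] .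
  moreover have "(\<lambda>h. inner (h *\<^sub>R f') (sgn (f x))) = (\<lambda>h. h *\<^sub>R (cmod (f x) * Re (f' / f x)))"
  proof
    fix h
    have "Re (f' / f x) = (Re f' * Re (f x) + Im f' * Im (f x)) / (cmod (f x))\<^sup>2"
      by (simp add: complex_div_cnj[of f' "f x"])
    then show "inner (h *\<^sub>R f') (sgn (f x)) = h *\<^sub>R (cmod (f x) * Re (f' / f x))"
      using assms(2) by (simp add: inner_complex_def sgn_div_norm field_simps power2_eq_square)
  qed
  ultimately show ?thesis
    unfolding has_vector_derivative_def by (simp only:)
qed

section \<open>The flows of the transformed solution\<close>

lemma nls_flow_cong:
  assumes "\<And>j. j \<le> N \<Longrightarrow> d j = d' j"
  shows "nls_flow \<epsilon> N d u y = nls_flow \<epsilon> N d' u y"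
proof -
  have "nls_sum N d S u = nls_sum N d' S u" for S
    unfolding nls_sum_def[abs_def] using assms by (intro ext sum.cong) auto
  then show ?thesis
    by (simp add: nls_flow_def nls_S_def nls_Q_def[abs_def])
qed

lemma nls_flow_0 [simp]: "nls_flow \<epsilon> N (\<lambda>j. 0) u y = 0"
proof -
  have "nls_Q N (\<lambda>j. 0) u = (\<lambda>_. 0)"
    by (auto simp: nls_Q_def nls_sum_def)
  then show ?thesis
    by (simp add: nls_flow_def nls_S_def nls_sum_def xderiv_def prod_eq_iff)
qed

locale nls_gp =
  fixes N :: nat and \<epsilon> :: real and q :: "(nat \<Rightarrow> real) \<Rightarrow> real \<Rightarrow> complex"
    and \<phi> :: "(nat \<Rightarrow> real) \<Rightarrow> real" and W :: "(nat \<Rightarrow> real) \<Rightarrow> real \<Rightarrow> real \<times> real"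
  assumes eps: "\<epsilon> > 0"
    and smooth: "smooth_tx N q"
    and nowhere_zero: "\<And>t x. t \<in> time_space N \<Longrightarrow> q t x \<noteq> 0"
    and nls: "nls_hierarchy N q"
    and W_cont: "\<And>T. T \<in> time_space N \<Longrightarrow> continuous_on UNIV (W T)"
    and W_decay: "\<And>T. T \<in> time_space N \<Longrightarrow> (W T \<longlongrightarrow> 0) at_top"
    and ansatz:
      "\<And>t x T X. t \<in> time_space N \<Longrightarrow> T = scaled_times \<epsilon> t \<Longrightarrow> X = sqrt 2 * \<epsilon> * x \<Longrightarrow>
         q t x = complex_of_real (1 + \<epsilon>\<^sup>2 / 2 * (fst (W T X) - snd (W T X)))
           * exp (\<i> * complex_of_real (\<epsilon> / sqrt 2 *
                 (LBINT Y=ereal 0..ereal X. fst (W T Y) + snd (W T Y))))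
           * exp (\<i> * \<phi> t)"
begin

sublocale gp \<epsilon>
  by unfold_locales (rule eps)

definition "unscaled T k = T k / time_scale \<epsilon> k"

lemma unscaled_time_space: "T \<in> time_space N \<Longrightarrow> unscaled T \<in> time_space N"
  by (simp add: unscaled_def time_space_def)

lemma scaled_unscaled: "scaled_times \<epsilon> (unscaled T) = T"
  by (simp add: scaled_times_def unscaled_def fun_eq_iff)

lemma polar_W:
  assumes "T \<in> time_space N"
  shows "polar \<epsilon> (W T) (q (unscaled T))"
proof (rule polar_ansatz[OF eps])
  note t = unscaled_time_space[OF assms]
  show "smooth (q (unscaled T))" by (rule smooth_tx_smooth[OF smooth t])
  show "q (unscaled T) y \<noteq> 0" for y by (rule nowhere_zero[OF t])
  show "continuous_on UNIV (W T)" "(W T \<longlongrightarrow> 0) at_top" using assms by (rule W_cont, rule W_decay)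
  show "q (unscaled T) y = complex_of_real (1 + \<epsilon>\<^sup>2 / 2 * (fst (W T X) - snd (W T X)))
           * exp (\<i> * complex_of_real (\<epsilon> / sqrt 2 * (LBINT Y=ereal 0..ereal X. fst (W T Y) + snd (W T Y))))
           * exp (\<i> * \<phi> (unscaled T))" if "X = sqrt 2 * \<epsilon> * y" for y X
    by (rule ansatz[OF t scaled_unscaled[symmetric] that])
qed

lemma W_line:
  assumes T: "T \<in> time_space N" and D: "D \<in> time_space N"
  shows "((\<lambda>s. cpair (W (\<lambda>k. T k + s * D k) X)) has_vector_derivative
    nls_flow \<epsilon> N (unscaled D) (q (unscaled T)) (X / (sqrt 2 * \<epsilon>))) (at 0)"
proof -
  define y where "y = X / (sqrt 2 * \<epsilon>)"
  have X: "X = sqrt 2 * \<epsilon> * y" using eps by (simp add: y_def)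
  define t d where "t = unscaled T" and "d = unscaled D"
  have t: "t \<in> time_space N" and d: "d \<in> time_space N"
    unfolding t_def d_def using T D by (simp_all add: unscaled_time_space)
  define U where "U s = q (\<lambda>k. t k + s * d k)" for s
  interpret p: polar \<epsilon> "W T" "q t"
    unfolding t_def by (rule polar_W[OF T])
  have U0: "U 0 = q t" by (simp add: U_def)
  have W: "cpair (W (\<lambda>k. T k + s * D k) X) =
    ((complex_of_real (Im (xderiv (U s) y / U s y)) + 2 * (complex_of_real (cmod (U s y)) - 1)) / (2 * (complex_of_real \<epsilon>)\<^sup>2),
     (complex_of_real (Im (xderiv (U s) y / U s y)) - 2 * (complex_of_real (cmod (U s y)) - 1)) / (2 * (complex_of_real \<epsilon>)\<^sup>2))" for s
  proof -
    have "unscaled (\<lambda>k. T k + s * D k) = (\<lambda>k. t k + s * d k)"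
      by (simp add: unscaled_def t_def d_def fun_eq_iff add_divide_distrib)
    then have "polar \<epsilon> (W (\<lambda>k. T k + s * D k)) (U s)"
      using polar_W[OF time_space_line[OF T D, of s]] by (simp add: U_def)
    from polar.field_formula[OF this, of y] show ?thesis unfolding X .
  qed
  define G where "G = (\<lambda>y. \<i> * nls_sum N d nls_n (q t) y)"
  have dU: "((\<lambda>s. U s y) has_vector_derivative G y) (at 0)"
    and dV: "((\<lambda>s. xderiv (U s) y) has_vector_derivative xderiv G y) (at 0)"
    using nls_hierarchy_line[OF smooth nls t d] unfolding U_def G_def by auto
  have nz: "U 0 y \<noteq> 0" unfolding U0 by (rule p.u_nz)
  have G: "smooth G"
    unfolding G_def by (intro smooth_mult smooth_const smooth_nls_sum p.u)
  have "((\<lambda>y. G y / q t y) has_vector_derivative (xderiv G y * q t y - G y * xderiv (q t) y) / (q t y)\<^sup>2) (at y)"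
    by (intro has_vector_derivative_quotient smooth_has_deriv G p.u p.u_nz)
  \<comment> \<open>The time derivative of q_x / q equals the space derivative of q_t / q.\<close>
  then have z: "xderiv (\<lambda>y. G y / q t y) y = (xderiv G y * U 0 y - xderiv (U 0) y * G y) / (U 0 y)\<^sup>2"
    unfolding U0 by (simp add: xderiv_eqI mult.commute)
  have 1: "((\<lambda>s. complex_of_real (Im (xderiv (U s) y / U s y))) has_vector_derivative
      complex_of_real (Im (xderiv (\<lambda>y. G y / q t y) y))) (at 0)"
    unfolding z
    by (intro has_vector_derivative_of_real has_real_derivative_iff_has_vector_derivative[THEN iffD2]
        bounded_linear.has_vector_derivative[OF bounded_linear_Im] has_vector_derivative_quotient dU dV nz)
  have 2: "((\<lambda>s. complex_of_real (cmod (U s y))) has_vector_derivative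
      complex_of_real (cmod (q t y) * Re (G y / q t y))) (at 0)"
    using has_vector_derivative_cmod[OF dU nz] unfolding U0
    by (intro has_vector_derivative_of_real has_real_derivative_iff_has_vector_derivative[THEN iffD2])
  have "((\<lambda>s. cpair (W (\<lambda>k. T k + s * D k) X)) has_vector_derivative
    ((complex_of_real (Im (xderiv (\<lambda>y. G y / q t y) y)) + 2 * (complex_of_real (cmod (q t y) * Re (G y / q t y)) - 0)) / (2 * (complex_of_real \<epsilon>)\<^sup>2),
     (complex_of_real (Im (xderiv (\<lambda>y. G y / q t y) y)) - 2 * (complex_of_real (cmod (q t y) * Re (G y / q t y)) - 0)) / (2 * (complex_of_real \<epsilon>)\<^sup>2))) (at 0)"
    unfolding W
    by (intro has_vector_derivative_Pair has_vector_derivative_divide has_vector_derivative_add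
        has_vector_derivative_diff has_vector_derivative_mult_right has_vector_derivative_const 1 2)
  then show ?thesis
    unfolding p.nls_flow_real_imag t_def[symmetric] d_def[symmetric] y_def[symmetric] G_def by simp
qed

lemma W_shift:
  assumes T: "T \<in> time_space N" and D: "D \<in> time_space N"
    and line: "\<And>s. f s = (\<lambda>k. T k + (s - s0) * D k)"
  shows "((\<lambda>s. cpair (W (f s) X)) has_vector_derivative
    nls_flow \<epsilon> N (unscaled D) (q (unscaled T)) (X / (sqrt 2 * \<epsilon>))) (at s0)"
proof -
  have "((\<lambda>s. s - s0) has_vector_derivative 1) (at s0)"
    by (auto intro!: derivative_eq_intros)
  from vector_diff_chain_at[OF this, of "\<lambda>s. cpair (W (\<lambda>k. T k + s * D k) X)"] W_line[OF T D, of X]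
  show ?thesis by (simp add: o_def line)
qed

lemma gp_flow:
  assumes T: "T \<in> time_space N" and l: "l \<le> N"
  shows "((\<lambda>s. cpair (W (c_map N \<epsilon> (T(l := s))) X)) has_vector_derivative
    ((1 / time_scale \<epsilon> l) * (1 / (2 * \<epsilon>\<^sup>2))) *\<^sub>R
      gp_J \<epsilon> (W (c_map N \<epsilon> T)) (gp_grad (gpt_H \<epsilon> (int l)) (W (c_map N \<epsilon> T))) X) (at (T l))"
proof -
  \<comment> \<open>Moving \<open>T l\<close> moves \<open>c_map N \<epsilon> T\<close> along column
    \<open>l\<close> of the matrix.\<close>
  define D where "D = (\<lambda>j. if j \<le> N then c_matrix \<epsilon> j l else 0)"
  have cT: "c_map N \<epsilon> T \<in> time_space N" and D: "D \<in> time_space N"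
    by (simp_all add: time_space_def c_map_def D_def)
  have line: "c_map N \<epsilon> (T(l := s)) = (\<lambda>k. c_map N \<epsilon> T k + (s - T l) * D k)" for s
  proof
    fix k
    have "(\<Sum>i\<le>N. c_matrix \<epsilon> k i * (T(l := s)) i) = (\<Sum>i\<le>N. c_matrix \<epsilon> k i * T i + (if i = l then c_matrix \<epsilon> k l * (s - T l) else 0))"
      by (intro sum.cong) (auto simp: algebra_simps)
    also have "\<dots> = (\<Sum>i\<le>N. c_matrix \<epsilon> k i * T i) + c_matrix \<epsilon> k l * (s - T l)"
      using l by (simp add: sum.distrib)
    finally show "c_map N \<epsilon> (T(l := s)) k = c_map N \<epsilon> T k + (s - T l) * D k"
      by (simp add: c_map_def D_def)
  qed
  interpret p: polar \<epsilon> "W (c_map N \<epsilon> T)" "q (unscaled (c_map N \<epsilon> T))"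
    by (rule polar_W[OF cT])
  have "nls_flow \<epsilon> N (unscaled D) u y = nls_flow \<epsilon> N (\<lambda>j. c_matrix \<epsilon> j l / time_scale \<epsilon> j) u y" for u y
    by (rule nls_flow_cong) (simp add: unscaled_def D_def)
  then show ?thesis
    using W_shift[OF cT D line, of X] p.gpt_flow[OF l, of X] by simp
qed

text \<open>The transition matrix is inverted by changing the sign of its argument, since its entries
  satisfy the trinomial revision identity.\<close>

lemma transition_inverse:
  fixes a :: real
  shows "(\<Sum>m\<le>n. (((real n - 1 / 2) gchoose (n - m)) * a ^ (n - m)) *
      (if k \<le> m then ((real m - 1 / 2) gchoose (m - k)) * (- a) ^ (m - k) else 0)) = (if k = n then 1 else 0)"
proof (cases "k \<le> n")
  case True
  have split: "(((real n - 1 / 2) gchoose (n - m)) * a ^ (n - m)) * (((real m - 1 / 2) gchoose (m - k)) * (- a) ^ (m - k)) =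
      ((real n - 1 / 2) gchoose (n - k)) * (real ((n - k) choose (n - m)) * a ^ (n - m) * (- a) ^ (m - k))"
    if "k \<le> m" "m \<le> n" for m
  proof -
    have "((real n - 1 / 2) gchoose (n - k)) * (of_nat (n - k) gchoose (n - m)) =
        ((real n - 1 / 2) gchoose (n - m)) * (real n - 1 / 2 - of_nat (n - m) gchoose (n - k - (n - m)))"
      using that by (intro gbinomial_trinomial_revision) auto
    moreover have "real n - 1 / 2 - of_nat (n - m) = real m - 1 / 2" "n - k - (n - m) = m - k"
      using that by (auto simp: of_nat_diff)
    ultimately show ?thesis
      by (simp add: binomial_gbinomial mult_ac)
  qed
  have "(\<Sum>m\<le>n. (((real n - 1 / 2) gchoose (n - m)) * a ^ (n - m)) *
      (if k \<le> m then ((real m - 1 / 2) gchoose (m - k)) * (- a) ^ (m - k) else 0)) =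
      (\<Sum>m\<in>{k..n}. ((real n - 1 / 2) gchoose (n - k)) * (real ((n - k) choose (n - m)) * a ^ (n - m) * (- a) ^ (m - k)))"
    by (rule sum.mono_neutral_cong_right) (auto simp: split)
  also have "\<dots> = (\<Sum>i\<le>n - k. ((real n - 1 / 2) gchoose (n - k)) * (real ((n - k) choose i) * a ^ i * (- a) ^ (n - k - i)))"
    by (rule sum.reindex_bij_witness[of _ "\<lambda>i. n - i" "\<lambda>m. n - m"]) (use True in auto)
  \<comment> \<open>The sum is the binomial expansion of \<open>(a + - a) ^ (n - k)\<close>, which
    is zero unless \<open>k = n\<close>.\<close>
  also have "\<dots> = ((real n - 1 / 2) gchoose (n - k)) * (a + - a) ^ (n - k)"
    unfolding binomial_ring sum_distrib_left by simp
  also have "\<dots> = (if k = n then 1 else 0)"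
    using True by (simp add: power_0_left)
  finally show ?thesis .
qed (auto intro!: sum.neutral)

text \<open>The inversion identity with \<open>a = 2 / \<epsilon>^2\<close>. Expanding unit
  directions in matrix columns carries the result back from the transformed solution to
  \<open>W\<close>.\<close>

lemma unit_direction_even:
  "(if j = 2 * n then 1 else 0 :: real) =
    (\<Sum>m\<le>n. (((real n - 1 / 2) gchoose (n - m)) * (2 / \<epsilon>\<^sup>2) ^ (n - m)) * c_matrix \<epsilon> j (2 * m))"
proof (cases "even j")
  case True
  then obtain k where j: "j = 2 * k" by (elim evenE)
  have c: "c_matrix \<epsilon> j (2 * m) = (if k \<le> m then ((real m - 1 / 2) gchoose (m - k)) * (- (2 / \<epsilon>\<^sup>2)) ^ (m - k) else 0)" for m
    by (simp add: c_matrix_def j)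
  show ?thesis
    unfolding c transition_inverse by (simp add: j)
qed (auto simp: c_matrix_def intro!: sum.neutral[symmetric])

text \<open>In the absence of a column of index -1, the term \<open>m = 0\<close> stands for the
  zero direction.\<close>

lemma unit_direction_odd:
  assumes "n \<ge> 1"
  shows "(if j = 2 * n - 1 then 1 else 0 :: real) =
    (\<Sum>m\<le>n. (((real n - 1 / 2) gchoose (n - m)) * (2 / \<epsilon>\<^sup>2) ^ (n - m)) * (if m = 0 then 0 else c_matrix \<epsilon> j (2 * m - 1)))"
proof (cases "odd j")
  case True
  then obtain i where "j = 2 * i + 1" by (elim oddE)
  then obtain k where j: "j = 2 * k - 1" "k \<ge> 1" by (intro that[of "Suc i"]) auto
  have c: "(if m = 0 then 0 else c_matrix \<epsilon> j (2 * m - 1)) =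
      (if k \<le> m then ((real m - 1 / 2) gchoose (m - k)) * (- (2 / \<epsilon>\<^sup>2)) ^ (m - k) else 0)" for m
  proof (cases "m = 0")
    case False
    moreover have "(2 * k - 1 \<le> 2 * m - 1) = (k \<le> m)" using j False by auto
    moreover have "Suc (2 * k - 1) div 2 = k" "Suc (2 * m - 1) div 2 = m" using j False by auto
    ultimately show ?thesis using j by (simp add: c_matrix_def)
  qed (use j in auto)
  show ?thesis
    unfolding c transition_inverse using assms j by auto
next
  case False
  then have "(if m = 0 then 0 else c_matrix \<epsilon> j (2 * m - 1)) = 0" for m
    by (auto simp: c_matrix_def)
  moreover have "j \<noteq> 2 * n - 1" using False assms by auto
  ultimately show ?thesis by (simp only: mult_zero_right sum.neutral_const if_False)
qed

lemma unit_line: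
  assumes "l \<le> N" "T \<in> time_space N"
  shows "((\<lambda>s. cpair (W (T(l := s)) X)) has_vector_derivative
    nls_flow \<epsilon> N (\<lambda>j. (if j = l then 1 else 0) / time_scale \<epsilon> j) (q (unscaled T)) (X / (sqrt 2 * \<epsilon>))) (at (T l))"
proof -
  have D: "(\<lambda>j. if j = l then 1 else 0 :: real) \<in> time_space N"
    using assms(1) by (auto simp: time_space_def)
  have "T(l := s) = (\<lambda>k. T k + (s - T l) * (if k = l then 1 else 0))" for s
    by auto
  from W_shift[OF assms(2) D this] show ?thesis by (simp add: unscaled_def[abs_def])
qed

context
  fixes P :: "int \<Rightarrow> (gp_var, complex poly) dpoly" and T :: "nat \<Rightarrow> real" and X :: real
  assumes P: "residual_densities P" and T: "T \<in> time_space N"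
begin

interpretation p: polar \<epsilon> "W T" "q (unscaled T)"
  by (rule polar_W[OF T])

text \<open>Both sides are the velocity of the modified GP flow of index \<open>l\<close>, once in
  terms of the NLS field and once in terms of the KdV energies.\<close>

lemma column_flow:
  "l \<le> N \<Longrightarrow> nls_flow \<epsilon> N (\<lambda>j. c_matrix \<epsilon> j l / time_scale \<epsilon> j) (q (unscaled T)) (X / (sqrt 2 * \<epsilon>)) =
    kdv_flow \<epsilon> P (int l) (W T) X"
  using p.gpt_flow p.gpt_kdv_flow[OF P] by simp

lemma even_flow:
  assumes "2 * n \<le> N"
  shows "((\<lambda>s. cpair (W (T(2 * n := s)) X)) has_vector_derivative
    (\<Sum>m\<le>n. (((real n - 1 / 2) gchoose (n - m)) * (2 / \<epsilon>\<^sup>2) ^ (n - m)) *\<^sub>R kdv_flow \<epsilon> P (2 * int m) (W T) X)) (at (T (2 * n)))"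
proof -
  let ?b = "\<lambda>m. ((real n - 1 / 2) gchoose (n - m)) * (2 / \<epsilon>\<^sup>2) ^ (n - m)"
  have "(\<lambda>j. (if j = 2 * n then 1 else 0) / time_scale \<epsilon> j) =
      (\<lambda>j. \<Sum>m\<le>n. ?b m * (c_matrix \<epsilon> j (2 * m) / time_scale \<epsilon> j))"
    unfolding unit_direction_even by (simp add: sum_divide_distrib)
  then have "nls_flow \<epsilon> N (\<lambda>j. (if j = 2 * n then 1 else 0) / time_scale \<epsilon> j) (q (unscaled T)) (X / (sqrt 2 * \<epsilon>)) =
      (\<Sum>m\<le>n. ?b m *\<^sub>R nls_flow \<epsilon> N (\<lambda>j. c_matrix \<epsilon> j (2 * m) / time_scale \<epsilon> j) (q (unscaled T)) (X / (sqrt 2 * \<epsilon>)))"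
    by (simp only: nls_flow_linear[OF p.u p.u_nz])
  also have "\<dots> = (\<Sum>m\<le>n. ?b m *\<^sub>R kdv_flow \<epsilon> P (2 * int m) (W T) X)"
    using assms by (intro sum.cong refl) (simp add: column_flow)
  finally show ?thesis
    using unit_line[OF assms T, of X] by simp
qed

lemma odd_flow:
  assumes "n \<ge> 1" "2 * n - 1 \<le> N"
  shows "((\<lambda>s. cpair (W (T(2 * n - 1 := s)) X)) has_vector_derivative
    (\<Sum>m\<le>n. (((real n - 1 / 2) gchoose (n - m)) * (2 / \<epsilon>\<^sup>2) ^ (n - m)) *\<^sub>R kdv_flow \<epsilon> P (2 * int m - 1) (W T) X)) (at (T (2 * n - 1)))"
proof -
  let ?b = "\<lambda>m. ((real n - 1 / 2) gchoose (n - m)) * (2 / \<epsilon>\<^sup>2) ^ (n - m)"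
  let ?c = "\<lambda>m j. (if m = 0 then 0 else c_matrix \<epsilon> j (2 * m - 1)) / time_scale \<epsilon> j"
  have "(\<lambda>j. (if j = 2 * n - 1 then 1 else 0) / time_scale \<epsilon> j) = (\<lambda>j. \<Sum>m\<le>n. ?b m * ?c m j)"
    unfolding unit_direction_odd[OF assms(1)] by (simp add: sum_divide_distrib)
  then have "nls_flow \<epsilon> N (\<lambda>j. (if j = 2 * n - 1 then 1 else 0) / time_scale \<epsilon> j) (q (unscaled T)) (X / (sqrt 2 * \<epsilon>)) =
      (\<Sum>m\<le>n. ?b m *\<^sub>R nls_flow \<epsilon> N (?c m) (q (unscaled T)) (X / (sqrt 2 * \<epsilon>)))"
    by (simp only: nls_flow_linear[OF p.u p.u_nz])
  also have "\<dots> = (\<Sum>m\<le>n. ?b m *\<^sub>R kdv_flow \<epsilon> P (2 * int m - 1) (W T) X)"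
  proof (intro sum.cong refl)
    fix m
    assume "m \<in> {..n}"
    then have "nls_flow \<epsilon> N (?c m) (q (unscaled T)) (X / (sqrt 2 * \<epsilon>)) = kdv_flow \<epsilon> P (2 * int m - 1) (W T) X"
    \<comment> \<open>For \<open>m = 0\<close> both sides vanish: the direction on the left is zero,
      and so is the flow of index -1 on the right.\<close>
    proof (cases "m = 0")
      case False
      then have "int (2 * m - 1) = 2 * int m - 1" by simp
      then show ?thesis
        using column_flow[of "2 * m - 1"] \<open>m \<in> {..n}\<close> assms(2) False by simp
    qed (simp add: p.kdv_flow_minus_one[OF P])
    then show "?b m *\<^sub>R nls_flow \<epsilon> N (?c m) (q (unscaled T)) (X / (sqrt 2 * \<epsilon>)) = ?b m *\<^sub>R kdv_flow \<epsilon> P (2 * int m - 1) (W T) X"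
      by simp
  qed
  finally show ?thesis
    using unit_line[OF assms(2) T, of X] by simp
qed

end

end

lemma kdv_flow_nat:
  "kdv_flow \<epsilon> P (int n) w X =
     (- ((- 1) ^ n) * (1 / 2) * xderiv (kdv_E_deriv \<lfloor>(real n - 1) / 2\<rfloor> (\<lambda>Y. complex_of_real (fst (w Y)))) X,
      - (1 / 2) * xderiv (kdv_E_deriv \<lfloor>(real n - 1) / 2\<rfloor> (\<lambda>Y. - complex_of_real (snd (w Y)))) X)
     + \<epsilon>\<^sup>2 *\<^sub>R residual \<epsilon> P (int n) w X"
proof -
  have "\<lfloor>(real n - 1) / 2\<rfloor> = (int n - 1) div 2"
    using floor_divide_of_int_eq[of "int n - 1" 2, where 'a = real] by simp
  then show ?thesis by (simp add: kdv_flow_def)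
qed

lemma kdv_flow_even:
  "kdv_flow \<epsilon> P (2 * int m) w X =
     (- (1 / 2) * xderiv (kdv_E_deriv (int m - 1) (\<lambda>Y. complex_of_real (fst (w Y)))) X,
      - (1 / 2) * xderiv (kdv_E_deriv (int m - 1) (\<lambda>Y. - complex_of_real (snd (w Y)))) X)
     + \<epsilon>\<^sup>2 *\<^sub>R residual \<epsilon> P (2 * int m) w X"
proof -
  have "(2 * int m - 1) div 2 = int m - 1" by simp
  then show ?thesis by (simp add: kdv_flow_def)
qed

lemma kdv_flow_odd:
  "kdv_flow \<epsilon> P (2 * int m - 1) w X =
     (1 / 2 * xderiv (kdv_E_deriv (int m - 1) (\<lambda>Y. complex_of_real (fst (w Y)))) X,
      - (1 / 2) * xderiv (kdv_E_deriv (int m - 1) (\<lambda>Y. - complex_of_real (snd (w Y)))) X)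
     + \<epsilon>\<^sup>2 *\<^sub>R residual \<epsilon> P (2 * int m - 1) w X"
proof -
  have "(2 * int m - 1 - 1) div 2 = int m - 1" by simp
  then show ?thesis by (simp add: kdv_flow_def)
qed

theorem theorem1p8:
  fixes N :: nat and \<epsilon> :: real
    and q :: "(nat \<Rightarrow> real) \<Rightarrow> real \<Rightarrow> complex"
    and \<psi> \<phi> :: "(nat \<Rightarrow> real) \<Rightarrow> real"
    and q_minus q_plus :: complex
    and W :: "(nat \<Rightarrow> real) \<Rightarrow> real \<Rightarrow> real \<times> real"
    and P :: "int \<Rightarrow> (gp_var, complex poly) dpoly"
  assumes eps: "\<epsilon> > 0"
    and smooth: "smooth_tx N q"
    and nowhere_zero: "\<And>t x. t \<in> time_space N \<Longrightarrow> q t x \<noteq> 0"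
    and unit_limits: "norm q_minus = 1" "norm q_plus = 1"
    and bc_minus:
      "\<And>t. t \<in> time_space N \<Longrightarrow> ((\<lambda>x. q t x * exp (- \<i> * \<psi> t)) \<longlongrightarrow> q_minus) at_bot"
    and bc_plus:
      "\<And>t. t \<in> time_space N \<Longrightarrow> ((\<lambda>x. q t x * exp (- \<i> * \<psi> t)) \<longlongrightarrow> q_plus) at_top"
    and nls: "nls_hierarchy N q"
    and W_cont: "\<And>T. T \<in> time_space N \<Longrightarrow> continuous_on UNIV (W T)"
    and W_decay: "\<And>T. T \<in> time_space N \<Longrightarrow> (W T \<longlongrightarrow> 0) at_bot"
      "\<And>T. T \<in> time_space N \<Longrightarrow> (W T \<longlongrightarrow> 0) at_top"
    and ansatz:
      "\<And>t x T X. t \<in> time_space N \<Longrightarrow> T = scaled_times \<epsilon> t \<Longrightarrow> X = sqrt 2 * \<epsilon> * x \<Longrightarrow>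
         q t x = complex_of_real (1 + \<epsilon>\<^sup>2 / 2 * (fst (W T X) - snd (W T X)))
           * exp (\<i> * complex_of_real (\<epsilon> / sqrt 2 *
                 (LBINT Y=ereal 0..ereal X. fst (W T Y) + snd (W T Y))))
           * exp (\<i> * \<phi> t)"
    and P: "residual_densities P"
  shows "gpt_hierarchy N \<epsilon> (\<lambda>T. W (c_map N \<epsilon> T))
     \<and> (\<forall>n\<le>N. \<forall>T\<in>time_space N. \<forall>X.
       ((\<lambda>s. cpair (W (c_map N \<epsilon> (T(n := s))) X)) has_vector_derivative
          (- ((- 1) ^ n) * (1 / 2) *
             xderiv (kdv_E_deriv \<lfloor>(real n - 1) / 2\<rfloor> (\<lambda>Y. complex_of_real (fst (W (c_map N \<epsilon> T) Y)))) X,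
           - (1 / 2) *
             xderiv (kdv_E_deriv \<lfloor>(real n - 1) / 2\<rfloor> (\<lambda>Y. - complex_of_real (snd (W (c_map N \<epsilon> T) Y)))) X)
          + \<epsilon>\<^sup>2 *\<^sub>R residual \<epsilon> P (int n) (W (c_map N \<epsilon> T)) X) (at (T n)))
     \<and> (\<forall>n. 2 * n \<le> N \<longrightarrow> (\<forall>T\<in>time_space N. \<forall>X.
       ((\<lambda>s. cpair (W (T(2 * n := s)) X)) has_vector_derivative
          (\<Sum>m\<le>n. (((real n - 1 / 2) gchoose (n - m)) * (2 / \<epsilon>\<^sup>2) ^ (n - m)) *\<^sub>R
             ((- (1 / 2) *
                 xderiv (kdv_E_deriv (int m - 1) (\<lambda>Y. complex_of_real (fst (W T Y)))) X,
               - (1 / 2) *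
                 xderiv (kdv_E_deriv (int m - 1) (\<lambda>Y. - complex_of_real (snd (W T Y)))) X)
              + \<epsilon>\<^sup>2 *\<^sub>R residual \<epsilon> P (2 * int m) (W T) X))) (at (T (2 * n)))))
     \<and> (\<forall>n\<ge>1. 2 * n - 1 \<le> N \<longrightarrow> (\<forall>T\<in>time_space N. \<forall>X.
       ((\<lambda>s. cpair (W (T(2 * n - 1 := s)) X)) has_vector_derivative
          (\<Sum>m\<le>n. (((real n - 1 / 2) gchoose (n - m)) * (2 / \<epsilon>\<^sup>2) ^ (n - m)) *\<^sub>R
             ((1 / 2 *
                 xderiv (kdv_E_deriv (int m - 1) (\<lambda>Y. complex_of_real (fst (W T Y)))) X,
               - (1 / 2) *
                 xderiv (kdv_E_deriv (int m - 1) (\<lambda>Y. - complex_of_real (snd (W T Y)))) X)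
              + \<epsilon>\<^sup>2 *\<^sub>R residual \<epsilon> P (2 * int m - 1) (W T) X))) (at (T (2 * n - 1)))))"
proof -
  interpret g: nls_gp N \<epsilon> q \<phi> W
    by unfold_locales (fact eps smooth nowhere_zero nls W_cont W_decay(2) ansatz)+
  have c: "c_map N \<epsilon> T \<in> time_space N" for T
    by (simp add: time_space_def c_map_def)
  have kdv: "((1 / time_scale \<epsilon> n) * (1 / (2 * \<epsilon>\<^sup>2))) *\<^sub>R
      gp_J \<epsilon> (W (c_map N \<epsilon> T)) (gp_grad (gpt_H \<epsilon> (int n)) (W (c_map N \<epsilon> T))) X =
      kdv_flow \<epsilon> P (int n) (W (c_map N \<epsilon> T)) X" for n T X
    by (rule polar.gpt_kdv_flow[OF g.polar_W[OF c] P])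
  show ?thesis
    unfolding gpt_hierarchy_def kdv_flow_nat[symmetric] kdv_flow_even[symmetric] kdv_flow_odd[symmetric]
    using g.gp_flow g.gp_flow[unfolded kdv] g.even_flow[OF P] g.odd_flow[OF P] by blast
qed

end
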